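(* Let $\delta$ be a matrix of free polynomials in $d$ variables, let $\psi_1,\dots,\psi_k\in H^\infty(G_\delta)$, and suppose that for some $\varepsilon>0$, $\sum_{j=1}^k\psi_j(x)^*\psi_j(x)\ge\varepsilon^2 I_{\mathbb C^n}$ for all $n$ and all $x\in G_\delta\cap\mathcal M_n^d$. Then there exist $\omega_1,\dots,\omega_k\in H^\infty(G_\delta)$ with $\sup_{x\in G_\delta}\|(\omega_1(x),\dots,\omega_k(x))\|\le 1/\varepsilon$ (the norm of the row operator $\mathbb C^n\otimes\mathbb C^k\to\mathbb C^n$) such that $\sum_{j=1}^k\omega_j(x)\psi_j(x)=I_{\mathbb C^n}$ for all $n$ and all $x\in G_\delta\cap\mathcal M_n^d$.
   Context: $\mathcal M^d=\bigcup_n\mathcal M_n^d$ ($d$-tuples of $n\times n$ complex matrices); $G_\delta=\{M\in\mathcal M^d:\|\delta(M)\|<1\}$. $H^\infty(G_\delta)$ is the set of bounded nc-functions on $G_\delta$: maps $\phi$ with $\phi(x)\in\mathcal M_n$ for $x\in G_\delta\cap\mathcal M_n^d$, $\phi(x\oplus y)=\phi(x)\oplus\phi(y)$, $\phi(s^{-1}xs)=s^{-1}\phi(x)s$ whenever $s$ is invertible and $x,s^{-1}xs\in G_\delta$, and $\sup_{x\in G_\delta}\|\phi(x)\|<\infty$. *)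

theory Defs
  imports "HOL-Analysis.Analysis" "Jordan_Normal_Form.Schur_Decomposition"
begin

text \<open>Points of M^d: a d-tuple of n x n complex matrices is a list of length d of
  matrices in carrier_mat n n (we take n >= 1).\<close>

definition tuple_of :: "nat \<Rightarrow> nat \<Rightarrow> complex mat list \<Rightarrow> bool" where
  "tuple_of d n x \<longleftrightarrow> length x = d \<and> (\<forall>a\<in>set x. a \<in> carrier_mat n n)"

text \<open>Free (noncommutative) polynomials in d variables: finitely supported
  coefficient functions on words over the alphabet {0..<d}.\<close>

definition free_poly :: "nat \<Rightarrow> (nat list \<Rightarrow> complex) \<Rightarrow> bool" where
  "free_poly d p \<longleftrightarrow> finite {w. p w \<noteq> 0} \<and> (\<forall>w. p w \<noteq> 0 \<longrightarrow> set w \<subseteq> {..<d})"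

definition word_eval :: "nat \<Rightarrow> complex mat list \<Rightarrow> nat list \<Rightarrow> complex mat" where
  "word_eval n x w = foldr (\<lambda>i M. (x ! i) * M) w (1\<^sub>m n)"

definition fp_eval :: "nat \<Rightarrow> (nat list \<Rightarrow> complex) \<Rightarrow> complex mat list \<Rightarrow> complex mat" where
  "fp_eval n p x = mat n n (\<lambda>(i,j). \<Sum>w\<in>{w. p w \<noteq> 0}. p w * (word_eval n x w $$ (i,j)))"

definition fp_matrix :: "nat \<Rightarrow> nat \<Rightarrow> nat \<Rightarrow> (nat \<Rightarrow> nat \<Rightarrow> nat list \<Rightarrow> complex) \<Rightarrow> bool" where
  "fp_matrix d r s \<delta> \<longleftrightarrow> (\<forall>i<r. \<forall>j<s. free_poly d (\<delta> i j))"

definition fpm_eval :: "nat \<Rightarrow> nat \<Rightarrow> (nat \<Rightarrow> nat \<Rightarrow> nat list \<Rightarrow> complex) \<Rightarrow> nat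
    \<Rightarrow> complex mat list \<Rightarrow> complex mat" where
  "fpm_eval r s \<delta> n x = mat (r * n) (s * n)
     (\<lambda>(i,j). fp_eval n (\<delta> (i div n) (j div n)) x $$ (i mod n, j mod n))"

definition vnorm :: "complex vec \<Rightarrow> real" where
  "vnorm v = sqrt (\<Sum>i<dim_vec v. (cmod (v $ i))\<^sup>2)"

definition opnorm :: "complex mat \<Rightarrow> real" where
  "opnorm A = Sup {vnorm (A *\<^sub>v v) | v. v \<in> carrier_vec (dim_col A) \<and> vnorm v \<le> 1}"

definition G_delta :: "nat \<Rightarrow> nat \<Rightarrow> nat \<Rightarrow> (nat \<Rightarrow> nat \<Rightarrow> nat list \<Rightarrow> complex)
    \<Rightarrow> nat \<Rightarrow> complex mat list set" where
  "G_delta d r s \<delta> n = {x. tuple_of d n x \<and> opnorm (fpm_eval r s \<delta> n x) < 1}"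

definition H_inf :: "nat \<Rightarrow> nat \<Rightarrow> nat \<Rightarrow> (nat \<Rightarrow> nat \<Rightarrow> nat list \<Rightarrow> complex)
    \<Rightarrow> (complex mat list \<Rightarrow> complex mat) \<Rightarrow> bool" where
  "H_inf d r s \<delta> \<phi> \<longleftrightarrow>
     (\<forall>n\<ge>1. \<forall>x\<in>G_delta d r s \<delta> n. \<phi> x \<in> carrier_mat n n) \<and>
     (\<forall>n\<ge>1. \<forall>m\<ge>1. \<forall>x\<in>G_delta d r s \<delta> n. \<forall>y\<in>G_delta d r s \<delta> m.
        map2 (\<lambda>a b. four_block_mat a (0\<^sub>m n m) (0\<^sub>m m n) b) x y \<in> G_delta d r s \<delta> (n + m) \<longrightarrow>
        \<phi> (map2 (\<lambda>a b. four_block_mat a (0\<^sub>m n m) (0\<^sub>m m n) b) x y) =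
          four_block_mat (\<phi> x) (0\<^sub>m n m) (0\<^sub>m m n) (\<phi> y)) \<and>
     (\<forall>n\<ge>1. \<forall>x\<in>G_delta d r s \<delta> n. \<forall>S\<in>carrier_mat n n. \<forall>S'\<in>carrier_mat n n.
        S * S' = 1\<^sub>m n \<longrightarrow> S' * S = 1\<^sub>m n \<longrightarrow>
        map (\<lambda>a. S' * a * S) x \<in> G_delta d r s \<delta> n \<longrightarrow>
        \<phi> (map (\<lambda>a. S' * a * S) x) = S' * \<phi> x * S) \<and>
     (\<exists>C. \<forall>n\<ge>1. \<forall>x\<in>G_delta d r s \<delta> n. opnorm (\<phi> x) \<le> C)"

definition loewner_le :: "nat \<Rightarrow> complex mat \<Rightarrow> complex mat \<Rightarrow> bool" where
  "loewner_le n A B \<longleftrightarrow> (\<forall>v\<in>carrier_vec n.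
     Im (conjugate v \<bullet> ((B - A) *\<^sub>v v)) = 0 \<and> Re (conjugate v \<bullet> ((B - A) *\<^sub>v v)) \<ge> 0)"

definition row_op :: "nat \<Rightarrow> nat \<Rightarrow> (nat \<Rightarrow> complex mat) \<Rightarrow> complex mat" where
  "row_op n k A = mat n (n * k) (\<lambda>(i,j). A (j div n) $$ (i, j mod n))"

definition msum :: "nat \<Rightarrow> (nat \<Rightarrow> complex mat) \<Rightarrow> nat set \<Rightarrow> complex mat" where
  "msum n f J = mat n n (\<lambda>(i,j). \<Sum>l\<in>J. f l $$ (i,j))"

end

theory Submission
  imports Defs
begin

text \<open>
  Bounded nc functions are exactly the bounded graded functions that respect intertwiners:
  if \<open>W x = y W\<close> then \<open>W \<phi>(x) = \<phi>(y) W\<close>, because \<open>x \<oplus> y\<close> commutes with the unipotent block matrix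
  with corner \<open>W\<close>.

  Fix one point \<open>x\<close> of size \<open>n\<close>. A contractive left inverse of the column \<open>\<psi>\<close> at \<open>x\<close> is obtained
  as the value of a transfer function \<open>A + B \<delta> (1 - D \<delta>)\<inverse> C\<close> with contractive finite
  colligation; such a function is automatically nc and contractive on the whole domain.
  The colligation exists as soon as the Gram matrix of the entries of \<open>\<psi>(x)\<close> minus that of
  the entries of \<open>\<epsilon> I\<close>, a Hermitian form on the space of \<open>n \<times> n\<close> matrices, lies in the
  cone of forms \<open>\<Sum> F_aa - \<Sum> (\<delta> F \<delta>*)_bb + P\<close> with \<open>F\<close> and \<open>P\<close> positive semidefinite. If it does
  not, a separating form, made definite by a small perturbation and factored as \<open>S* S\<close>,
  turns the direct sum of \<open>n\<close> copies of \<open>x\<close> into a point \<open>S (x \<oplus> ... \<oplus> x) S\<inverse>\<close> of the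
  domain at which the lower bound on \<open>\<psi>\<close> fails.

  Direct sums make the one-point problems a directed family, and Tychonoff's theorem
  produces one solution for all points.
\<close>

section \<open>Positive semidefinite forms\<close>

text \<open>Strictness carries the cone argument: since \<delta>(x) has norm below 1, the trace of
  \<open>\<Sum> F_aa\<close> minus the trace of the forms built with \<delta> dominates a positive
  multiple of the trace of \<open>F\<close>. Bounded images therefore come from bounded
  \<open>F\<close>, and the distance from the target to the cone is attained. A form on matrices is
  indexed by pairs (i,j): x acts on the row index i, and j labels one of n copies of x. The direct
  sum of n copies of \<psi>(x) sends the vectorised identity to the vectorised \<psi>(x), so a
  single vector at a single point sees the whole matrix. The transfer function is normalised to be
  contractive and to send the column \<psi>(x) to \<epsilon> I; dividing by \<epsilon> is the origin
  of the bound 1/\<epsilon>. The state space of the colligation grows with the point. The limit is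
  therefore not taken among colligations but among functions of the entry index (l,x,i,j), each
  entry being confined to a disc of radius 1/\<epsilon>; every requirement involves finitely many
  entries and is closed.\<close>

definition qform :: "'i set \<Rightarrow> ('i \<times> 'i \<Rightarrow> complex) \<Rightarrow> ('i \<Rightarrow> complex) \<Rightarrow> complex" where
  "qform I A c = (\<Sum>i\<in>I. \<Sum>j\<in>I. cnj (c i) * A (i,j) * c j)"

definition herm_on :: "'i set \<Rightarrow> ('i \<times> 'i \<Rightarrow> complex) \<Rightarrow> bool" where
  "herm_on I A \<longleftrightarrow> (\<forall>i\<in>I. \<forall>j\<in>I. A (j,i) = cnj (A (i,j)))"

definition psd_on :: "'i set \<Rightarrow> ('i \<times> 'i \<Rightarrow> complex) \<Rightarrow> bool" where
  "psd_on I A \<longleftrightarrow> herm_on I A \<and> (\<forall>c. 0 \<le> Re (qform I A c))"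

lemma herm_onD: "herm_on I A \<Longrightarrow> i \<in> I \<Longrightarrow> j \<in> I \<Longrightarrow> A (j,i) = cnj (A (i,j))"
  unfolding herm_on_def by blast

lemma herm_on_cnj: "herm_on I A \<Longrightarrow> i \<in> I \<Longrightarrow> j \<in> I \<Longrightarrow> cnj (A (i,j)) = A (j,i)"
  using herm_onD[of I A i j] by argo

lemma cmod_sq: "complex_of_real ((cmod z)\<^sup>2) = cnj z * z"
  by (metis complex_norm_square mult.commute)

lemma qform_cong:
  assumes "\<And>i. i \<in> I \<Longrightarrow> c i = c' i"
    and "\<And>i j. i \<in> I \<Longrightarrow> j \<in> I \<Longrightarrow> A (i,j) = A' (i,j)"
  shows "qform I A c = qform I A' c'"
  unfolding qform_def using assms by (auto intro!: sum.cong)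

lemma qform_insert:
  assumes "finite I" "a \<notin> I" "herm_on (insert a I) A"
  shows "qform (insert a I) A c =
    cnj (c a) * A (a,a) * c a + cnj (c a) * (\<Sum>j\<in>I. A (a,j) * c j)
      + cnj (\<Sum>j\<in>I. A (a,j) * c j) * c a + qform I A c"
proof -
  have *: "A (i,a) = cnj (A (a,i))" if "i \<in> I" for i
    using herm_onD[OF assms(3)] that by blast
  have "(\<Sum>i\<in>I. cnj (c i) * A (i,a) * c a) = cnj (\<Sum>j\<in>I. A (a,j) * c j) * c a"
    unfolding cnj_sum sum_distrib_right by (intro sum.cong refl) (simp add: *)
  moreover have "(\<Sum>j\<in>I. cnj (c a) * A (a,j) * c j) = cnj (c a) * (\<Sum>j\<in>I. A (a,j) * c j)"
    unfolding sum_distrib_left by (intro sum.cong refl) simp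
  ultimately show ?thesis
    unfolding qform_def using assms(1,2) by (simp add: sum.distrib add.assoc)
qed

lemma qform_rank_one:
  "qform I (\<lambda>(i,j). cnj (s i) * s j) c = complex_of_real ((cmod (\<Sum>j\<in>I. s j * c j))\<^sup>2)"
  unfolding cmod_sq qform_def cnj_sum sum_product by (intro sum.cong refl) simp

lemma qform_diff: "qform I (\<lambda>p. A p - B p) c = qform I A c - qform I B c"
  by (simp add: qform_def ring_distribs sum_subtractf)

lemma psd_on_diag:
  assumes "finite I" "psd_on I A" "a \<in> I"
  shows "0 \<le> Re (A (a,a))" "Im (A (a,a)) = 0"
proof -
  have "qform I A (\<lambda>i. if i = a then 1 else 0) = A (a,a)"
    unfolding qform_def using assms
    by (simp add: if_distrib[of cnj] if_distrib[of "\<lambda>z. z * _"] if_distrib[of "\<lambda>z. _ * z"] sum.If_cases if_distribR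
        cong: if_cong)
  then show "0 \<le> Re (A (a,a))" using assms(2) by (metis psd_on_def)
  have "A (a,a) = cnj (A (a,a))" using assms herm_onD unfolding psd_on_def by metis
  then show "Im (A (a,a)) = 0" by (metis Reals_cnj_iff complex_is_Real_iff)
qed

lemma psd_on_subset:
  assumes "finite J" "psd_on J A" "I \<subseteq> J"
  shows "psd_on I A"
proof -
  have "qform I A c = qform J A (\<lambda>i. if i \<in> I then c i else 0)" for c
  proof -
    have "qform J A (\<lambda>i. if i \<in> I then c i else 0) =
      (\<Sum>i\<in>J. if i \<in> I then (\<Sum>j\<in>J. if j \<in> I then cnj (c i) * A (i,j) * c j else 0) else 0)"
      unfolding qform_def by (auto intro!: sum.cong)
    also have "\<dots> = qform I A c"
      using assms(1,3) by (simp add: sum.If_cases Int_absorb1 qform_def)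
    finally show ?thesis by simp
  qed
  then show ?thesis using assms unfolding psd_on_def herm_on_def by (metis subsetD)
qed

text \<open>Only the 2 x 2 block on \<open>a\<close> and \<open>j\<close> matters: at the vector
  with entries \<open>- t * A (a,j)\<close> and 1 the form has real part \<open>Re (A (j,j))\<close>
  minus \<open>2 * t\<close> times the squared modulus of \<open>A (a,j)\<close>, which becomes
  negative for large \<open>t\<close> unless that modulus is 0.\<close>

lemma psd_on_zero_diag:
  assumes "finite I" "a \<notin> I" "psd_on (insert a I) A" "A (a,a) = 0" "j \<in> I"
  shows "A (a,j) = 0"
proof (rule ccontr)
  assume nz: "A (a,j) \<noteq> 0"
  have "psd_on {a,j} A" using psd_on_subset[OF _ assms(3)] assms by auto
  then have P: "herm_on {a,j} A" "\<And>c. 0 \<le> Re (qform {a,j} A c)" by (auto simp: psd_on_def)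
  have aj: "a \<notin> {j}" using assms by auto
  define m where "m = (cmod (A (a,j)))\<^sup>2"
  have m: "m > 0" using nz by (simp add: m_def)
  have "0 \<le> - 2 * t * m + Re (A (j,j))" for t
  proof -
    let ?c = "\<lambda>i. if i = a then - complex_of_real t * A (a,j) else 1"
    have ja: "j \<noteq> a" using aj by auto
    have e: "qform {a,j} A ?c = - complex_of_real t * (cnj (A (a,j)) * A (a,j))
        - complex_of_real t * (cnj (A (a,j)) * A (a,j)) + A (j,j)"
      using qform_insert[OF _ aj P(1), of ?c] ja assms(4)
      by (simp add: qform_def)
    have e': "qform {a,j} A ?c = complex_of_real (- 2 * t * m) + A (j,j)"
      unfolding e m_def cmod_sq[symmetric] by simp
    have "Re (qform {a,j} A ?c) = - 2 * t * m + Re (A (j,j))"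
      unfolding e' by simp
    then show ?thesis using P(2)[of ?c] by linarith
  qed
  from this[of "(\<bar>Re (A (j,j))\<bar> + 1) / m"] m show False by auto
qed

text \<open>Cholesky elimination of one index at a time: the rank-one form built from row
  \<open>a\<close> is subtracted, the Schur complement on the remaining indices is again positive
  semidefinite, and its factor is extended by zero at \<open>a\<close>. The rows of \<open>S\<close>
  are indexed by \<open>I\<close> itself, so \<open>S\<close> is square and can later be
  inverted.\<close>

theorem psd_on_factor:
  assumes "finite I" "psd_on I A"
  shows "\<exists>S. \<forall>i\<in>I. \<forall>j\<in>I. A (i,j) = (\<Sum>e\<in>I. cnj (S e i) * S e j)"
  using assms
proof (induction I arbitrary: A rule: finite_induct)
  case empty
  then show ?case by simp
next
  case (insert a I)
  have H: "herm_on (insert a I) A" using insert.prems by (simp add: psd_on_def)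
  define \<alpha> where "\<alpha> = Re (A (a,a))"
  have Aa: "A (a,a) = of_real \<alpha>" and \<alpha>0: "\<alpha> \<ge> 0"
    using psd_on_diag[OF _ insert.prems, of a] insert.hyps by (auto simp: complex_eq_iff \<alpha>_def)
  \<comment> \<open>For pivot \<alpha> = 0, division by zero gives \<open>s = 0\<close>, which is
    the right value because the whole row \<open>a\<close> then vanishes.\<close>
  define s where "s = (\<lambda>j. A (a,j) / of_real (sqrt \<alpha>))"
  define B where "B = (\<lambda>p. A p - (\<lambda>(i,j). cnj (s i) * s j) p)"
  have hB: "herm_on I B"
    unfolding herm_on_def
  proof (intro ballI)
    fix i j assume "i \<in> I" "j \<in> I"
    then have "A (j,i) = cnj (A (i,j))" using herm_onD[OF H] by blast
    then show "B (j,i) = cnj (B (i,j))" by (simp add: B_def)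
  qed
  have row: "A (a,j) = cnj (s a) * s j" if "j \<in> insert a I" for j
  proof (cases "\<alpha> = 0")
    case True
    then show ?thesis
      using psd_on_zero_diag[OF insert.hyps(1,2) insert.prems] Aa that by (auto simp: s_def)
  next
    case False
    then have "complex_of_real (sqrt \<alpha>) * complex_of_real (sqrt \<alpha>) = of_real \<alpha>"
      using \<alpha>0 by (metis abs_of_nonneg of_real_mult real_sqrt_mult_self)
    then show ?thesis using False \<alpha>0 by (simp add: s_def Aa field_simps)
  qed
  have qB: "0 \<le> Re (qform I B c)" for c
  proof -
    define m where "m = (\<Sum>j\<in>I. A (a,j) * c j)"
    have qB: "qform I B c = qform I A c - of_real ((cmod (\<Sum>j\<in>I. s j * c j))\<^sup>2)"
      unfolding B_def qform_diff qform_rank_one ..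
    have sm: "(\<Sum>j\<in>I. s j * c j) = m / of_real (sqrt \<alpha>)"
      by (simp add: s_def m_def sum_divide_distrib)
    show ?thesis
    proof (cases "\<alpha> = 0")
      case True
      have "0 \<le> Re (qform I A c)" using psd_on_subset[OF _ insert.prems, of I] insert.hyps
        by (auto simp: psd_on_def)
      then show ?thesis unfolding qB sm using True by simp
    next
      case False
      \<comment> \<open>This value at \<open>a\<close> minimises the form in that coordinate; the
        minimum is the Schur complement evaluated at \<open>c\<close>.\<close>
      let ?c = "c(a := - m / of_real \<alpha>)"
      have c1: "(\<Sum>j\<in>I. A (a,j) * ?c j) = m"
        unfolding m_def using insert.hyps by (auto intro!: sum.cong)
      have c2: "qform I A ?c = qform I A c"
        using insert.hyps by (intro qform_cong) auto
      have "qform (insert a I) A ?c = cnj (?c a) * A (a,a) * ?c a + cnj (?c a) * m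
          + cnj m * ?c a + qform I A c"
        using qform_insert[OF insert.hyps(1,2) H, of ?c] unfolding c1 c2 .
      also have "\<dots> = qform I A c - cnj m * m / of_real \<alpha>"
        using False by (simp add: Aa field_simps)
      also have "\<dots> = qform I A c - of_real ((cmod m)\<^sup>2 / \<alpha>)"
        by (simp only: cmod_sq of_real_divide)
      also have "(cmod m)\<^sup>2 / \<alpha> = (cmod (m / of_real (sqrt \<alpha>)))\<^sup>2"
        using \<alpha>0 by (simp add: norm_divide power_divide)
      finally show ?thesis using insert.prems unfolding qB sm psd_on_def by metis
    qed
  qed
  from hB qB have "psd_on I B" by (simp add: psd_on_def)
  then obtain S where S: "\<And>i j. i \<in> I \<Longrightarrow> j \<in> I \<Longrightarrow> B (i,j) = (\<Sum>e\<in>I. cnj (S e i) * S e j)"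
    using insert.IH by blast
  define S' where "S' = (\<lambda>e i. if e = a then s i else if i = a then 0 else S e i)"
  have "A (i,j) = (\<Sum>e\<in>insert a I. cnj (S' e i) * S' e j)" if ij: "i \<in> insert a I" "j \<in> insert a I" for i j
  proof -
    have "(\<Sum>e\<in>insert a I. cnj (S' e i) * S' e j) =
        cnj (s i) * s j + (\<Sum>e\<in>I. if i = a \<or> j = a then 0 else cnj (S e i) * S e j)"
      using insert.hyps by (auto simp: S'_def intro!: sum.cong)
    also have "\<dots> = A (i,j)"
    proof (cases "i = a \<or> j = a")
      case True
      have "A (i,a) = cnj (s i) * s a" if "i \<in> insert a I"
        using row[OF that] herm_onD[OF H _ that, of a] by simp
      then show ?thesis using True row ij by auto
    next
      case False
      then have "i \<in> I" "j \<in> I" using ij by auto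
      then show ?thesis using False S[of i j] by (simp add: B_def algebra_simps)
    qed
    finally show ?thesis ..
  qed
  then show ?case by blast
qed

lemma qform_factor:
  assumes "finite I" "\<And>i j. i \<in> I \<Longrightarrow> j \<in> I \<Longrightarrow> A (i,j) = (\<Sum>e\<in>E. cnj (S e i) * S e j)"
  shows "qform I A c = of_real (\<Sum>e\<in>E. (cmod (\<Sum>j\<in>I. S e j * c j))\<^sup>2)"
proof -
  have "qform I A c = (\<Sum>i\<in>I. \<Sum>j\<in>I. \<Sum>e\<in>E. cnj (c i) * (cnj (S e i) * S e j) * c j)"
    unfolding qform_def by (simp add: assms(2) sum_distrib_left sum_distrib_right cong: sum.cong)
  also have "\<dots> = (\<Sum>e\<in>E. qform I (\<lambda>(i,j). cnj (S e i) * S e j) c)"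
    unfolding qform_def prod.case
    by (simp only: sum.swap[of _ E])
  also have "\<dots> = of_real (\<Sum>e\<in>E. (cmod (\<Sum>j\<in>I. S e j * c j))\<^sup>2)"
    by (simp only: qform_rank_one of_real_sum)
  finally show ?thesis .
qed

section \<open>Finite-dimensional separation and extension\<close>

text \<open>Tychonoff's theorem for the product topology on the function type. The index type is
  arbitrary; it serves both for cones of forms and for functions on all points of the
  domain.\<close>

lemma compact_function_box:
  fixes S :: "'a \<Rightarrow> 'b::topological_space set"
  assumes "\<And>i. compact (S i)"
  shows "compact {f. \<forall>i. f i \<in> S i}"
proof -
  have "compactin (product_topology (\<lambda>i. euclidean) UNIV) (PiE UNIV S)"
    using assms by (simp add: compactin_PiE)
  moreover have "PiE UNIV S = {f. \<forall>i. f i \<in> S i}" by (auto simp: PiE_def Pi_def)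
  ultimately show ?thesis by (simp add: euclidean_product_topology)
qed

text \<open>The determinant criterion for square matrices, carried from indices
  \<open>{0..<N}\<close> to an arbitrary finite index set by a bijection.\<close>

lemma finite_injective_inverse:
  fixes T :: "'i \<Rightarrow> 'i \<Rightarrow> complex"
  assumes fin: "finite I"
    and inj: "\<And>c. (\<And>i. i \<in> I \<Longrightarrow> (\<Sum>j\<in>I. T i j * c j) = 0) \<Longrightarrow> (\<And>j. j \<in> I \<Longrightarrow> c j = 0)"
  obtains R where
    "\<And>i j. i \<in> I \<Longrightarrow> j \<in> I \<Longrightarrow> (\<Sum>e\<in>I. T i e * R e j) = (if i = j then 1 else 0)"
    "\<And>i j. i \<in> I \<Longrightarrow> j \<in> I \<Longrightarrow> (\<Sum>e\<in>I. R i e * T e j) = (if i = j then 1 else 0)"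
proof -
  define N where "N = card I"
  obtain h where h: "bij_betw h {0..<N} I"
    using ex_bij_betw_nat_finite[OF fin] N_def by auto
  define h' where "h' = inv_into {0..<N} h"
  have h': "h' i < N" "h (h' i) = i" if "i \<in> I" for i
    using that h bij_betw_inv_into_right[OF h] bij_betwE[OF bij_betw_inv_into[OF h]] unfolding h'_def by auto
  have h'h: "h' (h a) = a" if "a < N" for a
    using that h bij_betw_inv_into_left[OF h] unfolding h'_def by auto
  have hI: "h a \<in> I" if "a < N" for a using that bij_betwE[OF h] by auto
  have re: "(\<Sum>a = 0..<N. f (h a)) = (\<Sum>i\<in>I. f i)" for f :: "'i \<Rightarrow> complex"
    using sum.reindex_bij_betw[OF h] .
  define A where "A = Matrix.mat N N (\<lambda>(a,b). T (h a) (h b))"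
  have A: "A \<in> carrier_mat N N" by (simp add: A_def)
  have "Determinant.det A \<noteq> 0"
  proof
    assume "Determinant.det A = 0"
    then obtain v where v: "v \<in> carrier_vec N" "v \<noteq> 0\<^sub>v N" "A *\<^sub>v v = 0\<^sub>v N"
      using det_0_iff_vec_prod_zero_field[OF A] by blast
    define c where "c i = vec_index v (h' i)" for i
    have "(\<Sum>j\<in>I. T i j * c j) = 0" if "i \<in> I" for i
    proof -
      have "0 = vec_index (A *\<^sub>v v) (h' i)" using v(3) h'(1)[OF that] by simp
      also have "\<dots> = (\<Sum>a = 0..<N. T i (h a) * vec_index v a)"
        using h'[OF that] v(1) by (simp add: A_def scalar_prod_def)
      also have "\<dots> = (\<Sum>a = 0..<N. T i (h a) * c (h a))"
        by (simp add: c_def h'h)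
      finally show ?thesis using re[of "\<lambda>j. T i j * c j"] by simp
    qed
    then have "c j = 0" if "j \<in> I" for j using inj that by blast
    then have "vec_index v a = 0" if "a < N" for a
      using that hI[OF that] h'h[OF that] unfolding c_def by metis
    then have "v = 0\<^sub>v N" using v(1) by (intro eq_vecI) auto
    with v(2) show False by simp
  qed
  then have "A \<in> Units (ring_mat TYPE(complex) N ())"
    using det_non_zero_imp_unit[OF A] by simp
  then obtain B where B: "B \<in> carrier_mat N N" "B * A = 1\<^sub>m N" "A * B = 1\<^sub>m N"
    by (auto simp: Units_def ring_mat_def)
  define R where "R i j = B $$ (h' i, h' j)" for i j
  show thesis
  proof
    fix i j assume ij: "i \<in> I" "j \<in> I"
    have eqij: "(h' i = h' j) = (i = j)" using h' ij by metis
    have "(\<Sum>e\<in>I. T i e * R e j) = (\<Sum>a = 0..<N. T i (h a) * R (h a) j)" by (rule re[symmetric])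
    also have "\<dots> = (A * B) $$ (h' i, h' j)"
      using h' ij B(1) by (simp add: A_def R_def scalar_prod_def h'h)
    finally show "(\<Sum>e\<in>I. T i e * R e j) = (if i = j then 1 else 0)"
      using h' ij by (simp add: B(3) eqij)
    have "(\<Sum>e\<in>I. R i e * T e j) = (\<Sum>a = 0..<N. R i (h a) * T (h a) j)" by (rule re[symmetric])
    also have "\<dots> = (B * A) $$ (h' i, h' j)"
      using h' ij B(1) by (simp add: A_def R_def scalar_prod_def h'h)
    finally show "(\<Sum>e\<in>I. R i e * T e j) = (if i = j then 1 else 0)"
      using h' ij by (simp add: B(2) eqij)
  qed
qed

section \<open>Inner products, least squares and extension of contractions\<close>

definition ip :: "'i set \<Rightarrow> ('i \<Rightarrow> complex) \<Rightarrow> ('i \<Rightarrow> complex) \<Rightarrow> complex" where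
  "ip A x y = (\<Sum>\<alpha>\<in>A. cnj (x \<alpha>) * y \<alpha>)"

definition nsq :: "'i set \<Rightarrow> ('i \<Rightarrow> complex) \<Rightarrow> real" where
  "nsq A x = (\<Sum>\<alpha>\<in>A. (cmod (x \<alpha>))\<^sup>2)"

lemma nsq_nonneg [simp]: "0 \<le> nsq A x"
  by (simp add: nsq_def sum_nonneg)

lemma ip_self: "ip A x x = of_real (nsq A x)"
  by (simp only: ip_def nsq_def of_real_sum cmod_sq)

lemma nsq_eq_0: "finite A \<Longrightarrow> nsq A x = 0 \<longleftrightarrow> (\<forall>\<alpha>\<in>A. x \<alpha> = 0)"
  by (simp add: nsq_def sum_nonneg_eq_0_iff)

lemma nsq_cong: "(\<And>\<alpha>. \<alpha> \<in> A \<Longrightarrow> x \<alpha> = y \<alpha>) \<Longrightarrow> nsq A x = nsq A y"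
  by (simp add: nsq_def)

lemma ip_cong: "(\<And>\<alpha>. \<alpha> \<in> A \<Longrightarrow> x \<alpha> = x' \<alpha>) \<Longrightarrow> (\<And>\<alpha>. \<alpha> \<in> A \<Longrightarrow> y \<alpha> = y' \<alpha>) \<Longrightarrow> ip A x y = ip A x' y'"
  by (simp add: ip_def)

lemma ip_cnj: "cnj (ip A x y) = ip A y x"
  by (simp add: ip_def cnj_sum mult.commute)

lemma ip_diff_right: "ip A x (\<lambda>\<alpha>. y \<alpha> - z \<alpha>) = ip A x y - ip A x z"
  by (simp add: ip_def right_diff_distrib sum_subtractf)

lemma ip_add_right: "ip A x (\<lambda>\<alpha>. y \<alpha> + z \<alpha>) = ip A x y + ip A x z"
  by (simp add: ip_def distrib_left sum.distrib)

lemma ip_add_left: "ip A (\<lambda>\<alpha>. y \<alpha> + z \<alpha>) x = ip A y x + ip A z x"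
  by (simp add: ip_def distrib_right sum.distrib)

lemma ip_scale_right: "ip A x (\<lambda>\<alpha>. c * y \<alpha>) = c * ip A x y"
  by (simp add: ip_def sum_distrib_left mult_ac)

lemma ip_sum_left: "ip A (\<lambda>\<alpha>. \<Sum>m\<in>M. g m \<alpha> * c m) x = (\<Sum>m\<in>M. cnj (c m) * ip A (g m) x)"
proof -
  have "ip A (\<lambda>\<alpha>. \<Sum>m\<in>M. g m \<alpha> * c m) x = (\<Sum>\<alpha>\<in>A. \<Sum>m\<in>M. cnj (c m) * (cnj (g m \<alpha>) * x \<alpha>))"
    unfolding ip_def cnj_sum sum_distrib_right by (intro sum.cong refl) simp
  also have "\<dots> = (\<Sum>m\<in>M. \<Sum>\<alpha>\<in>A. cnj (c m) * (cnj (g m \<alpha>) * x \<alpha>))" by (rule sum.swap)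
  finally show ?thesis by (simp add: ip_def sum_distrib_left)
qed

lemma nsq_add:
  "nsq A (\<lambda>\<alpha>. x \<alpha> + y \<alpha>) = nsq A x + nsq A y + 2 * Re (ip A x y)"
proof -
  have "complex_of_real (nsq A (\<lambda>\<alpha>. x \<alpha> + y \<alpha>)) =
      of_real (nsq A x) + of_real (nsq A y) + (ip A x y + cnj (ip A x y))"
    unfolding ip_self[symmetric] ip_cnj ip_add_left ip_add_right by simp
  also have "ip A x y + cnj (ip A x y) = of_real (2 * Re (ip A x y))"
    by (simp add: complex_add_cnj)
  finally show ?thesis by (simp only: of_real_add[symmetric] of_real_eq_iff)
qed

text \<open>The normal equations of least squares, solved in the manner of Gram-Schmidt; linear
  dependence among the \<open>g m\<close> is allowed.\<close>

lemma exists_projection_coeffs: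
  assumes "finite M" "finite A"
  shows "\<exists>c. \<forall>m\<in>M. ip A (g m) (\<lambda>\<alpha>. y \<alpha> - (\<Sum>m\<in>M. g m \<alpha> * c m)) = 0"
  using assms(1)
proof (induction M arbitrary: y rule: finite_induct)
  case empty
  then show ?case by simp
next
  case (insert b M)
  obtain cb where cb: "\<And>m. m \<in> M \<Longrightarrow> ip A (g m) (\<lambda>\<alpha>. g b \<alpha> - (\<Sum>m\<in>M. g m \<alpha> * cb m)) = 0"
    using insert.IH by blast
  obtain c where c: "\<And>m. m \<in> M \<Longrightarrow> ip A (g m) (\<lambda>\<alpha>. y \<alpha> - (\<Sum>m\<in>M. g m \<alpha> * c m)) = 0"
    using insert.IH by blast
  \<comment> \<open>\<open>e\<close> is the part of the new vector orthogonal to the old ones.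
    Adding a multiple of \<open>e\<close> to the approximation keeps the old equations and can be
    used to satisfy the new one.\<close>
  define e where "e = (\<lambda>\<alpha>. g b \<alpha> - (\<Sum>m\<in>M. g m \<alpha> * cb m))"
  define res where "res = (\<lambda>\<alpha>. y \<alpha> - (\<Sum>m\<in>M. g m \<alpha> * c m))"
  have ge: "ip A (g m) e = 0" if "m \<in> M" for m using cb that by (simp add: e_def)
  have gr: "ip A (g m) res = 0" if "m \<in> M" for m using c that by (simp add: res_def)
  have gb: "g b = (\<lambda>\<alpha>. e \<alpha> + (\<Sum>m\<in>M. g m \<alpha> * cb m))" by (simp add: e_def)
  \<comment> \<open>A vanishing \<open>e\<close> means that \<open>g b\<close> already lies in the
    span of the other vectors on \<open>A\<close>; then no correction is made.\<close>
  define t where "t = (if nsq A e = 0 then 0 else ip A e res / of_real (nsq A e))"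
  \<comment> \<open>The correction \<open>t * e\<close> rewritten in the given vectors:
    \<open>g b\<close> receives the coefficient \<open>t\<close>, the others lose
    \<open>t * cb m\<close>.\<close>
  define c' where "c' = (\<lambda>m. if m = b then t else c m - t * cb m)"
  have "(\<Sum>m\<in>insert b M. g m \<alpha> * c' m) = (\<Sum>m\<in>M. g m \<alpha> * c m) + t * e \<alpha>" for \<alpha>
  proof -
    have "(\<Sum>m\<in>M. g m \<alpha> * c' m) = (\<Sum>m\<in>M. g m \<alpha> * c m - t * (g m \<alpha> * cb m))"
      using insert.hyps by (intro sum.cong) (auto simp: c'_def algebra_simps)
    also have "\<dots> = (\<Sum>m\<in>M. g m \<alpha> * c m) - t * (\<Sum>m\<in>M. g m \<alpha> * cb m)"
      by (simp add: sum_subtractf sum_distrib_left)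
    finally show ?thesis using insert.hyps by (simp add: c'_def e_def algebra_simps)
  qed
  then have eq: "(\<lambda>\<alpha>. y \<alpha> - (\<Sum>m\<in>insert b M. g m \<alpha> * c' m)) = (\<lambda>\<alpha>. res \<alpha> - t * e \<alpha>)"
    by (simp add: res_def algebra_simps)
  have M: "ip A (g m) (\<lambda>\<alpha>. res \<alpha> - t * e \<alpha>) = 0" if "m \<in> M" for m
    by (simp add: ip_diff_right ip_scale_right ge[OF that] gr[OF that])
  have "ip A e (\<lambda>\<alpha>. res \<alpha> - t * e \<alpha>) = ip A e res - t * of_real (nsq A e)"
    by (simp add: ip_diff_right ip_scale_right ip_self)
  also have "\<dots> = 0"
  proof (cases "nsq A e = 0")
    case True
    then have "ip A e res = 0" using nsq_eq_0[OF assms(2)] by (simp add: ip_def)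
    then show ?thesis using True by simp
  qed (simp add: t_def)
  finally have E: "ip A e (\<lambda>\<alpha>. res \<alpha> - t * e \<alpha>) = 0" .
  have "ip A (g b) (\<lambda>\<alpha>. res \<alpha> - t * e \<alpha>) = 0"
    by (subst gb) (simp add: ip_add_left ip_sum_left E M)
  then show ?case using M by (intro exI[of _ c']) (auto simp: eq)
qed

text \<open>The inequality makes the assignment of \<open>h m\<close> to \<open>g m\<close> a well
  defined contraction on the span of the \<open>g m\<close>; \<open>U\<close> is this map preceded
  by the orthogonal projection onto the span. It supplies the colligation later on.\<close>

lemma contraction_extension:
  fixes g :: "'m \<Rightarrow> 'a \<Rightarrow> complex" and h :: "'m \<Rightarrow> 'b \<Rightarrow> complex"
  assumes fin: "finite M" "finite A" "finite B"
    and le: "\<And>c. nsq B (\<lambda>\<beta>. \<Sum>m\<in>M. h m \<beta> * c m) \<le> nsq A (\<lambda>\<alpha>. \<Sum>m\<in>M. g m \<alpha> * c m)"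
  obtains U where "\<And>m \<beta>. m \<in> M \<Longrightarrow> \<beta> \<in> B \<Longrightarrow> (\<Sum>\<alpha>\<in>A. U \<beta> \<alpha> * g m \<alpha>) = h m \<beta>"
    and "\<And>y. nsq B (\<lambda>\<beta>. \<Sum>\<alpha>\<in>A. U \<beta> \<alpha> * y \<alpha>) \<le> nsq A y"
proof -
  have "\<forall>y. \<exists>c. \<forall>m\<in>M. ip A (g m) (\<lambda>\<alpha>. y \<alpha> - (\<Sum>m\<in>M. g m \<alpha> * c m)) = 0"
    using exists_projection_coeffs[OF fin(1,2)] by blast
  then obtain cc where cc: "\<And>y m. m \<in> M \<Longrightarrow> ip A (g m) (\<lambda>\<alpha>. y \<alpha> - (\<Sum>m\<in>M. g m \<alpha> * cc y m)) = 0"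
    by metis
  define w where "w m \<alpha> = cc (\<lambda>\<alpha>'. if \<alpha>' = \<alpha> then 1 else 0) m" for m \<alpha>
  define W where "W y m = (\<Sum>\<alpha>\<in>A. w m \<alpha> * y \<alpha>)" for y m
  define P where "P y \<alpha> = (\<Sum>m\<in>M. g m \<alpha> * W y m)" for y \<alpha>
  define U where "U \<beta> \<alpha> = (\<Sum>m\<in>M. h m \<beta> * w m \<alpha>)" for \<beta> \<alpha>
  have orth: "ip A (g m) (\<lambda>\<alpha>. y \<alpha> - P y \<alpha>) = 0" if "m \<in> M" for m y
  proof -
    have "y \<alpha> - P y \<alpha> = (\<Sum>\<alpha>'\<in>A. y \<alpha>' * ((if \<alpha> = \<alpha>' then 1 else 0) - (\<Sum>m\<in>M. g m \<alpha> * w m \<alpha>')))"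
      if "\<alpha> \<in> A" for \<alpha>
    proof -
      have "P y \<alpha> = (\<Sum>\<alpha>'\<in>A. \<Sum>m\<in>M. y \<alpha>' * (g m \<alpha> * w m \<alpha>'))"
        unfolding P_def W_def sum_distrib_left by (subst sum.swap) (simp add: mult_ac)
      moreover have "y \<alpha> = (\<Sum>\<alpha>'\<in>A. y \<alpha>' * (if \<alpha> = \<alpha>' then 1 else 0))"
        using that fin(2) by (simp add: if_distrib cong: if_cong)
      ultimately show ?thesis
        by (simp only: right_diff_distrib sum_subtractf sum_distrib_left)
    qed
    then have "ip A (g m) (\<lambda>\<alpha>. y \<alpha> - P y \<alpha>) =
        ip A (g m) (\<lambda>\<alpha>. \<Sum>\<alpha>'\<in>A. y \<alpha>' * ((if \<alpha> = \<alpha>' then 1 else 0) - (\<Sum>m\<in>M. g m \<alpha> * w m \<alpha>')))"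
      by (intro ip_cong) auto
    also have "\<dots> = (\<Sum>\<alpha>'\<in>A. y \<alpha>' * ip A (g m) (\<lambda>\<alpha>. (if \<alpha> = \<alpha>' then 1 else 0) - (\<Sum>m\<in>M. g m \<alpha> * w m \<alpha>')))"
      unfolding ip_def sum_distrib_left by (subst sum.swap) (simp add: mult_ac)
    also have "\<dots> = 0"
      using cc[OF that] unfolding w_def by simp
    finally show ?thesis .
  qed
  have orthP: "ip A (\<lambda>\<alpha>. \<Sum>m\<in>M. g m \<alpha> * c m) (\<lambda>\<alpha>. y \<alpha> - P y \<alpha>) = 0" for c y
    by (simp add: ip_sum_left orth)
  have Pc: "nsq A (P y) \<le> nsq A y" for y
  proof -
    have "nsq A y = nsq A (\<lambda>\<alpha>. P y \<alpha> + (y \<alpha> - P y \<alpha>))" by simp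
    also have "\<dots> = nsq A (P y) + nsq A (\<lambda>\<alpha>. y \<alpha> - P y \<alpha>) + 2 * Re (ip A (P y) (\<lambda>\<alpha>. y \<alpha> - P y \<alpha>))"
      by (rule nsq_add)
    also have "ip A (P y) (\<lambda>\<alpha>. y \<alpha> - P y \<alpha>) = 0" using orthP[of "W y" y] unfolding P_def .
    finally show ?thesis by simp
  qed
  have U: "(\<Sum>\<alpha>\<in>A. U \<beta> \<alpha> * y \<alpha>) = (\<Sum>m\<in>M. h m \<beta> * W y m)" for \<beta> y
    unfolding U_def W_def sum_distrib_left sum_distrib_right by (subst sum.swap) (simp add: mult_ac)
  show thesis
  proof
    fix y show "nsq B (\<lambda>\<beta>. \<Sum>\<alpha>\<in>A. U \<beta> \<alpha> * y \<alpha>) \<le> nsq A y"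
      unfolding U using le[of "W y"] Pc[of y] unfolding P_def by linarith
  next
    fix m \<beta> assume m: "m \<in> M" and \<beta>: "\<beta> \<in> B"
    define c where "c m' = W (g m) m' - (if m' = m then 1 else 0)" for m'
    have gc: "(\<Sum>m\<in>M. f m * c m) = (\<Sum>m\<in>M. f m * W (g m') m) - f m'" if "m' = m" for f :: "'m \<Rightarrow> complex" and m'
    proof -
      have "(\<Sum>m\<in>M. f m * c m) = (\<Sum>m'\<in>M. f m' * W (g m) m' - (if m' = m then f m' else 0))"
        by (intro sum.cong refl) (simp add: c_def right_diff_distrib)
      then show ?thesis using m fin(1) that by (simp add: sum_subtractf)
    qed
    have "ip A (\<lambda>\<alpha>. g m \<alpha> - P (g m) \<alpha>) (\<lambda>\<alpha>. g m \<alpha> - P (g m) \<alpha>) = 0"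
    proof -
      have "(\<lambda>\<alpha>. g m \<alpha> - P (g m) \<alpha>) = (\<lambda>\<alpha>. \<Sum>m\<in>M. g m \<alpha> * - c m)"
        by (simp add: P_def sum_negf gc[OF refl])
      then show ?thesis using orthP by metis
    qed
    then have "\<forall>\<alpha>\<in>A. g m \<alpha> - P (g m) \<alpha> = 0" by (simp add: ip_self nsq_eq_0[OF fin(2)])
    then have "nsq A (\<lambda>\<alpha>. \<Sum>m\<in>M. g m \<alpha> * c m) = 0"
      by (simp add: nsq_eq_0[OF fin(2)] gc[OF refl] P_def)
    with le[of c] have "nsq B (\<lambda>\<beta>. \<Sum>m\<in>M. h m \<beta> * c m) = 0"
      using nsq_nonneg[of B "\<lambda>\<beta>. \<Sum>m\<in>M. h m \<beta> * c m"] by linarith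
    then have "(\<Sum>m\<in>M. h m \<beta> * c m) = 0" using \<beta> by (simp add: nsq_eq_0[OF fin(3)])
    then show "(\<Sum>\<alpha>\<in>A. U \<beta> \<alpha> * g m \<alpha>) = h m \<beta>" unfolding U by (simp add: gc[OF refl])
  qed
qed

section \<open>The nearest point of a cone and its separating functional\<close>

lemma nonneg_of_small_quadratic:
  fixes a b :: real
  assumes "\<And>t. 0 < t \<Longrightarrow> t \<le> 1 \<Longrightarrow> 0 \<le> t * a + t\<^sup>2 * b"
  shows "0 \<le> a"
proof (rule ccontr)
  assume "\<not> 0 \<le> a"
  then have a: "a < 0" by simp
  \<comment> \<open>Small enough for the linear term to outweigh the quadratic one:
    \<open>t * \<bar>b\<bar>\<close> stays below half of \<open>- a\<close>.\<close>
  define t where "t = min 1 (- a / (2 * (\<bar>b\<bar> + 1)))"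
  have d: "0 < 2 * (\<bar>b\<bar> + 1)" by simp
  have "t \<le> - a / (2 * (\<bar>b\<bar> + 1))" by (simp add: t_def)
  then have t3: "t * (2 * (\<bar>b\<bar> + 1)) \<le> - a" using pos_le_divide_eq[OF d] by blast
  have "0 < - a / (2 * (\<bar>b\<bar> + 1))" using a d by (intro divide_pos_pos) auto
  then have t: "0 < t" "t \<le> 1" by (auto simp: t_def)
  have "0 \<le> t * (a + t * b)" using assms[OF t(1,2)] by (simp add: power2_eq_square algebra_simps)
  then have "0 \<le> a + t * b" using t(1) by (simp add: zero_le_mult_iff)
  moreover have "t * b \<le> t * \<bar>b\<bar>" using t by (intro mult_left_mono) auto
  moreover have "0 \<le> t * \<bar>b\<bar>" using t by simp
  moreover have "t * (2 * (\<bar>b\<bar> + 1)) = 2 * (t * \<bar>b\<bar>) + 2 * t" by (simp add: algebra_simps)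
  ultimately show False using t t3 a by linarith
qed

text \<open>\<open>F0\<close> minimises the distance from \<open>L F\<close> to \<open>Q\<close>
  over the cone, and the residual at \<open>F0\<close> separates. Coercivity takes the place of
  closedness of the image cone: candidates no worse than 0 stay in a box, which is compact in the
  product topology.\<close>

theorem cone_alternative:
  fixes C :: "('u \<Rightarrow> complex) set" and L :: "('u \<Rightarrow> complex) \<Rightarrow> 'p \<Rightarrow> complex"
  assumes P: "finite P" and C: "closed C" "(\<lambda>_. 0) \<in> C"
    and add: "\<And>F G t. F \<in> C \<Longrightarrow> G \<in> C \<Longrightarrow> 0 \<le> t \<Longrightarrow> (\<lambda>u. F u + of_real t * G u) \<in> C"
    and lin: "\<And>F G t p. p \<in> P \<Longrightarrow> L (\<lambda>u. F u + of_real t * G u) p = L F p + of_real t * L G p"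
    and cont: "\<And>p. p \<in> P \<Longrightarrow> continuous_on UNIV (\<lambda>F. L F p)"
    and coer: "0 \<le> B" "\<And>F u. F \<in> C \<Longrightarrow> cmod (F u) \<le> B * (\<Sum>p\<in>P. cmod (L F p))"
    and no: "\<not> (\<exists>F\<in>C. \<forall>p\<in>P. L F p = Q p)"
  obtains F0 where "F0 \<in> C" "\<And>F. F \<in> C \<Longrightarrow> 0 \<le> Re (ip P (\<lambda>p. L F0 p - Q p) (L F))"
    "Re (ip P (\<lambda>p. L F0 p - Q p) Q) < 0"
proof -
  define g where "g F = nsq P (\<lambda>p. L F p - Q p)" for F
  have L0: "L (\<lambda>_. 0) p = 0" if "p \<in> P" for p
    using lin[OF that, of "\<lambda>_. 0" 1 "\<lambda>_. 0"] by simp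
  then have g0: "g (\<lambda>_. 0) = nsq P Q" by (simp add: g_def nsq_def)
  \<comment> \<open>If \<open>L F\<close> is at least as close to \<open>Q\<close> as 0 is, each
    \<open>L F p\<close> has modulus at most \<open>sqrt (nsq P Q) + cmod (Q p)\<close>; coercivity
    turns this into the bound \<open>b\<close> on every entry of \<open>F\<close>.\<close>
  define b where "b = B * (\<Sum>p\<in>P. sqrt (nsq P Q) + cmod (Q p))"
  have b0: "0 \<le> b" unfolding b_def using coer(1) by (intro mult_nonneg_nonneg sum_nonneg) auto
  have bd: "cmod (F u) \<le> b" if "F \<in> C" "g F \<le> nsq P Q" for F u
  proof -
    have "cmod (L F p) \<le> sqrt (nsq P Q) + cmod (Q p)" if p: "p \<in> P" for p
    proof -
      have "(cmod (L F p - Q p))\<^sup>2 \<le> g F" unfolding g_def nsq_def using P p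
        by (intro member_le_sum) auto
      then have "cmod (L F p - Q p) \<le> sqrt (nsq P Q)"
        using \<open>g F \<le> nsq P Q\<close> by (intro real_le_rsqrt) simp
      then show ?thesis using norm_triangle_ineq2[of "L F p" "Q p"] by linarith
    qed
    then have "(\<Sum>p\<in>P. cmod (L F p)) \<le> (\<Sum>p\<in>P. sqrt (nsq P Q) + cmod (Q p))"
      by (rule sum_mono)
    then show ?thesis unfolding b_def using coer(2)[OF that(1), of u] coer(1)
      by (meson mult_left_mono order_trans)
  qed
  define K where "K = {F. \<forall>u. F u \<in> cball 0 b} \<inter> C"
  have "compact K" unfolding K_def by (intro compact_Int_closed compact_function_box C) simp
  moreover have "(\<lambda>_. 0) \<in> K" using C b0 by (simp add: K_def)
  moreover have "continuous_on K g"
    unfolding g_def nsq_def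
    by (intro continuous_intros continuous_on_subset[OF cont]) auto
  ultimately obtain F0 where F0: "F0 \<in> K" "\<And>F. F \<in> K \<Longrightarrow> g F0 \<le> g F"
    using continuous_attains_inf[of K g] by blast
  have F0C: "F0 \<in> C" using F0 by (simp add: K_def)
  have min: "g F0 \<le> g F" if "F \<in> C" for F
  proof (cases "g F \<le> nsq P Q")
    case True
    then show ?thesis using bd[OF that True] that by (intro F0(2)) (simp add: K_def)
  next
    case False
    then show ?thesis using F0(2)[OF \<open>(\<lambda>_. 0) \<in> K\<close>] g0 by linarith
  qed
  define H where "H p = L F0 p - Q p" for p
  have var: "g (\<lambda>u. F0 u + of_real t * G u) = g F0 + (t * (2 * Re (ip P H (L G))) + t\<^sup>2 * nsq P (L G))" for t G
  proof -
    have "g (\<lambda>u. F0 u + of_real t * G u) = nsq P (\<lambda>p. H p + of_real t * L G p)"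
      unfolding g_def by (intro nsq_cong) (simp add: lin H_def)
    also have "\<dots> = nsq P H + nsq P (\<lambda>p. of_real t * L G p) + 2 * Re (of_real t * ip P H (L G))"
      by (simp only: nsq_add ip_scale_right)
    also have "nsq P (\<lambda>p. of_real t * L G p) = t\<^sup>2 * nsq P (L G)"
      by (simp add: nsq_def norm_mult power_mult_distrib sum_distrib_left)
    finally show ?thesis by (simp add: g_def H_def[abs_def])
  qed
  have "0 \<le> Re (ip P H (L G))" if "G \<in> C" for G
  proof -
    have "0 \<le> t * (2 * Re (ip P H (L G))) + t\<^sup>2 * nsq P (L G)" if "0 < t" for t
      using min[OF add[OF F0C \<open>G \<in> C\<close>, of t]] that unfolding var by simp
    then have "0 \<le> 2 * Re (ip P H (L G))" by (rule nonneg_of_small_quadratic)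
    then show ?thesis by simp
  qed
  moreover have "Re (ip P H Q) < 0"
  proof -
    \<comment> \<open>Radial variation: \<open>F0\<close> shrunk by the factor \<open>1 - t\<close>
      remains in the cone for \<open>t \<le> 1\<close>. So the residual pairs with
      \<open>L F0\<close> to something of real part at most 0, and with \<open>Q = L F0 - H\<close>
      to that minus the squared norm of \<open>H\<close>.\<close>
    have "0 \<le> t * (- (2 * Re (ip P H (L F0)))) + t\<^sup>2 * nsq P (L F0)" if t: "0 < t" "t \<le> 1" for t
    proof -
      have "(\<lambda>u. 0 + of_real (1 - t) * F0 u) \<in> C" using t by (intro add C F0C) auto
      moreover have "(\<lambda>u. 0 + of_real (1 - t) * F0 u) = (\<lambda>u. F0 u + of_real (-t) * F0 u)"
        by (simp add: algebra_simps)
      ultimately have "g F0 \<le> g (\<lambda>u. F0 u + of_real (-t) * F0 u)" using min by simp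
      then show ?thesis unfolding var by simp
    qed
    then have "0 \<le> - (2 * Re (ip P H (L F0)))" by (rule nonneg_of_small_quadratic)
    moreover have "ip P H (L F0) = ip P H Q + of_real (nsq P H)"
      unfolding ip_self[symmetric] ip_add_right[symmetric] by (intro ip_cong) (auto simp: H_def)
    moreover have "nsq P H \<noteq> 0"
      using no F0C nsq_eq_0[OF P, of H] by (auto simp: H_def)
    then have "0 < nsq P H" using nsq_nonneg[of P H] by linarith
    ultimately show ?thesis by simp
  qed
  ultimately show thesis using that[OF F0C] unfolding H_def by blast
qed

section \<open>A Farkas alternative for Gram matrices\<close>

definition outer :: "('u \<Rightarrow> complex) \<Rightarrow> 'u \<times> 'u \<Rightarrow> complex" where
  "outer f = (\<lambda>(u,v). f u * cnj (f v))"

definition mat_app :: "'u set \<Rightarrow> ('p \<Rightarrow> 'u \<Rightarrow> complex) \<Rightarrow> ('u \<Rightarrow> complex) \<Rightarrow> 'p \<Rightarrow> complex" where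
  "mat_app J M f p = (\<Sum>u\<in>J. M p u * f u)"

text \<open>The matrix product M F M*, which maps forms on \<open>J\<close> to forms on the row
  indices of \<open>M\<close>.\<close>

definition congruence :: "'u set \<Rightarrow> ('p \<Rightarrow> 'u \<Rightarrow> complex) \<Rightarrow> ('u \<times> 'u \<Rightarrow> complex) \<Rightarrow> 'p \<times> 'p \<Rightarrow> complex" where
  "congruence J M F = (\<lambda>(p,q). \<Sum>u\<in>J. \<Sum>v\<in>J. M p u * cnj (M q v) * F (u,v))"

lemma congruence_outer: "congruence J M (outer f) = outer (mat_app J M f)"
proof -
  have "(\<Sum>u\<in>J. M p u * f u) * (\<Sum>v\<in>J. cnj (M q v * f v)) =
      (\<Sum>u\<in>J. \<Sum>v\<in>J. M p u * cnj (M q v) * (f u * cnj (f v)))" for p q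
    unfolding sum_product by (intro sum.cong refl) simp
  then show ?thesis by (auto simp: congruence_def outer_def mat_app_def cnj_sum)
qed

lemma congruence_cong: "(\<And>u v. u \<in> J \<Longrightarrow> v \<in> J \<Longrightarrow> F (u,v) = G (u,v)) \<Longrightarrow> congruence J M F = congruence J M G"
  by (simp add: congruence_def)

lemma congruence_sum: "congruence J M (\<lambda>w. \<Sum>e\<in>E. G e w) w = (\<Sum>e\<in>E. congruence J M (G e) w)"
  by (cases w) (simp only: congruence_def prod.case sum_distrib_left sum.swap[of _ E])

lemma congruence_lin: "congruence J M (\<lambda>w. F w + t * G w) w = congruence J M F w + t * congruence J M G w"
proof (cases w)
  case (Pair p q)
  have "(\<Sum>u\<in>J. \<Sum>v\<in>J. M p u * cnj (M q v) * (F (u,v) + t * G (u,v))) =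
    (\<Sum>u\<in>J. \<Sum>v\<in>J. M p u * cnj (M q v) * F (u,v) + t * (M p u * cnj (M q v) * G (u,v)))"
    by (intro sum.cong refl) (simp add: algebra_simps)
  then show ?thesis unfolding Pair congruence_def prod.case by (simp only: sum.distrib sum_distrib_left)
qed

lemma congruence_herm:
  assumes "herm_on J F"
  shows "congruence J M F (q,p) = cnj (congruence J M F (p,q))"
proof -
  have "cnj (congruence J M F (p,q)) = (\<Sum>u\<in>J. \<Sum>v\<in>J. M q v * cnj (M p u) * F (v,u))"
    unfolding congruence_def prod.case cnj_sum
    by (intro sum.cong refl) (simp add: herm_on_cnj[OF assms])
  also have "\<dots> = (\<Sum>v\<in>J. \<Sum>u\<in>J. M q v * cnj (M p u) * F (v,u))" by (rule sum.swap)
  finally show ?thesis by (simp add: congruence_def)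
qed

lemma congruence_continuous: "continuous_on UNIV (\<lambda>F. congruence J M F w)"
  by (cases w) (simp add: congruence_def continuous_intros continuous_on_product_coordinates)

lemma qform_outer: "qform I (outer f) c = of_real ((cmod (\<Sum>p\<in>I. f p * cnj (c p)))\<^sup>2)"
proof -
  have "qform I (outer f) c = of_real ((cmod (\<Sum>p\<in>I. cnj (f p) * c p))\<^sup>2)"
    using qform_rank_one[of I "\<lambda>i. cnj (f i)" c] by (simp add: outer_def)
  also have "(\<Sum>p\<in>I. cnj (f p) * c p) = cnj (\<Sum>p\<in>I. f p * cnj (c p))" by (simp add: cnj_sum)
  finally show ?thesis by (simp only: complex_mod_cnj)
qed

lemma qform_sum: "qform I (\<lambda>w. \<Sum>e\<in>E. G e w) c = (\<Sum>e\<in>E. qform I (G e) c)"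
  by (simp only: qform_def sum_distrib_left sum_distrib_right sum.swap[of _ E])

lemma qform_lin: "qform I (\<lambda>w. F w + t * G w) c = qform I F c + t * qform I G c"
proof -
  have "qform I (\<lambda>w. F w + t * G w) c =
    (\<Sum>i\<in>I. \<Sum>j\<in>I. cnj (c i) * F (i,j) * c j + t * (cnj (c i) * G (i,j) * c j))"
    unfolding qform_def by (intro sum.cong refl) (simp add: algebra_simps)
  then show ?thesis unfolding qform_def by (simp only: sum.distrib sum_distrib_left)
qed

lemma ip_sum_right: "ip A x (\<lambda>w. \<Sum>e\<in>E. G e w) = (\<Sum>e\<in>E. ip A x (G e))"
  by (simp only: ip_def sum_distrib_left sum.swap[of _ E])

text \<open>This is how a separating functional on Gram matrices is read as a quadratic form:
  pairing with the rank-one matrix of \<open>g\<close> evaluates the form at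
  \<open>g\<close>.\<close>

lemma ip_outer:
  assumes "finite I" "herm_on I H"
  shows "ip (I \<times> I) H (outer g) = qform I H g"
proof -
  have "ip (I \<times> I) H (outer g) = (\<Sum>p\<in>I. \<Sum>q\<in>I. cnj (H (p,q)) * (g p * cnj (g q)))"
    unfolding ip_def outer_def by (simp add: sum.cartesian_product split_def)
  also have "\<dots> = (\<Sum>p\<in>I. \<Sum>q\<in>I. cnj (g q) * H (q,p) * g p)"
    by (intro sum.cong refl) (simp add: herm_on_cnj[OF assms(2)])
  also have "\<dots> = qform I H g" unfolding qform_def by (rule sum.swap)
  finally show ?thesis .
qed

lemma closed_psd_on: "closed {F. psd_on J F}"
proof -
  have "{F. psd_on J F} = (\<Inter>i\<in>J. \<Inter>j\<in>J. {F. F (j,i) = cnj (F (i,j))}) \<inter> (\<Inter>c. {F. 0 \<le> Re (qform J F c)})"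
    by (auto simp only: psd_on_def herm_on_def)
  moreover have "closed {F :: 'a \<times> 'a \<Rightarrow> complex. F (j,i) = cnj (F (i,j))}" for i j
    by (intro closed_Collect_eq continuous_intros continuous_on_product_coordinates)
  moreover have "closed {F. 0 \<le> Re (qform J F c)}" for c
    unfolding qform_def
    by (intro closed_Collect_le continuous_intros continuous_on_product_coordinates)
  ultimately show ?thesis by (auto intro!: closed_Int closed_INT)
qed

lemma psd_on_lin:
  assumes "psd_on J F" "psd_on J G" "0 \<le> t"
  shows "psd_on J (\<lambda>u. F u + of_real t * G u)"
proof -
  have "herm_on J (\<lambda>u. F u + of_real t * G u)"
    unfolding herm_on_def
  proof (intro ballI)
    fix i j assume "i \<in> J" "j \<in> J"
    then have "F (j,i) = cnj (F (i,j))" "G (j,i) = cnj (G (i,j))"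
      using assms herm_onD unfolding psd_on_def by metis+
    then show "F (j,i) + of_real t * G (j,i) = cnj (F (i,j) + of_real t * G (i,j))" by simp
  qed
  then show ?thesis using assms by (simp add: psd_on_def qform_lin)
qed

lemma psd_on_outer: "psd_on J (outer f)"
  unfolding psd_on_def by (simp add: qform_outer) (simp add: herm_on_def outer_def)

lemma psd_on_cong:
  assumes "\<And>i j. i \<in> J \<Longrightarrow> j \<in> J \<Longrightarrow> F (i,j) = G (i,j)" "psd_on J F"
  shows "psd_on J G"
proof -
  have "qform J G c = qform J F c" for c using assms(1) by (intro qform_cong) auto
  moreover have "herm_on J G" unfolding herm_on_def
    using assms herm_onD[of J F] unfolding psd_on_def by metis
  ultimately show ?thesis using assms(2) by (simp add: psd_on_def)
qed

lemma psd_on_sum_outer: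
  assumes "finite J" "psd_on J F"
  obtains f where "\<And>i j. i \<in> J \<Longrightarrow> j \<in> J \<Longrightarrow> F (i,j) = (\<Sum>e\<in>J. outer (f e) (i,j))"
proof -
  obtain S where "\<forall>i\<in>J. \<forall>j\<in>J. F (i,j) = (\<Sum>e\<in>J. cnj (S e i) * S e j)"
    using psd_on_factor[OF assms] by blast
  then show thesis using that[of "\<lambda>e i. cnj (S e i)"] by (simp add: outer_def)
qed

text \<open>The cone alternative for the map \<open>L\<close> sending a positive semidefinite F to
  the sum of the N F N* minus the sum of the M F M*. After splitting F into rank-one terms,
  \<open>coer\<close> says that the trace of \<open>L F\<close> is at least \<kappa> times the trace
  of F, which in turn bounds each entry of F. Testing the separating residual on rank-one F gives
  the inequality of forms in the second case.\<close>

theorem gram_alternative: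
  fixes N :: "'a \<Rightarrow> 'p \<Rightarrow> 'u \<Rightarrow> complex" and M :: "'b \<Rightarrow> 'p \<Rightarrow> 'u \<Rightarrow> complex"
    and Q :: "'p \<times> 'p \<Rightarrow> complex"
  assumes fin: "finite I" "finite J"
    and \<kappa>: "\<kappa> > 0"
    and coer: "\<And>f. (\<Sum>b\<in>T2. nsq I (mat_app J (M b) f)) + \<kappa> * nsq J f \<le> (\<Sum>a\<in>T1. nsq I (mat_app J (N a) f))"
    and Qh: "herm_on I Q"
  obtains f where "\<And>p q. p \<in> I \<Longrightarrow> q \<in> I \<Longrightarrow>
      Q (p,q) = (\<Sum>e\<in>J. (\<Sum>a\<in>T1. outer (mat_app J (N a) (f e)) (p,q)) - (\<Sum>b\<in>T2. outer (mat_app J (M b) (f e)) (p,q)))"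
  | H where "herm_on I H"
    "\<And>f. (\<Sum>b\<in>T2. Re (qform I H (mat_app J (M b) f))) \<le> (\<Sum>a\<in>T1. Re (qform I H (mat_app J (N a) f)))"
    "Re (ip (I \<times> I) H Q) < 0"
proof -
  define L where "L F w = (\<Sum>a\<in>T1. congruence J (N a) F w) - (\<Sum>b\<in>T2. congruence J (M b) F w)" for F w
  \<comment> \<open>Entries outside \<open>J \<times> J\<close> are forced to 0 because coercivity
    has to bound \<open>F\<close> at every index of its type.\<close>
  define C where "C = {F. psd_on J F} \<inter> {F. \<forall>w. w \<notin> J \<times> J \<longrightarrow> F w = 0}"
  have Lrk: "L F w = (\<Sum>e\<in>E. (\<Sum>a\<in>T1. outer (mat_app J (N a) (f e)) w) - (\<Sum>b\<in>T2. outer (mat_app J (M b) (f e)) w))"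
    if "\<And>i j. i \<in> J \<Longrightarrow> j \<in> J \<Longrightarrow> F (i,j) = (\<Sum>e\<in>E. outer (f e) (i,j))" for F f w and E :: "'u set"
  proof -
    have "congruence J X F w = (\<Sum>e\<in>E. outer (mat_app J X (f e)) w)" for X :: "'p \<Rightarrow> 'u \<Rightarrow> complex"
    proof -
      have "congruence J X F = congruence J X (\<lambda>w. \<Sum>e\<in>E. outer (f e) w)" using that by (intro congruence_cong) auto
      then show ?thesis by (simp add: congruence_sum congruence_outer)
    qed
    then show ?thesis unfolding L_def sum_subtractf by (simp only: sum.swap[of _ E])
  qed
  have closed: "closed C"
  proof -
    have "{F :: 'u \<times> 'u \<Rightarrow> complex. \<forall>w. w \<notin> J \<times> J \<longrightarrow> F w = 0} = (\<Inter>w\<in>- (J \<times> J). {F. F w = 0})" by auto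
    moreover have "closed {F :: 'u \<times> 'u \<Rightarrow> complex. F w = 0}" for w
      by (intro closed_Collect_eq continuous_intros continuous_on_product_coordinates)
    ultimately show ?thesis unfolding C_def by (auto intro!: closed_Int closed_INT closed_psd_on)
  qed
  have zero: "(\<lambda>_. 0) \<in> C" by (simp add: C_def psd_on_def herm_on_def qform_def)
  have add: "(\<lambda>u. F u + of_real t * G u) \<in> C" if "F \<in> C" "G \<in> C" "0 \<le> t" for F G t
    using that by (auto simp: C_def intro: psd_on_lin)
  have lin: "L (\<lambda>u. F u + of_real t * G u) w = L F w + of_real t * L G w" for F G t w
    unfolding L_def congruence_lin sum.distrib sum_distrib_left[symmetric] by (simp add: right_diff_distrib)
  have cont: "continuous_on UNIV (\<lambda>F. L F w)" for w
    unfolding L_def by (intro continuous_intros congruence_continuous)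
  have coercive: "cmod (F w) \<le> (1 / \<kappa>) * (\<Sum>p\<in>I \<times> I. cmod (L F p))" if "F \<in> C" for F w
  proof (cases "w \<in> J \<times> J")
    case False
    then have "F w = 0" using that unfolding C_def by blast
    then show ?thesis using \<kappa> by (simp add: sum_nonneg)
  next
    case True
    then obtain u v where w: "w = (u,v)" "u \<in> J" "v \<in> J" by auto
    have "psd_on J F" using that by (simp add: C_def)
    then obtain f where f: "\<And>i j. i \<in> J \<Longrightarrow> j \<in> J \<Longrightarrow> F (i,j) = (\<Sum>e\<in>J. outer (f e) (i,j))"
      using psd_on_sum_outer[OF fin(2)] by blast
    have LF: "L F w = (\<Sum>e\<in>J. (\<Sum>a\<in>T1. outer (mat_app J (N a) (f e)) w) - (\<Sum>b\<in>T2. outer (mat_app J (M b) (f e)) w))" for w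
      by (rule Lrk) (rule f)
    define m where "m = (\<Sum>e\<in>J. nsq J (f e))"
    have "cmod (F w) \<le> (\<Sum>e\<in>J. cmod (outer (f e) (u,v)))"
      using f[OF w(2,3)] w(1) by (simp add: norm_sum)
    also have "\<dots> \<le> m"
      unfolding m_def
    proof (rule sum_mono)
      fix e
      have "(cmod (f e u))\<^sup>2 \<le> nsq J (f e)" "(cmod (f e v))\<^sup>2 \<le> nsq J (f e)"
        unfolding nsq_def using fin(2) w by (auto intro!: member_le_sum)
      moreover have "2 * (cmod (f e u) * cmod (f e v)) \<le> (cmod (f e u))\<^sup>2 + (cmod (f e v))\<^sup>2"
        using sum_squares_bound[of "cmod (f e u)" "cmod (f e v)"] by simp
      ultimately show "cmod (outer (f e) (u,v)) \<le> nsq J (f e)"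
        by (simp add: outer_def norm_mult)
    qed
    finally have 1: "cmod (F w) \<le> m" .
    \<comment> \<open>The trace of a rank-one form is the squared norm of its vector, so the chain
      below compares the traces of \<open>F\<close> and \<open>L F\<close>.\<close>
    have rkn: "(\<Sum>p\<in>I. Re (outer g (p,p))) = nsq I g" for g
      unfolding outer_def nsq_def by (intro sum.cong refl) (simp add: cmod_power2, simp add: power2_eq_square)
    have "\<kappa> * m = (\<Sum>e\<in>J. \<kappa> * nsq J (f e))" by (simp add: m_def sum_distrib_left)
    also have "\<dots> \<le> (\<Sum>e\<in>J. (\<Sum>a\<in>T1. nsq I (mat_app J (N a) (f e))) - (\<Sum>b\<in>T2. nsq I (mat_app J (M b) (f e))))"
    proof (rule sum_mono)
      fix e show "\<kappa> * nsq J (f e) \<le> (\<Sum>a\<in>T1. nsq I (mat_app J (N a) (f e))) - (\<Sum>b\<in>T2. nsq I (mat_app J (M b) (f e)))"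
        using coer[of "f e"] by linarith
    qed
    also have "\<dots> = (\<Sum>p\<in>I. Re (L F (p,p)))"
      unfolding LF Re_sum minus_complex.sel rkn[symmetric] sum_subtractf
      by (simp only: sum.swap[of _ I])
    also have "\<dots> \<le> (\<Sum>p\<in>I. cmod (L F (p,p)))" by (intro sum_mono complex_Re_le_cmod)
    also have "\<dots> = (\<Sum>p\<in>(\<lambda>p. (p,p)) ` I. cmod (L F p))"
      by (subst sum.reindex) (auto simp: inj_on_def)
    also have "\<dots> \<le> (\<Sum>p\<in>I \<times> I. cmod (L F p))"
      using fin(1) by (intro sum_mono2) auto
    finally have "m \<le> (1 / \<kappa>) * (\<Sum>p\<in>I \<times> I. cmod (L F p))"
      using \<kappa> by (simp add: field_simps)
    with 1 show ?thesis by linarith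
  qed
  show thesis
  proof (cases "\<exists>F\<in>C. \<forall>w\<in>I \<times> I. L F w = Q w")
    case True
    then obtain F where F: "F \<in> C" "\<And>w. w \<in> I \<times> I \<Longrightarrow> L F w = Q w" by blast
    then have "psd_on J F" by (simp add: C_def)
    then obtain f where f: "\<And>i j. i \<in> J \<Longrightarrow> j \<in> J \<Longrightarrow> F (i,j) = (\<Sum>e\<in>J. outer (f e) (i,j))"
      using psd_on_sum_outer[OF fin(2)] by blast
    have LF: "L F w = (\<Sum>e\<in>J. (\<Sum>a\<in>T1. outer (mat_app J (N a) (f e)) w) - (\<Sum>b\<in>T2. outer (mat_app J (M b) (f e)) w))" for w
      by (rule Lrk) (rule f)
    show thesis
    proof (rule that(1)[of f])
      fix p q assume "p \<in> I" "q \<in> I"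
      then have "Q (p,q) = L F (p,q)" using F(2) by simp
      also note LF
      finally show "Q (p,q) = (\<Sum>e\<in>J. (\<Sum>a\<in>T1. outer (mat_app J (N a) (f e)) (p,q)) - (\<Sum>b\<in>T2. outer (mat_app J (M b) (f e)) (p,q)))"
        by simp
    qed
  next
    case False
    have \<kappa>': "0 \<le> 1 / \<kappa>" using \<kappa> by simp
    obtain F0 where F0: "F0 \<in> C"
      "\<And>F. F \<in> C \<Longrightarrow> 0 \<le> Re (ip (I \<times> I) (\<lambda>p. L F0 p - Q p) (L F))"
      "Re (ip (I \<times> I) (\<lambda>p. L F0 p - Q p) Q) < 0"
      using cone_alternative[OF finite_cartesian_product[OF fin(1) fin(1)] closed zero add lin cont
          \<kappa>' coercive False] by blast
    define H where "H = (\<lambda>p. L F0 p - Q p)"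
    have hH: "herm_on I H" unfolding herm_on_def
    proof (intro ballI)
      fix i j assume ij: "i \<in> I" "j \<in> I"
      have h0: "herm_on J F0" using F0(1) by (simp add: C_def psd_on_def)
      have "L F0 (j,i) = cnj (L F0 (i,j))"
        unfolding L_def complex_cnj_diff cnj_sum congruence_herm[OF h0, symmetric] ..
      then show "H (j,i) = cnj (H (i,j))" using herm_onD[OF Qh ij] by (simp add: H_def)
    qed
    have "(\<Sum>b\<in>T2. Re (qform I H (mat_app J (M b) f))) \<le> (\<Sum>a\<in>T1. Re (qform I H (mat_app J (N a) f)))" for f
    proof -
      \<comment> \<open>The rank-one form of \<open>f\<close>, cut off so as to lie in
        \<open>C\<close>; the cut-off does not affect its congruences, which only read
        \<open>J \<times> J\<close>.\<close>
      define F where "F w = (if w \<in> J \<times> J then outer f w else 0)" for w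
      have "psd_on J F" by (rule psd_on_cong[OF _ psd_on_outer[of J f]]) (simp add: F_def)
      then have FC: "F \<in> C" by (simp add: C_def F_def)
      have LF: "L F = (\<lambda>w. (\<Sum>a\<in>T1. outer (mat_app J (N a) f) w) - (\<Sum>b\<in>T2. outer (mat_app J (M b) f) w))"
      proof
        fix w
        have "congruence J X F = outer (mat_app J X f)" for X :: "'p \<Rightarrow> 'u \<Rightarrow> complex"
        proof -
          have "congruence J X F = congruence J X (outer f)" by (intro congruence_cong) (simp add: F_def)
          then show ?thesis by (simp add: congruence_outer)
        qed
        then show "L F w = (\<Sum>a\<in>T1. outer (mat_app J (N a) f) w) - (\<Sum>b\<in>T2. outer (mat_app J (M b) f) w)"
          by (simp add: L_def)
      qed
      have "ip (I \<times> I) H (L F) = (\<Sum>a\<in>T1. qform I H (mat_app J (N a) f)) - (\<Sum>b\<in>T2. qform I H (mat_app J (M b) f))"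
        unfolding LF ip_diff_right ip_sum_right ip_outer[OF fin(1) hH] ..
      then show ?thesis using F0(2)[OF FC] unfolding H_def[symmetric] by simp
    qed
    then show thesis using that(2)[OF hH] F0(3) unfolding H_def[symmetric] by blast
  qed
qed

section \<open>Transfer functions\<close>

text \<open>\<open>D b a i j\<close> is entry (i,j) of block (b,a) of a matrix of n x n blocks, and
  \<open>g\<close> is a column of s vectors.\<close>

definition act :: "(nat \<Rightarrow> nat \<Rightarrow> nat \<Rightarrow> nat \<Rightarrow> complex) \<Rightarrow> nat \<Rightarrow> nat \<Rightarrow> (nat \<Rightarrow> nat \<Rightarrow> complex)
    \<Rightarrow> nat \<Rightarrow> nat \<Rightarrow> complex" where
  "act D s n g b i = (\<Sum>a<s. \<Sum>j<n. D b a i j * g a j)"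

text \<open>Here \<rho> bounds the square of the operator norm. For \<delta> at a point this amounts
  to membership in the domain, and the gap 1 - \<rho> is the source of every coercivity
  estimate.\<close>

definition strict_contr :: "nat \<Rightarrow> nat \<Rightarrow> nat \<Rightarrow> (nat \<Rightarrow> nat \<Rightarrow> nat \<Rightarrow> nat \<Rightarrow> complex) \<Rightarrow> bool" where
  "strict_contr r s n D \<longleftrightarrow> (\<exists>\<rho>. 0 \<le> \<rho> \<and> \<rho> < 1 \<and>
     (\<forall>g. (\<Sum>b<r. nsq {..<n} (act D s n g b)) \<le> \<rho> * (\<Sum>a<s. nsq {..<n} (g a))))"

lemma nsq_Times: "finite A \<Longrightarrow> finite B \<Longrightarrow> nsq (A \<times> B) x = (\<Sum>a\<in>A. nsq B (\<lambda>b. x (a,b)))"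
  by (simp add: nsq_def sum.cartesian_product split_def)

lemma nsq_Plus: "finite A \<Longrightarrow> finite B \<Longrightarrow> nsq (A <+> B) x = nsq A (\<lambda>a. x (Inl a)) + nsq B (\<lambda>b. x (Inr b))"
  by (simp add: nsq_def sum.Plus)

lemma nsq_swap: "finite A \<Longrightarrow> finite B \<Longrightarrow> (\<Sum>a\<in>A. nsq B (x a)) = (\<Sum>b\<in>B. nsq A (\<lambda>a. x a b))"
  unfolding nsq_def by (rule sum.swap)

lemma qform_unit: "finite I \<Longrightarrow> qform I (\<lambda>(p,q). if p = q then 1 else 0) g = of_real (nsq I g)"
  unfolding qform_def nsq_def of_real_sum cmod_sq
  by (intro sum.cong refl) (simp add: if_distrib if_distribR cong: if_cong)

text \<open>A function on pairs (i,j) is an n x n matrix, and \<open>D\<close> multiplies it from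
  the left: it acts on the row index and leaves the column index as a passive label.\<close>

definition lift :: "(nat \<Rightarrow> nat \<Rightarrow> nat \<Rightarrow> nat \<Rightarrow> complex) \<Rightarrow> nat \<Rightarrow> nat \<Rightarrow> (nat \<Rightarrow> nat \<times> nat \<Rightarrow> complex)
    \<Rightarrow> nat \<Rightarrow> nat \<times> nat \<Rightarrow> complex" where
  "lift D s n f b p = act D s n (\<lambda>a i. f a (i, snd p)) b (fst p)"

lemma lift_contr:
  assumes "\<And>g. (\<Sum>b<r. nsq {..<n} (act D s n g b)) \<le> \<rho> * (\<Sum>a<s. nsq {..<n} (g a))"
  shows "(\<Sum>b<r. nsq ({..<n} \<times> {..<n}) (lift D s n f b)) \<le> \<rho> * (\<Sum>a<s. nsq ({..<n} \<times> {..<n}) (f a))"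
proof -
  have sq: "nsq ({..<n} \<times> {..<n}) x = (\<Sum>j<n. nsq {..<n} (\<lambda>i. x (i,j)))" for x
    by (simp add: nsq_Times) (rule nsq_swap, simp_all)
  have "(\<Sum>b<r. nsq ({..<n} \<times> {..<n}) (lift D s n f b)) =
      (\<Sum>j<n. \<Sum>b<r. nsq {..<n} (act D s n (\<lambda>a i. f a (i,j)) b))"
    unfolding sq lift_def fst_conv snd_conv by (rule sum.swap)
  also have "\<dots> \<le> (\<Sum>j<n. \<rho> * (\<Sum>a<s. nsq {..<n} (\<lambda>i. f a (i,j))))"
    by (intro sum_mono assms)
  also have "\<dots> = \<rho> * (\<Sum>a<s. nsq ({..<n} \<times> {..<n}) (f a))"
    unfolding sq sum_distrib_left[symmetric] by (subst sum.swap) simp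
  finally show ?thesis .
qed

text \<open>The Gram alternative for the Gram matrix of the \<open>\<psi> l\<close> minus that of
  \<open>h\<close>. If it fails, the separating form is only semidefinite, whereas
  \<open>pos\<close> speaks of definite forms with a positive gap; a small multiple of the identity
  form bridges the difference. The conclusion compares norms of linear combinations, as
  \<open>contraction_extension\<close> requires.\<close>

theorem model_exists:
  fixes n r s k :: nat and \<psi> :: "nat \<Rightarrow> nat \<times> nat \<Rightarrow> complex" and h :: "nat \<times> nat \<Rightarrow> complex"
  defines "I \<equiv> {..<n} \<times> {..<n}"
  assumes D: "strict_contr r s n D"
    and pos: "\<And>H \<kappa>. 0 < \<kappa> \<Longrightarrow> herm_on I H \<Longrightarrow> (\<And>g. \<kappa> * nsq I g \<le> Re (qform I H g)) \<Longrightarrow>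
      (\<And>f. (\<Sum>b<r. Re (qform I H (lift D s n f b))) + \<kappa> * (\<Sum>a<s. nsq I (f a))
          \<le> (\<Sum>a<s. Re (qform I H (f a)))) \<Longrightarrow>
      Re (qform I H h) \<le> (\<Sum>l<k. Re (qform I H (\<psi> l)))"
  obtains E :: "(nat \<times> nat \<times> nat) set" and f where "finite E"
    "\<And>c. (cmod (\<Sum>p\<in>I. h p * c p))\<^sup>2 + (\<Sum>e\<in>E. \<Sum>a<s. (cmod (\<Sum>p\<in>I. f e a p * c p))\<^sup>2)
      \<le> (\<Sum>l<k. (cmod (\<Sum>p\<in>I. \<psi> l p * c p))\<^sup>2)
        + (\<Sum>e\<in>E. \<Sum>b<r. (cmod (\<Sum>p\<in>I. lift D s n (f e) b p * c p))\<^sup>2)"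
proof -
  obtain \<rho> where \<rho>: "0 \<le> \<rho>" "\<rho> < 1"
    and Dc: "\<And>g. (\<Sum>b<r. nsq {..<n} (act D s n g b)) \<le> \<rho> * (\<Sum>a<s. nsq {..<n} (g a))"
    using D unfolding strict_contr_def by blast
  have finI: "finite I" by (simp add: I_def)
  \<comment> \<open>The index \<open>a = s\<close> is a zero column appended to \<open>\<delta>\<close>; it absorbs the positive semidefinite slack.\<close>
  define J where "J = {..s} \<times> I"
  have finJ: "finite J" by (simp add: J_def finI)
  \<comment> \<open>\<open>N a\<close> picks the component \<open>a\<close>, and \<open>M b\<close>
    applies row \<open>b\<close> of \<delta> to the components below \<open>s\<close>; the component
    \<open>a = s\<close> is thus invisible to every \<open>M b\<close>.\<close>
  define N where "N = (\<lambda>(a::nat) (p::nat \<times> nat) (u::nat \<times> nat \<times> nat). if u = (a,p) then 1 else (0::complex))"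
  define M where "M = (\<lambda>b (p::nat \<times> nat) (u::nat \<times> nat \<times> nat).
      if fst u < s \<and> snd (snd u) = snd p then D b (fst u) (fst p) (fst (snd u)) else 0)"
  have apN: "mat_app J (N a) f p = f (a,p)" if "a \<le> s" "p \<in> I" for a p f
  proof -
    have "mat_app J (N a) f p = (\<Sum>u\<in>J. if u = (a,p) then f u else 0)"
      unfolding mat_app_def N_def by (intro sum.cong refl) simp
    then show ?thesis using that finJ by (simp add: J_def)
  qed
  have apM: "mat_app J (M b) f p = lift D s n (\<lambda>a p. f (a,p)) b p" if "p \<in> I" for b p f
  proof -
    have j: "snd p < n" using that by (auto simp: I_def)
    have "mat_app J (M b) f p = (\<Sum>a\<le>s. \<Sum>i<n. \<Sum>j<n. M b p (a,i,j) * f (a,i,j))"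
      by (simp add: mat_app_def J_def I_def sum.cartesian_product split_def)
    also have "\<dots> = (\<Sum>a\<le>s. \<Sum>i<n. if a < s then D b a (fst p) i * f (a,i,snd p) else 0)"
    proof (intro sum.cong refl)
      fix a i
      have "(\<Sum>j<n. M b p (a,i,j) * f (a,i,j)) =
          (\<Sum>j<n. if j = snd p then (if a < s then D b a (fst p) i * f (a,i,j) else 0) else 0)"
        by (intro sum.cong refl) (auto simp: M_def)
      then show "(\<Sum>j<n. M b p (a,i,j) * f (a,i,j)) = (if a < s then D b a (fst p) i * f (a,i,snd p) else 0)"
        using j by simp
    qed
    also have "\<dots> = (\<Sum>a<s. \<Sum>i<n. D b a (fst p) i * f (a,i,snd p))"
      by (simp add: lessThan_Suc_atMost[symmetric])
    finally show ?thesis by (simp add: lift_def act_def)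
  qed
  have nJ: "nsq J f = (\<Sum>a\<le>s. nsq I (\<lambda>p. f (a,p)))" for f
    unfolding J_def by (simp add: nsq_Times finI)
  have coer: "(\<Sum>b<r. nsq I (mat_app J (M b) f)) + (1 - \<rho>) * nsq J f \<le> (\<Sum>a\<le>s. nsq I (mat_app J (N a) f))" for f
  proof -
    have 1: "(\<Sum>a\<le>s. nsq I (mat_app J (N a) f)) = nsq J f"
      unfolding nJ by (intro sum.cong refl nsq_cong) (simp add: apN)
    have "(\<Sum>b<r. nsq I (mat_app J (M b) f)) = (\<Sum>b<r. nsq I (lift D s n (\<lambda>a p. f (a,p)) b))"
      by (intro sum.cong refl nsq_cong) (simp add: apM)
    also have "\<dots> \<le> \<rho> * (\<Sum>a<s. nsq I (\<lambda>p. f (a,p)))"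
      unfolding I_def by (rule lift_contr[OF Dc])
    also have "\<dots> \<le> \<rho> * nsq J f"
      unfolding nJ by (intro mult_left_mono sum_mono2) (auto simp: \<rho>)
    finally show ?thesis unfolding 1 by (simp add: algebra_simps)
  qed
  define Q where "Q w = (\<Sum>l<k. outer (\<psi> l) w) - outer h w" for w
  have Qh: "herm_on I Q"
    by (simp add: herm_on_def Q_def outer_def mult.commute)
  have \<rho>': "0 < 1 - \<rho>" using \<rho> by simp
  show thesis
  proof (cases rule: gram_alternative[OF finI finJ \<rho>' coer Qh])
    case (1 f)
    define f' where "f' e a p = f e (a,p)" for e a p
    have "(cmod (\<Sum>p\<in>I. h p * c p))\<^sup>2 + (\<Sum>e\<in>J. \<Sum>a<s. (cmod (\<Sum>p\<in>I. f' e a p * c p))\<^sup>2)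
      \<le> (\<Sum>l<k. (cmod (\<Sum>p\<in>I. \<psi> l p * c p))\<^sup>2)
        + (\<Sum>e\<in>J. \<Sum>b<r. (cmod (\<Sum>p\<in>I. lift D s n (f' e) b p * c p))\<^sup>2)" for c
    proof -
      \<comment> \<open>The claim is stated with \<open>c\<close> unconjugated, so the forms are
        evaluated at the conjugate of \<open>c\<close>.\<close>
      define v where "v x = (cmod (\<Sum>p\<in>I. x p * c p))\<^sup>2" for x
      have qv: "qform I (outer x) (\<lambda>p. cnj (c p)) = of_real (v x)" for x
        by (simp add: qform_outer v_def)
      have vN: "v (mat_app J (N a) (f e)) = v (f' e a)" if "a \<le> s" for a e
        using that unfolding v_def by (simp add: apN f'_def cong: sum.cong)
      have vM: "v (mat_app J (M b) (f e)) = v (lift D s n (f' e) b)" for b e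
        unfolding v_def f'_def[abs_def] by (simp add: apM cong: sum.cong)
      have "qform I Q (\<lambda>p. cnj (c p)) = of_real ((\<Sum>l<k. v (\<psi> l)) - v h)"
        unfolding Q_def qform_diff qform_sum qv by simp
      moreover have "qform I Q (\<lambda>p. cnj (c p)) = qform I (\<lambda>w. \<Sum>e\<in>J. (\<Sum>a\<le>s. outer (mat_app J (N a) (f e)) w)
          - (\<Sum>b<r. outer (mat_app J (M b) (f e)) w)) (\<lambda>p. cnj (c p))"
        by (intro qform_cong) (auto simp: 1)
      moreover have "\<dots> = of_real (\<Sum>e\<in>J. (\<Sum>a\<le>s. v (mat_app J (N a) (f e))) - (\<Sum>b<r. v (mat_app J (M b) (f e))))"
        unfolding qform_sum qform_diff qv by simp
      ultimately have "complex_of_real ((\<Sum>l<k. v (\<psi> l)) - v h)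
          = of_real (\<Sum>e\<in>J. (\<Sum>a\<le>s. v (mat_app J (N a) (f e))) - (\<Sum>b<r. v (mat_app J (M b) (f e))))"
        by argo
      then have "(\<Sum>l<k. v (\<psi> l)) - v h
          = (\<Sum>e\<in>J. (\<Sum>a\<le>s. v (mat_app J (N a) (f e))) - (\<Sum>b<r. v (mat_app J (M b) (f e))))"
        by (simp only: of_real_eq_iff)
      also have "\<dots> = (\<Sum>e\<in>J. (\<Sum>a\<le>s. v (f' e a)) - (\<Sum>b<r. v (lift D s n (f' e) b)))"
        unfolding vM by (intro sum.cong refl arg_cong2[where f="(-)"]) (simp add: vN)
      finally have eq: "(\<Sum>l<k. v (\<psi> l)) - v h
        = (\<Sum>e\<in>J. \<Sum>a\<le>s. v (f' e a)) - (\<Sum>e\<in>J. \<Sum>b<r. v (lift D s n (f' e) b))"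
        by (simp add: sum_subtractf)
      \<comment> \<open>Discarding the slack block turns the identity into an inequality.\<close>
      have "(\<Sum>e\<in>J. \<Sum>a<s. v (f' e a)) \<le> (\<Sum>e\<in>J. \<Sum>a\<le>s. v (f' e a))"
        by (intro sum_mono sum_mono2) (auto simp: v_def)
      with eq show ?thesis unfolding v_def by linarith
    qed
    then show thesis using that[OF finJ, of f'] by blast
  next
    case (2 H)
    define q where "q g = Re (qform I H g)" for g
    have qf: "(\<Sum>b<r. q (lift D s n (\<lambda>a p. f (a,p)) b)) \<le> (\<Sum>a\<le>s. q (\<lambda>p. f (a,p)))" for f
    proof -
      have "q (mat_app J (M b) f) = q (lift D s n (\<lambda>a p. f (a,p)) b)" for b
        unfolding q_def by (intro arg_cong[where f=Re] qform_cong) (auto simp: apM)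
      moreover have "q (mat_app J (N a) f) = q (\<lambda>p. f (a,p))" if "a \<le> s" for a
        unfolding q_def using that by (intro arg_cong[where f=Re] qform_cong) (auto simp: apN)
      ultimately show ?thesis using 2(2)[of f] unfolding q_def[symmetric] by simp
    qed
    have q0: "q (\<lambda>p. 0) = 0" by (simp add: q_def qform_def)
    have l0: "lift D s n (\<lambda>a p. if a = s then g p else 0) b = (\<lambda>p. 0)" for g b
      by (auto simp: lift_def act_def)
    \<comment> \<open>A vector supported in the slack block is annihilated by the lifted \<delta>,
      so the separating inequality reduces to positivity of \<open>q\<close>.\<close>
    have qpos: "0 \<le> q g" for g
    proof -
      have "(\<Sum>a\<le>s. q (\<lambda>p. if a = s then g p else 0)) = q g"
        by (simp add: lessThan_Suc_atMost[symmetric] q0)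
      then show ?thesis using qf[of "\<lambda>(a,p). if a = s then g p else 0"] by (simp add: l0 q0)
    qed
    have ql: "(\<Sum>b<r. q (lift D s n f b)) \<le> (\<Sum>a<s. q (f a))" for f
    proof -
      have "lift D s n (\<lambda>a p. if a < s then f a p else 0) b = lift D s n f b" for b
        by (auto simp: lift_def act_def)
      moreover have "(\<Sum>a\<le>s. q (\<lambda>p. if a < s then f a p else 0)) = (\<Sum>a<s. q (f a))"
        by (simp add: lessThan_Suc_atMost[symmetric] q0)
      ultimately show ?thesis using qf[of "\<lambda>(a,p). if a < s then f a p else 0"] by simp
    qed
    have "ip (I \<times> I) H Q = (\<Sum>l<k. qform I H (\<psi> l)) - qform I H h"
      unfolding Q_def ip_diff_right ip_sum_right ip_outer[OF finI 2(1)] ..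
    then have neg: "(\<Sum>l<k. q (\<psi> l)) < q h" using 2(3) by (simp add: q_def)
    define m where "m = (\<Sum>l<k. nsq I (\<psi> l))"
    have m: "0 \<le> m" by (simp add: m_def sum_nonneg)
    \<comment> \<open>With \<open>m + 1\<close> in the denominator, \<open>\<eta> * m\<close> is
      smaller than the gap, so the perturbed form still separates; the summand 1 also covers
      \<open>m = 0\<close>.\<close>
    define \<eta> where "\<eta> = (q h - (\<Sum>l<k. q (\<psi> l))) / (m + 1)"
    have \<eta>: "0 < \<eta>" unfolding \<eta>_def using neg m by simp
    have "\<eta> * (m + 1) = q h - (\<Sum>l<k. q (\<psi> l))" using m by (simp add: \<eta>_def)
    then have \<eta>m: "(\<Sum>l<k. q (\<psi> l)) + \<eta> * m < q h" using \<eta> by (simp add: algebra_simps)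
    define H' where "H' w = H w + of_real \<eta> * (case w of (p,q) \<Rightarrow> if p = q then 1 else 0)" for w
    have q': "Re (qform I H' g) = q g + \<eta> * nsq I g" for g
      unfolding H'_def[abs_def] qform_lin qform_unit[OF finI] q_def by simp
    have hH': "herm_on I H'" unfolding herm_on_def
    proof (intro ballI)
      fix i j assume "i \<in> I" "j \<in> I"
      then show "H' (j,i) = cnj (H' (i,j))" using herm_on_cnj[OF 2(1), of i j] by (simp add: H'_def)
    qed
    have "Re (qform I H' h) \<le> (\<Sum>l<k. Re (qform I H' (\<psi> l)))"
    \<comment> \<open>The semidefinite part contributes no gap; on the added multiple of the
      identity, contractivity of \<delta> contributes \<open>\<eta> * (1 - \<rho>)\<close>.\<close>
    proof (rule pos[of "\<eta> * (1 - \<rho>)", OF _ hH'])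
      show "0 < \<eta> * (1 - \<rho>)" using \<eta> \<rho> by simp
      show "\<eta> * (1 - \<rho>) * nsq I g \<le> Re (qform I H' g)" for g
      proof -
        have "\<eta> * (1 - \<rho>) * nsq I g \<le> \<eta> * nsq I g"
          using \<eta> \<rho> by (intro mult_right_mono) (auto simp: mult_le_cancel_left1)
        then show ?thesis unfolding q' using qpos[of g] by linarith
      qed
      show "(\<Sum>b<r. Re (qform I H' (lift D s n f b))) + \<eta> * (1 - \<rho>) * (\<Sum>a<s. nsq I (f a))
          \<le> (\<Sum>a<s. Re (qform I H' (f a)))" for f
      proof -
        have "\<eta> * (\<Sum>b<r. nsq I (lift D s n f b)) \<le> \<eta> * (\<rho> * (\<Sum>a<s. nsq I (f a)))"
          using \<eta> lift_contr[OF Dc, of f] unfolding I_def by (intro mult_left_mono) auto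
        then show ?thesis unfolding q' sum.distrib sum_distrib_left[symmetric] using ql[of f]
          by (simp add: algebra_simps)
      qed
    qed
    moreover have "0 \<le> \<eta> * nsq I h" using \<eta> by simp
    ultimately have False
      unfolding q' sum.distrib sum_distrib_left[symmetric] m_def[symmetric] using \<eta>m by linarith
    then show thesis ..
  qed
qed

text \<open>\<open>U\<close> maps C^k \<oplus> (E \<otimes> C^r) into C \<oplus> (E \<otimes> C^s):
  \<open>Inl\<close> marks external input and output, \<open>Inr\<close> the feedback channels, and
  E is an auxiliary multiplicity space. At a point of size m it acts tensored with the identity of
  C^m, whereas \<delta> acts on C^m.\<close>

locale transfer_function =
  fixes k r s :: nat and E :: "'e set" and U :: "unit + 'e \<times> nat \<Rightarrow> nat + 'e \<times> nat \<Rightarrow> complex"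
    and A :: "(nat + 'e \<times> nat) set"
  defines "A \<equiv> {..<k} <+> E \<times> {..<r}"
  assumes finE: "finite E"
    and contr: "nsq ({()} <+> E \<times> {..<s}) (\<lambda>\<beta>. \<Sum>\<alpha>\<in>A. U \<beta> \<alpha> * y \<alpha>) \<le> nsq A y"
begin

definition inp :: "(nat \<Rightarrow> nat \<Rightarrow> nat \<Rightarrow> nat \<Rightarrow> complex) \<Rightarrow> nat \<Rightarrow> (nat \<Rightarrow> nat \<Rightarrow> complex)
    \<Rightarrow> ('e \<times> nat \<Rightarrow> nat \<Rightarrow> complex) \<Rightarrow> nat \<Rightarrow> nat + 'e \<times> nat \<Rightarrow> complex" where
  "inp D m u f i = case_sum (\<lambda>l. u l i) (\<lambda>(e,b). act D s m (\<lambda>a. f (e,a)) b i)"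

definition out :: "(nat \<Rightarrow> nat \<Rightarrow> nat \<Rightarrow> nat \<Rightarrow> complex) \<Rightarrow> nat \<Rightarrow> (nat \<Rightarrow> nat \<Rightarrow> complex)
    \<Rightarrow> ('e \<times> nat \<Rightarrow> nat \<Rightarrow> complex) \<Rightarrow> nat \<Rightarrow> unit + 'e \<times> nat \<Rightarrow> complex" where
  "out D m u f i \<beta> = (\<Sum>\<alpha>\<in>A. U \<beta> \<alpha> * inp D m u f i \<alpha>)"

text \<open>The feedback equations with input \<open>u\<close>, output \<open>v\<close> and state
  \<open>f\<close>, where \<delta> applied to the state re-enters through \<open>inp\<close>.
  Working with solutions avoids manipulating an explicit inverse.\<close>

definition sol :: "(nat \<Rightarrow> nat \<Rightarrow> nat \<Rightarrow> nat \<Rightarrow> complex) \<Rightarrow> nat \<Rightarrow> (nat \<Rightarrow> nat \<Rightarrow> complex)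
    \<Rightarrow> (nat \<Rightarrow> complex) \<Rightarrow> ('e \<times> nat \<Rightarrow> nat \<Rightarrow> complex) \<Rightarrow> bool" where
  "sol D m u v f \<longleftrightarrow> (\<forall>i<m. v i = out D m u f i (Inl ())) \<and>
     (\<forall>\<gamma>\<in>E \<times> {..<s}. \<forall>i<m. f \<gamma> i = out D m u f i (Inr \<gamma>))"

lemma finA: "finite A"
  by (simp add: A_def finE)

text \<open>Contractivity of \<open>U\<close> is applied for each coordinate i of C^m separately;
  exchanging the sums then gives norms in C^m.\<close>

lemma energy:
  assumes "\<And>\<gamma> i. \<gamma> \<in> E \<times> {..<s} \<Longrightarrow> i < m \<Longrightarrow> f \<gamma> i = out D m u f i (Inr \<gamma>)"
  shows "nsq {..<m} (\<lambda>i. out D m u f i (Inl ())) + (\<Sum>e\<in>E. \<Sum>a<s. nsq {..<m} (f (e,a)))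
    \<le> (\<Sum>l<k. nsq {..<m} (u l)) + (\<Sum>e\<in>E. \<Sum>b<r. nsq {..<m} (act D s m (\<lambda>a. f (e,a)) b))"
proof -
  have "nsq {..<m} (\<lambda>i. out D m u f i (Inl ())) + (\<Sum>e\<in>E. \<Sum>a<s. nsq {..<m} (f (e,a))) =
     nsq {..<m} (\<lambda>i. out D m u f i (Inl ())) + (\<Sum>\<gamma>\<in>E \<times> {..<s}. nsq {..<m} (f \<gamma>))"
    by (simp add: sum.cartesian_product split_def)
  also have "(\<Sum>\<gamma>\<in>E \<times> {..<s}. nsq {..<m} (f \<gamma>)) = (\<Sum>\<gamma>\<in>E \<times> {..<s}. nsq {..<m} (\<lambda>i. out D m u f i (Inr \<gamma>)))"
    by (intro sum.cong refl nsq_cong) (simp add: assms)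
  also have "nsq {..<m} (\<lambda>i. out D m u f i (Inl ())) + \<dots> =
     (\<Sum>\<beta>\<in>{()} <+> E \<times> {..<s}. nsq {..<m} (\<lambda>i. out D m u f i \<beta>))"
    using finE by (simp add: sum.Plus)
  also have "\<dots> = (\<Sum>i<m. nsq ({()} <+> E \<times> {..<s}) (out D m u f i))"
    using finE by (intro nsq_swap) auto
  also have "\<dots> \<le> (\<Sum>i<m. nsq A (inp D m u f i))"
    unfolding out_def[abs_def] by (intro sum_mono contr)
  also have "\<dots> = (\<Sum>\<alpha>\<in>A. nsq {..<m} (\<lambda>i. inp D m u f i \<alpha>))"
    using finA by (intro nsq_swap) auto
  also have "\<dots> = (\<Sum>l<k. nsq {..<m} (u l)) + (\<Sum>\<gamma>\<in>E \<times> {..<r}. nsq {..<m} (\<lambda>i. inp D m u f i (Inr \<gamma>)))"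
    unfolding A_def using finE by (simp add: sum.Plus inp_def)
  also have "(\<Sum>\<gamma>\<in>E \<times> {..<r}. nsq {..<m} (\<lambda>i. inp D m u f i (Inr \<gamma>))) =
      (\<Sum>e\<in>E. \<Sum>b<r. nsq {..<m} (act D s m (\<lambda>a. f (e,a)) b))"
    by (simp add: sum.cartesian_product split_def inp_def)
  finally show ?thesis .
qed

text \<open>Strictness of \<delta> leaves a positive multiple of the state energy on the left. This
  yields contractivity, and with input 0 it shows that the feedback system is injective.\<close>

lemma energy_strict:
  assumes D: "strict_contr r s m D"
    and f: "\<And>\<gamma> i. \<gamma> \<in> E \<times> {..<s} \<Longrightarrow> i < m \<Longrightarrow> f \<gamma> i = out D m u f i (Inr \<gamma>)"
  obtains \<kappa> where "0 < \<kappa>"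
    "nsq {..<m} (\<lambda>i. out D m u f i (Inl ())) + \<kappa> * (\<Sum>e\<in>E. \<Sum>a<s. nsq {..<m} (f (e,a)))
      \<le> (\<Sum>l<k. nsq {..<m} (u l))"
proof -
  obtain \<rho> where \<rho>: "0 \<le> \<rho>" "\<rho> < 1"
    and Dc: "\<And>g. (\<Sum>b<r. nsq {..<m} (act D s m g b)) \<le> \<rho> * (\<Sum>a<s. nsq {..<m} (g a))"
    using D unfolding strict_contr_def by blast
  have "(\<Sum>e\<in>E. \<Sum>b<r. nsq {..<m} (act D s m (\<lambda>a. f (e,a)) b)) \<le> (\<Sum>e\<in>E. \<rho> * (\<Sum>a<s. nsq {..<m} (f (e,a))))"
    by (intro sum_mono Dc)
  also have "\<dots> = \<rho> * (\<Sum>e\<in>E. \<Sum>a<s. nsq {..<m} (f (e,a)))" by (simp add: sum_distrib_left)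
  finally have "nsq {..<m} (\<lambda>i. out D m u f i (Inl ())) + (1 - \<rho>) * (\<Sum>e\<in>E. \<Sum>a<s. nsq {..<m} (f (e,a)))
      \<le> (\<Sum>l<k. nsq {..<m} (u l))"
    using energy[OF f] by (simp add: algebra_simps)
  then show thesis using that[of "1 - \<rho>"] \<rho> by simp
qed

lemma sol_contr:
  assumes "strict_contr r s m D" "sol D m u v f"
  shows "nsq {..<m} v \<le> (\<Sum>l<k. nsq {..<m} (u l))"
proof -
  have f: "\<And>\<gamma> i. \<gamma> \<in> E \<times> {..<s} \<Longrightarrow> i < m \<Longrightarrow> f \<gamma> i = out D m u f i (Inr \<gamma>)"
    using assms(2) unfolding sol_def by blast
  obtain \<kappa> where \<kappa>: "0 < \<kappa>"
    "nsq {..<m} (\<lambda>i. out D m u f i (Inl ())) + \<kappa> * (\<Sum>e\<in>E. \<Sum>a<s. nsq {..<m} (f (e,a)))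
      \<le> (\<Sum>l<k. nsq {..<m} (u l))"
    using energy_strict[OF assms(1) f] by blast
  have "nsq {..<m} v = nsq {..<m} (\<lambda>i. out D m u f i (Inl ()))"
    using assms(2) by (intro nsq_cong) (simp add: sol_def)
  moreover have "0 \<le> \<kappa> * (\<Sum>e\<in>E. \<Sum>a<s. nsq {..<m} (f (e,a)))"
    using \<kappa>(1) by (intro mult_nonneg_nonneg sum_nonneg) auto
  ultimately show ?thesis using \<kappa>(2) by linarith
qed

lemma inp_sum:
  "inp D m (\<lambda>l i. \<Sum>t\<in>T. u t l i * c t) (\<lambda>\<gamma> i. \<Sum>t\<in>T. f t \<gamma> i * c t) i \<alpha> =
    (\<Sum>t\<in>T. inp D m (u t) (f t) i \<alpha> * c t)"
proof -
  have "act D s m (\<lambda>a i. \<Sum>t\<in>T. f t (e,a) i * c t) b i = (\<Sum>t\<in>T. act D s m (\<lambda>a. f t (e,a)) b i * c t)" for e b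
  proof -
    have "act D s m (\<lambda>a i. \<Sum>t\<in>T. f t (e,a) i * c t) b i =
      (\<Sum>a<s. \<Sum>j<m. \<Sum>t\<in>T. D b a i j * f t (e,a) j * c t)"
      by (simp add: act_def sum_distrib_left mult_ac)
    then show ?thesis unfolding act_def sum_distrib_right by (simp only: sum.swap[of _ T])
  qed
  then show ?thesis by (cases \<alpha>) (auto simp: inp_def)
qed

lemma out_sum:
  "out D m (\<lambda>l i. \<Sum>t\<in>T. u t l i * c t) (\<lambda>\<gamma> i. \<Sum>t\<in>T. f t \<gamma> i * c t) i \<beta> =
    (\<Sum>t\<in>T. out D m (u t) (f t) i \<beta> * c t)"
proof -
  have "out D m (\<lambda>l i. \<Sum>t\<in>T. u t l i * c t) (\<lambda>\<gamma> i. \<Sum>t\<in>T. f t \<gamma> i * c t) i \<beta> =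
    (\<Sum>\<alpha>\<in>A. \<Sum>t\<in>T. U \<beta> \<alpha> * inp D m (u t) (f t) i \<alpha> * c t)"
    unfolding out_def inp_sum sum_distrib_left by (simp add: mult.assoc)
  then show ?thesis unfolding out_def sum_distrib_right by (simp only: sum.swap[of _ T])
qed

lemma sol_sum:
  assumes "\<And>t. t \<in> T \<Longrightarrow> sol D m (u t) (v t) (f t)"
  shows "sol D m (\<lambda>l i. \<Sum>t\<in>T. u t l i * c t) (\<lambda>i. \<Sum>t\<in>T. v t i * c t) (\<lambda>\<gamma> i. \<Sum>t\<in>T. f t \<gamma> i * c t)"
  using assms unfolding sol_def out_sum by (auto intro!: sum.cong)

lemma inp_cong:
  assumes "\<And>l. l < k \<Longrightarrow> u l i = u' l i" "\<alpha> \<in> A"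
  shows "inp D m u f i \<alpha> = inp D m u' f i \<alpha>"
  using assms by (auto simp: inp_def A_def)

lemma sol_cong:
  assumes "sol D m u v f" "\<And>l i. l < k \<Longrightarrow> i < m \<Longrightarrow> u l i = u' l i"
  shows "sol D m u' v f"
proof -
  have "out D m u f i \<beta> = out D m u' f i \<beta>" if "i < m" for i \<beta>
    unfolding out_def using assms(2) that by (intro sum.cong refl) (metis inp_cong)
  then show ?thesis using assms(1) by (simp add: sol_def)
qed

lemma sol_unique:
  assumes "strict_contr r s m D" "sol D m u v f" "sol D m u v' f'" "i < m"
  shows "v i = v' i"
proof -
  define c where "c t = (if t then 1 else - 1 :: complex)" for t
  have "sol D m u (\<lambda>i. if t then v i else v' i) (\<lambda>\<gamma> i. if t then f \<gamma> i else f' \<gamma> i)" for t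
    using assms(2,3) by (cases t) simp_all
  then have "sol D m (\<lambda>l i. \<Sum>t\<in>UNIV. u l i * c t) (\<lambda>i. \<Sum>t\<in>UNIV. (if t then v i else v' i) * c t)
     (\<lambda>\<gamma> i. \<Sum>t\<in>UNIV. (if t then f \<gamma> i else f' \<gamma> i) * c t)"
    by (intro sol_sum)
  from sol_contr[OF assms(1) this] have "nsq {..<m} (\<lambda>i. v i - v' i) \<le> 0"
    by (simp add: UNIV_bool c_def nsq_def)
  then have "nsq {..<m} (\<lambda>i. v i - v' i) = 0" using nsq_nonneg order_antisym by blast
  then show ?thesis using assms(4) by (simp add: nsq_eq_0)
qed

text \<open>The state equation is a square linear system, and by the energy estimate with input 0
  its homogeneous version has only the zero solution.\<close>

lemma sol_exists:
  assumes "strict_contr r s m D"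
  shows "\<exists>v f. sol D m u v f"
proof -
  define \<Lambda> where "\<Lambda> = (E \<times> {..<s}) \<times> {..<m}"
  have fin: "finite \<Lambda>" by (simp add: \<Lambda>_def finE)
  define T where "T \<mu> \<nu> = (if \<mu> = \<nu> then 1 else 0)
      - (\<Sum>b<r. U (Inr (fst \<mu>)) (Inr (fst (fst \<nu>), b)) * D b (snd (fst \<nu>)) (snd \<mu>) (snd \<nu>))" for \<mu> \<nu>
  have out_Inr: "out D m u f i (Inr \<gamma>) = (\<Sum>l<k. U (Inr \<gamma>) (Inl l) * u l i)
      + (\<Sum>e\<in>E. \<Sum>b<r. U (Inr \<gamma>) (Inr (e,b)) * act D s m (\<lambda>a. f (e,a)) b i)" for u f i \<gamma>
    unfolding out_def A_def using finE by (simp add: sum.Plus inp_def sum.cartesian_product split_def)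
  have Tc: "(\<Sum>\<mu>\<in>\<Lambda>. T (\<gamma>,i) \<mu> * c \<mu>) = c (\<gamma>,i)
     - (\<Sum>e\<in>E. \<Sum>b<r. U (Inr \<gamma>) (Inr (e,b)) * act D s m (\<lambda>a i. c ((e,a),i)) b i)"
    if "(\<gamma>,i) \<in> \<Lambda>" for \<gamma> i c
  proof -
    have "(\<Sum>\<mu>\<in>\<Lambda>. T (\<gamma>,i) \<mu> * c \<mu>) = (\<Sum>\<mu>\<in>\<Lambda>. (if (\<gamma>,i) = \<mu> then c \<mu> else 0)
        - (\<Sum>b<r. U (Inr \<gamma>) (Inr (fst (fst \<mu>), b)) * D b (snd (fst \<mu>)) i (snd \<mu>)) * c \<mu>)"
      by (intro sum.cong refl) (simp add: T_def left_diff_distrib)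
    also have "\<dots> = c (\<gamma>,i) - (\<Sum>\<mu>\<in>\<Lambda>. (\<Sum>b<r. U (Inr \<gamma>) (Inr (fst (fst \<mu>), b)) * D b (snd (fst \<mu>)) i (snd \<mu>)) * c \<mu>)"
      using that fin by (simp add: sum_subtractf)
    also have "(\<Sum>\<mu>\<in>\<Lambda>. (\<Sum>b<r. U (Inr \<gamma>) (Inr (fst (fst \<mu>), b)) * D b (snd (fst \<mu>)) i (snd \<mu>)) * c \<mu>)
      = (\<Sum>e\<in>E. \<Sum>a<s. \<Sum>i'<m. \<Sum>b<r. U (Inr \<gamma>) (Inr (e, b)) * (D b a i i' * c ((e,a),i')))"
      unfolding \<Lambda>_def sum.cartesian_product' by (simp add: sum_distrib_right mult.assoc)
    also have "\<dots> = (\<Sum>e\<in>E. \<Sum>b<r. U (Inr \<gamma>) (Inr (e,b)) * act D s m (\<lambda>a i. c ((e,a),i)) b i)"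
      unfolding act_def sum_distrib_left by (rule sum.cong[OF refl]) (simp only: sum.swap[of _ "{..<r}"])
    finally show ?thesis .
  qed
  have inj: "c \<mu> = 0" if c: "\<And>\<mu>. \<mu> \<in> \<Lambda> \<Longrightarrow> (\<Sum>\<mu>'\<in>\<Lambda>. T \<mu> \<mu>' * c \<mu>') = 0" and \<mu>: "\<mu> \<in> \<Lambda>" for c \<mu>
  proof -
    define f where "f \<gamma> i = c (\<gamma>,i)" for \<gamma> i
    have f: "f \<gamma> i = out D m (\<lambda>l i. 0) f i (Inr \<gamma>)" if "\<gamma> \<in> E \<times> {..<s}" "i < m" for \<gamma> i
    proof -
      have "(\<gamma>,i) \<in> \<Lambda>" using that by (auto simp: \<Lambda>_def)
      from Tc[OF this, of c] c[OF this] show ?thesis by (simp add: out_Inr f_def[abs_def])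
    qed
    obtain \<kappa> where \<kappa>: "0 < \<kappa>"
      "nsq {..<m} (\<lambda>i. out D m (\<lambda>l i. 0) f i (Inl ())) + \<kappa> * (\<Sum>e\<in>E. \<Sum>a<s. nsq {..<m} (f (e,a)))
        \<le> (\<Sum>l<k. nsq {..<m} ((\<lambda>l i. 0) l))"
      using energy_strict[OF assms f] by blast
    have "(\<Sum>l<k. nsq {..<m} ((\<lambda>l i. 0) l)) = 0" by (simp add: nsq_def)
    then have "\<kappa> * (\<Sum>e\<in>E. \<Sum>a<s. nsq {..<m} (f (e,a))) \<le> 0"
      using \<kappa>(2) nsq_nonneg[of "{..<m}" "\<lambda>i. out D m (\<lambda>l i. 0) f i (Inl ())"] by linarith
    then have "(\<Sum>e\<in>E. \<Sum>a<s. nsq {..<m} (f (e,a))) \<le> 0" using \<kappa>(1) by (simp add: mult_le_0_iff)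
    then have "(\<Sum>e\<in>E. \<Sum>a<s. nsq {..<m} (f (e,a))) = 0" by (intro order_antisym sum_nonneg) auto
    then have "nsq {..<m} (f (e,a)) = 0" if "e \<in> E" "a < s" for e a
      using that finE by (simp add: sum_nonneg_eq_0_iff sum_nonneg)
    then show ?thesis using \<mu> by (auto simp: \<Lambda>_def nsq_eq_0 f_def)
  qed
  have "\<exists>R. \<forall>i\<in>\<Lambda>. \<forall>j\<in>\<Lambda>. (\<Sum>e\<in>\<Lambda>. T i e * R e j) = (if i = j then 1 else 0)"
  proof (rule finite_injective_inverse[OF fin, of T])
    fix c \<mu> assume "\<And>i. i \<in> \<Lambda> \<Longrightarrow> (\<Sum>j\<in>\<Lambda>. T i j * c j) = 0" "\<mu> \<in> \<Lambda>"
    then show "c \<mu> = 0" by (rule inj)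
  next
    fix R assume "\<And>i j. i \<in> \<Lambda> \<Longrightarrow> j \<in> \<Lambda> \<Longrightarrow> (\<Sum>e\<in>\<Lambda>. T i e * R e j) = (if i = j then 1 else 0)"
    then show ?thesis by blast
  qed
  then obtain R where R: "\<And>i j. i \<in> \<Lambda> \<Longrightarrow> j \<in> \<Lambda> \<Longrightarrow> (\<Sum>e\<in>\<Lambda>. T i e * R e j) = (if i = j then 1 else 0)"
    by blast
  define w where "w = (\<lambda>(\<gamma>,i). \<Sum>l<k. U (Inr \<gamma>) (Inl l) * u l i)"
  define c where "c \<mu> = (\<Sum>\<nu>\<in>\<Lambda>. R \<mu> \<nu> * w \<nu>)" for \<mu>
  define f where "f \<gamma> i = c (\<gamma>,i)" for \<gamma> i
  have "f \<gamma> i = out D m u f i (Inr \<gamma>)" if "\<gamma> \<in> E \<times> {..<s}" "i < m" for \<gamma> i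
  proof -
    have in\<Lambda>: "(\<gamma>,i) \<in> \<Lambda>" using that by (auto simp: \<Lambda>_def)
    have "(\<Sum>\<mu>\<in>\<Lambda>. T (\<gamma>,i) \<mu> * c \<mu>) = (\<Sum>\<nu>\<in>\<Lambda>. (\<Sum>\<mu>\<in>\<Lambda>. T (\<gamma>,i) \<mu> * R \<mu> \<nu>) * w \<nu>)"
      unfolding c_def sum_distrib_left sum_distrib_right by (subst sum.swap) (simp add: mult.assoc)
    also have "\<dots> = (\<Sum>\<nu>\<in>\<Lambda>. if (\<gamma>,i) = \<nu> then w \<nu> else 0)"
      by (intro sum.cong refl) (simp add: R[OF in\<Lambda>])
    also have "\<dots> = w (\<gamma>,i)" using in\<Lambda> fin by simp
    finally show ?thesis using Tc[OF in\<Lambda>, of c] by (simp add: out_Inr f_def[abs_def] w_def algebra_simps)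
  qed
  then have "sol D m u (\<lambda>i. out D m u f i (Inl ())) f" by (simp add: sol_def)
  then show ?thesis by blast
qed

text \<open>Column (l,j) is the output for the unit input at (l,j). The choice is harmless: for
  strictly contractive \<open>D\<close> the output is unique on \<open>i < m\<close>.\<close>

definition tf :: "(nat \<Rightarrow> nat \<Rightarrow> nat \<Rightarrow> nat \<Rightarrow> complex) \<Rightarrow> nat \<Rightarrow> nat \<Rightarrow> nat \<Rightarrow> nat \<Rightarrow> complex" where
  "tf D m l i j = (SOME v. \<exists>f. sol D m (\<lambda>l' i'. if l' = l \<and> i' = j then 1 else 0) v f) i"

lemma tf_sol:
  assumes "strict_contr r s m D"
  shows "\<exists>f. sol D m (\<lambda>l' i'. if l' = l \<and> i' = j then 1 else 0) (\<lambda>i. tf D m l i j) f"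
  unfolding tf_def using someI_ex[OF sol_exists[OF assms]] .

lemma tf_apply:
  assumes D: "strict_contr r s m D" and sol: "sol D m u v f" and "i < m"
  shows "(\<Sum>l<k. \<Sum>j<m. tf D m l i j * u l j) = v i"
proof -
  obtain F where F: "\<And>l j. sol D m (\<lambda>l' i'. if l' = l \<and> i' = j then 1 else 0) (\<lambda>i. tf D m l i j) (F l j)"
    using tf_sol[OF D] by metis
  define T where "T = {..<k} \<times> {..<m}"
  have "sol D m (\<lambda>l i. \<Sum>t\<in>T. (if l = fst t \<and> i = snd t then 1 else 0) * u (fst t) (snd t))
     (\<lambda>i. \<Sum>t\<in>T. tf D m (fst t) i (snd t) * u (fst t) (snd t)) (\<lambda>\<gamma> i. \<Sum>t\<in>T. F (fst t) (snd t) \<gamma> i * u (fst t) (snd t))"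
    by (rule sol_sum) (rule F)
  then have "sol D m u (\<lambda>i. \<Sum>t\<in>T. tf D m (fst t) i (snd t) * u (fst t) (snd t)) (\<lambda>\<gamma> i. \<Sum>t\<in>T. F (fst t) (snd t) \<gamma> i * u (fst t) (snd t))"
  proof (rule sol_cong)
    fix l i assume "l < k" "i < m"
    have "(\<Sum>t\<in>T. (if l = fst t \<and> i = snd t then 1 else 0) * u (fst t) (snd t)) =
      (\<Sum>t\<in>T. if (l,i) = t then u (fst t) (snd t) else 0)"
      by (intro sum.cong refl) auto
    also have "\<dots> = u l i" using \<open>l < k\<close> \<open>i < m\<close> by (simp add: T_def)
    finally show "(\<Sum>t\<in>T. (if l = fst t \<and> i = snd t then 1 else 0) * u (fst t) (snd t)) = u l i" .
  qed
  from sol_unique[OF D this sol \<open>i < m\<close>] show ?thesis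
    by (simp add: T_def sum.cartesian_product split_def)
qed

lemma tf_contr:
  assumes "strict_contr r s m D"
  shows "nsq {..<m} (\<lambda>i. \<Sum>l<k. \<Sum>j<m. tf D m l i j * u l j) \<le> (\<Sum>l<k. nsq {..<m} (u l))"
proof -
  obtain v f where vf: "sol D m u v f" using sol_exists[OF assms] by blast
  have "nsq {..<m} (\<lambda>i. \<Sum>l<k. \<Sum>j<m. tf D m l i j * u l j) = nsq {..<m} v"
    by (intro nsq_cong) (simp add: tf_apply[OF assms vf])
  then show ?thesis using sol_contr[OF assms vf] by simp
qed

text \<open>\<open>W\<close> carries a solution at \<open>D\<close> to a solution at
  \<open>D'\<close>, because \<open>U\<close> acts on the other tensor factor and \<open>W\<close>
  intertwines the two blocks; uniqueness of outputs does the rest. This is the reason why transfer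
  functions are nc.\<close>

lemma tf_intertwine:
  assumes D: "strict_contr r s m D" and D': "strict_contr r s m' D'"
    and W: "\<And>b a i j. b < r \<Longrightarrow> a < s \<Longrightarrow> i < m' \<Longrightarrow> j < m \<Longrightarrow>
      (\<Sum>i'<m. W i i' * D b a i' j) = (\<Sum>i'<m'. D' b a i i' * W i' j)"
    and "l < k" "i < m'" "j < m"
  shows "(\<Sum>i'<m. W i i' * tf D m l i' j) = (\<Sum>i'<m'. tf D' m' l i i' * W i' j)"
proof -
  obtain f where f: "sol D m (\<lambda>l' i'. if l' = l \<and> i' = j then 1 else 0) (\<lambda>i. tf D m l i j) f"
    using tf_sol[OF D] by blast
  define u where "u l' i' = (if l' = l \<and> i' = j then 1 else 0 :: complex)" for l' i'
  define Wa where "Wa x i = (\<Sum>i'<m. W i i' * x i')" for x i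
  have actW: "act D' s m' (\<lambda>a. Wa (g a)) b i = Wa (act D s m g b) i" if "b < r" "i < m'" for g b i
  proof -
    have "act D' s m' (\<lambda>a. Wa (g a)) b i = (\<Sum>a<s. \<Sum>i''<m'. \<Sum>j<m. D' b a i i'' * W i'' j * g a j)"
      by (simp add: act_def Wa_def sum_distrib_left mult.assoc)
    also have "\<dots> = (\<Sum>a<s. \<Sum>j<m. (\<Sum>i''<m'. D' b a i i'' * W i'' j) * g a j)"
      unfolding sum_distrib_right by (intro sum.cong refl sum.swap)
    also have "\<dots> = (\<Sum>a<s. \<Sum>j<m. (\<Sum>i'<m. W i i' * D b a i' j) * g a j)"
      using that by (intro sum.cong refl) (simp add: W)
    also have "\<dots> = (\<Sum>a<s. \<Sum>j<m. \<Sum>i'<m. W i i' * (D b a i' j * g a j))"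
      by (simp only: sum_distrib_right mult.assoc)
    also have "\<dots> = (\<Sum>a<s. \<Sum>i'<m. \<Sum>j<m. W i i' * (D b a i' j * g a j))"
      by (intro sum.cong refl sum.swap)
    also have "\<dots> = (\<Sum>i'<m. \<Sum>a<s. \<Sum>j<m. W i i' * (D b a i' j * g a j))" by (rule sum.swap)
    finally show ?thesis by (simp only: Wa_def act_def sum_distrib_left)
  qed
  have inpW: "inp D' m' (\<lambda>l. Wa (u l)) (\<lambda>\<gamma>. Wa (f \<gamma>)) i \<alpha> = Wa (\<lambda>i. inp D m u f i \<alpha>) i"
    if "\<alpha> \<in> A" "i < m'" for \<alpha> i
    using that by (cases \<alpha>) (auto simp: inp_def A_def actW)
  have outW: "out D' m' (\<lambda>l. Wa (u l)) (\<lambda>\<gamma>. Wa (f \<gamma>)) i \<beta> = Wa (\<lambda>i. out D m u f i \<beta>) i" if "i < m'" for i \<beta>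
  proof -
    have "out D' m' (\<lambda>l. Wa (u l)) (\<lambda>\<gamma>. Wa (f \<gamma>)) i \<beta> = (\<Sum>\<alpha>\<in>A. \<Sum>i'<m. W i i' * (U \<beta> \<alpha> * inp D m u f i' \<alpha>))"
      unfolding out_def using that
      by (intro sum.cong refl) (simp add: inpW, simp add: Wa_def sum_distrib_left mult_ac)
    also have "\<dots> = (\<Sum>i'<m. \<Sum>\<alpha>\<in>A. W i i' * (U \<beta> \<alpha> * inp D m u f i' \<alpha>))" by (rule sum.swap)
    finally show ?thesis by (simp only: Wa_def out_def sum_distrib_left)
  qed
  have Wcong: "Wa x i = Wa y i" if "\<And>i. i < m \<Longrightarrow> x i = y i" for x y i
    using that by (simp add: Wa_def)
  have su: "sol D m u (\<lambda>i. tf D m l i j) f" using f by (simp add: u_def[abs_def])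
  have "sol D' m' (\<lambda>l. Wa (u l)) (Wa (\<lambda>i. tf D m l i j)) (\<lambda>\<gamma>. Wa (f \<gamma>))"
    using su unfolding sol_def by (auto simp: outW intro!: Wcong)
  from tf_apply[OF D' this \<open>i < m'\<close>]
  have "(\<Sum>l'<k. \<Sum>j'<m'. tf D' m' l' i j' * Wa (u l') j') = (\<Sum>i'<m. W i i' * tf D m l i' j)"
    by (simp add: Wa_def)
  moreover have "Wa (u l') j' = (if l' = l then W j' j else 0)" for l' j'
    using \<open>j < m\<close> by (simp add: Wa_def u_def if_distrib cong: if_cong)
  moreover have "(\<Sum>l'<k. \<Sum>j'<m'. tf D' m' l' i j' * (if l' = l then W j' j else 0)) =
     (\<Sum>l'<k. if l' = l then \<Sum>j'<m'. tf D' m' l' i j' * W j' j else 0)"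
    by (intro sum.cong refl) auto
  ultimately show ?thesis using \<open>l < k\<close> by simp
qed

end

section \<open>Noncommutative functions and intertwiners\<close>

lemma mult_mat_entry:
  assumes "A \<in> carrier_mat p q" "B \<in> carrier_mat q t" "i < p" "j < t"
  shows "(A * B) $$ (i,j) = (\<Sum>l<q. A $$ (i,l) * B $$ (l,j))"
  using assms by (simp add: scalar_prod_def lessThan_atLeast0)

lemma mult_mat_vec_entry:
  assumes "A \<in> carrier_mat p q" "v \<in> carrier_vec q" "i < p"
  shows "vec_index (A *\<^sub>v v) i = (\<Sum>j<q. A $$ (i,j) * vec_index v j)"
  using assms by (simp add: scalar_prod_def lessThan_atLeast0)

lemma vnorm_nsq: "v \<in> carrier_vec q \<Longrightarrow> vnorm v = sqrt (nsq {..<q} (vec_index v))"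
  by (auto simp: vnorm_def nsq_def)

lemma vnorm_mult_mat_vec:
  assumes "A \<in> carrier_mat p q" "v \<in> carrier_vec q"
  shows "vnorm (A *\<^sub>v v) = sqrt (nsq {..<p} (\<lambda>i. \<Sum>j<q. A $$ (i,j) * vec_index v j))"
proof -
  have "A *\<^sub>v v \<in> carrier_vec p" using assms by simp
  then have "vnorm (A *\<^sub>v v) = sqrt (nsq {..<p} (vec_index (A *\<^sub>v v)))" by (rule vnorm_nsq)
  also have "nsq {..<p} (vec_index (A *\<^sub>v v)) = nsq {..<p} (\<lambda>i. \<Sum>j<q. A $$ (i,j) * vec_index v j)"
    using assms by (intro nsq_cong) (simp only: mult_mat_vec_entry lessThan_iff)
  finally show ?thesis .
qed

text \<open>A crude bound by row sums is enough; boundedness is what gives the real supremum in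
  \<open>opnorm\<close> its meaning.\<close>

lemma opnorm_set_bdd:
  assumes A: "A \<in> carrier_mat p q"
  shows "bdd_above {vnorm (A *\<^sub>v v) | v. v \<in> carrier_vec (dim_col A) \<and> vnorm v \<le> 1}"
proof (rule bdd_aboveI)
  fix t assume "t \<in> {vnorm (A *\<^sub>v v) | v. v \<in> carrier_vec (dim_col A) \<and> vnorm v \<le> 1}"
  then obtain v where v: "t = vnorm (A *\<^sub>v v)" "v \<in> carrier_vec q" "vnorm v \<le> 1" using A by auto
  have "nsq {..<q} (vec_index v) \<le> 1" using v by (simp add: vnorm_nsq)
  have le1: "cmod (vec_index v j) \<le> 1" if "j < q" for j
  proof -
    have "(cmod (vec_index v j))\<^sup>2 \<le> nsq {..<q} (vec_index v)"
      unfolding nsq_def using that by (intro member_le_sum) auto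
    then have "(cmod (vec_index v j))\<^sup>2 \<le> 1" using \<open>nsq {..<q} (vec_index v) \<le> 1\<close> by linarith
    then show ?thesis by (simp add: power_le_one_iff abs_square_le_1)
  qed
  have "nsq {..<p} (\<lambda>i. \<Sum>j<q. A $$ (i,j) * vec_index v j) \<le> (\<Sum>i<p. (\<Sum>j<q. cmod (A $$ (i,j)))\<^sup>2)"
    unfolding nsq_def
  proof (intro sum_mono power_mono)
    fix i
    have "cmod (\<Sum>j<q. A $$ (i,j) * vec_index v j) \<le> (\<Sum>j<q. cmod (A $$ (i,j) * vec_index v j))"
      by (rule norm_sum)
    also have "\<dots> \<le> (\<Sum>j<q. cmod (A $$ (i,j)))"
      by (intro sum_mono) (simp add: norm_mult le1 mult_left_le)
    finally show "cmod (\<Sum>j<q. A $$ (i,j) * vec_index v j) \<le> (\<Sum>j<q. cmod (A $$ (i,j)))" .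
  qed simp
  then show "t \<le> sqrt (\<Sum>i<p. (\<Sum>j<q. cmod (A $$ (i,j)))\<^sup>2)"
    unfolding v(1) vnorm_mult_mat_vec[OF A v(2)] by simp
qed

lemma opnorm_le:
  assumes A: "A \<in> carrier_mat p q" and c: "0 \<le> c"
    and le: "\<And>g. nsq {..<p} (\<lambda>i. \<Sum>j<q. A $$ (i,j) * g j) \<le> c\<^sup>2 * nsq {..<q} g"
  shows "opnorm A \<le> c"
  unfolding opnorm_def
proof (rule cSup_least)
  have "0\<^sub>v (dim_col A) \<in> carrier_vec (dim_col A)" "vnorm (0\<^sub>v (dim_col A)) \<le> 1"
    by (auto simp: vnorm_def)
  then show "{vnorm (A *\<^sub>v v) | v. v \<in> carrier_vec (dim_col A) \<and> vnorm v \<le> 1} \<noteq> {}" by blast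
next
  fix t assume "t \<in> {vnorm (A *\<^sub>v v) | v. v \<in> carrier_vec (dim_col A) \<and> vnorm v \<le> 1}"
  then obtain v where v: "t = vnorm (A *\<^sub>v v)" "v \<in> carrier_vec q" "vnorm v \<le> 1" using A by auto
  have "nsq {..<q} (vec_index v) \<le> 1" using v by (simp add: vnorm_nsq)
  then have "c\<^sup>2 * nsq {..<q} (vec_index v) \<le> c\<^sup>2 * 1" by (intro mult_left_mono) auto
  then have "nsq {..<p} (\<lambda>i. \<Sum>j<q. A $$ (i,j) * vec_index v j) \<le> c\<^sup>2"
    using le[of "vec_index v"] by linarith
  then show "t \<le> c" unfolding v(1) vnorm_mult_mat_vec[OF A v(2)] using c
    by (simp add: real_le_lsqrt)
qed

lemma opnorm_bound:
  assumes A: "A \<in> carrier_mat p q"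
  shows "0 \<le> opnorm A" "nsq {..<p} (\<lambda>i. \<Sum>j<q. A $$ (i,j) * g j) \<le> (opnorm A)\<^sup>2 * nsq {..<q} g"
proof -
  have up: "nsq {..<p} (\<lambda>i. \<Sum>j<q. A $$ (i,j) * g j) \<le> (opnorm A)\<^sup>2" "0 \<le> opnorm A"
    if g: "nsq {..<q} g \<le> 1" for g
  proof -
    define v where "v = Matrix.vec q g"
    have vc: "v \<in> carrier_vec q" by (simp add: v_def)
    have vg: "vec_index v j = g j" if "j < q" for j using that by (simp add: v_def)
    have "nsq {..<q} (vec_index v) = nsq {..<q} g" by (intro nsq_cong) (simp add: vg)
    then have "vnorm v \<le> 1" using g by (simp add: vnorm_nsq[OF vc])
    then have le: "vnorm (A *\<^sub>v v) \<le> opnorm A"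
      unfolding opnorm_def using vc A by (intro cSup_upper opnorm_set_bdd[OF A]) auto
    have e: "vnorm (A *\<^sub>v v) = sqrt (nsq {..<p} (\<lambda>i. \<Sum>j<q. A $$ (i,j) * g j))"
      unfolding vnorm_mult_mat_vec[OF A vc] by (simp add: vg)
    show "0 \<le> opnorm A" using le unfolding e by (meson nsq_nonneg order_trans real_sqrt_ge_zero)
    then show "nsq {..<p} (\<lambda>i. \<Sum>j<q. A $$ (i,j) * g j) \<le> (opnorm A)\<^sup>2"
      using le unfolding e by (metis nsq_nonneg power_mono real_sqrt_ge_zero real_sqrt_pow2)
  qed
  show "0 \<le> opnorm A" by (rule up(2)[of "\<lambda>_. 0"]) (simp add: nsq_def)
  show "nsq {..<p} (\<lambda>i. \<Sum>j<q. A $$ (i,j) * g j) \<le> (opnorm A)\<^sup>2 * nsq {..<q} g"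
  proof (cases "nsq {..<q} g = 0")
    case True
    then have "g j = 0" if "j < q" for j using that by (simp add: nsq_eq_0)
    then show ?thesis using True by (simp add: nsq_def)
  next
    case False
    \<comment> \<open>Dividing \<open>g\<close> by its norm reduces the general case to the unit
      ball.\<close>
    define c where "c = nsq {..<q} g"
    have c: "0 < c" using False nsq_nonneg[of "{..<q}" g] unfolding c_def by linarith
    have sc: "nsq X (\<lambda>i. complex_of_real (1 / sqrt c) * h i) = nsq X h / c" for X and h :: "nat \<Rightarrow> complex"
      using c by (simp add: nsq_def norm_mult norm_divide power_mult_distrib power_divide sum_divide_distrib)
    have "nsq {..<p} (\<lambda>i. \<Sum>j<q. A $$ (i,j) * (complex_of_real (1 / sqrt c) * g j)) \<le> (opnorm A)\<^sup>2"
      by (rule up(1)) (use c in \<open>simp only: sc, simp add: c_def\<close>)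
    also have "(\<lambda>i. \<Sum>j<q. A $$ (i,j) * (complex_of_real (1 / sqrt c) * g j)) =
        (\<lambda>i. complex_of_real (1 / sqrt c) * (\<Sum>j<q. A $$ (i,j) * g j))"
      by (simp only: sum_distrib_left mult.left_commute)
    finally have "nsq {..<p} (\<lambda>i. \<Sum>j<q. A $$ (i,j) * g j) / c \<le> (opnorm A)\<^sup>2" unfolding sc .
    then show ?thesis using c by (simp add: c_def field_simps)
  qed
qed

section \<open>Block indices and the domain in coordinates\<close>

lemma sum_lessThan_add:
  fixes f :: "nat \<Rightarrow> 'a::comm_monoid_add"
  shows "(\<Sum>i<m + n. f i) = (\<Sum>i<m. f i) + (\<Sum>i<n. f (m + i))"
  by (induction n) (simp_all add: add.assoc)

lemma sum_blocks:
  fixes f :: "nat \<Rightarrow> 'a::comm_monoid_add"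
  shows "(\<Sum>i<s * n. f i) = (\<Sum>a<s. \<Sum>j<n. f (a * n + j))"
proof (induction s)
  case (Suc s)
  have "(\<Sum>i<Suc s * n. f i) = (\<Sum>i<s * n + n. f i)" by (simp add: add.commute)
  then show ?case unfolding sum_lessThan_add Suc by simp
qed simp

lemma block_less: "b < r \<Longrightarrow> i < n \<Longrightarrow> b * n + i < r * (n::nat)"
proof -
  assume "b < r" "i < n"
  then have "b * n + i < Suc b * n" by simp
  also have "\<dots> \<le> r * n" using \<open>b < r\<close> by (intro mult_le_mono1) simp
  finally show ?thesis .
qed

definition delta_entry :: "(nat \<Rightarrow> nat \<Rightarrow> nat list \<Rightarrow> complex) \<Rightarrow> nat \<Rightarrow> complex mat list \<Rightarrow> nat \<Rightarrow> nat \<Rightarrow> nat \<Rightarrow> nat \<Rightarrow> complex" where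
  "delta_entry \<delta> n x b a i j = fp_eval n (\<delta> b a) x $$ (i,j)"

text \<open>The flat index \<open>b * n + i\<close> used by \<open>fpm_eval\<close> is the block
  index (b,i), so the flat matrix and the block action have the same norm. One direction takes
  \<rho> to be the square of \<open>opnorm\<close>, the other bounds \<open>opnorm\<close> by
  \<open>sqrt \<rho>\<close>.\<close>

lemma G_delta_iff:
  assumes n: "n \<ge> 1"
  shows "x \<in> G_delta d r s \<delta> n \<longleftrightarrow> tuple_of d n x \<and> strict_contr r s n (delta_entry \<delta> n x)"
proof -
  define A where "A = fpm_eval r s \<delta> n x"
  have A: "A \<in> carrier_mat (r * n) (s * n)" by (simp add: A_def fpm_eval_def)
  have Ae: "A $$ (b * n + i, a * n + j) = delta_entry \<delta> n x b a i j" if "b < r" "a < s" "i < n" "j < n" for a b i j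
    using that block_less[of b r i n] block_less[of a s j n] by (simp add: A_def fpm_eval_def delta_entry_def)
  have nA: "nsq {..<r * n} (\<lambda>i. \<Sum>j<s * n. A $$ (i,j) * g j) =
      (\<Sum>b<r. nsq {..<n} (act (delta_entry \<delta> n x) s n (\<lambda>a j. g (a * n + j)) b))" for g
    unfolding nsq_def sum_blocks act_def by (intro sum.cong refl) (simp add: Ae)
  have ng: "nsq {..<s * n} g = (\<Sum>a<s. nsq {..<n} (\<lambda>j. g (a * n + j)))" for g
    unfolding nsq_def sum_blocks ..
  have "opnorm A < 1 \<longleftrightarrow> strict_contr r s n (delta_entry \<delta> n x)"
  proof
    assume lt: "opnorm A < 1"
    have "(\<Sum>b<r. nsq {..<n} (act (delta_entry \<delta> n x) s n g b)) \<le> (opnorm A)\<^sup>2 * (\<Sum>a<s. nsq {..<n} (g a))" for g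
      using opnorm_bound(2)[OF A, of "\<lambda>J. g (J div n) (J mod n)"] n unfolding nA ng
      by (simp add: act_def nsq_def)
    moreover have "(opnorm A)\<^sup>2 < 1" using lt opnorm_bound(1)[OF A] by (simp add: abs_square_less_1)
    ultimately show "strict_contr r s n (delta_entry \<delta> n x)"
      unfolding strict_contr_def by (intro exI[of _ "(opnorm A)\<^sup>2"]) auto
  next
    assume "strict_contr r s n (delta_entry \<delta> n x)"
    then obtain \<rho> where \<rho>: "0 \<le> \<rho>" "\<rho> < 1"
      and Dc: "\<And>g. (\<Sum>b<r. nsq {..<n} (act (delta_entry \<delta> n x) s n g b)) \<le> \<rho> * (\<Sum>a<s. nsq {..<n} (g a))"
      unfolding strict_contr_def by blast
    have "opnorm A \<le> sqrt \<rho>"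
      using \<rho> Dc by (intro opnorm_le[OF A]) (simp_all add: nA ng)
    also have "\<dots> < 1" using \<rho> by simp
    finally show "opnorm A < 1" .
  qed
  then show ?thesis by (simp add: G_delta_def A_def)
qed

section \<open>Intertwiners of points and of free polynomials\<close>

definition intertwines :: "nat \<Rightarrow> complex mat \<Rightarrow> complex mat list \<Rightarrow> complex mat list \<Rightarrow> bool" where
  "intertwines d W x y \<longleftrightarrow> (\<forall>t<d. W * x ! t = y ! t * W)"

lemma tuple_of_nth: "tuple_of d n x \<Longrightarrow> t < d \<Longrightarrow> x ! t \<in> carrier_mat n n"
  by (simp add: tuple_of_def)

lemma word_eval_carrier:
  "tuple_of d n x \<Longrightarrow> set w \<subseteq> {..<d} \<Longrightarrow> word_eval n x w \<in> carrier_mat n n"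
  by (induction w) (auto simp: word_eval_def tuple_of_nth intro!: mult_carrier_mat)

text \<open>The intertwiner is moved past one letter at a time; linear combinations of words follow
  in \<open>fp_eval_intertwine\<close>.\<close>

lemma word_eval_intertwine:
  assumes "tuple_of d n x" "tuple_of d m y" "W \<in> carrier_mat m n" "intertwines d W x y"
  shows "set w \<subseteq> {..<d} \<Longrightarrow> W * word_eval n x w = word_eval m y w * W"
proof (induction w)
  case Nil
  then show ?case using assms(3) by (simp add: word_eval_def)
next
  case (Cons t w)
  have t: "t < d" and w: "set w \<subseteq> {..<d}" using Cons.prems by auto
  note xt = tuple_of_nth[OF assms(1) t] and yt = tuple_of_nth[OF assms(2) t]
  note xw = word_eval_carrier[OF assms(1) w] and yw = word_eval_carrier[OF assms(2) w]
  have "W * word_eval n x (t # w) = (W * x ! t) * word_eval n x w"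
    using assoc_mult_mat[OF assms(3) xt xw] by (simp add: word_eval_def)
  also have "W * x ! t = y ! t * W" using assms(4) t by (simp add: intertwines_def)
  also have "(y ! t * W) * word_eval n x w = y ! t * (W * word_eval n x w)"
    by (rule assoc_mult_mat[OF yt assms(3) xw])
  also have "\<dots> = y ! t * (word_eval m y w * W)" using Cons.IH[OF w] by simp
  also have "\<dots> = (y ! t * word_eval m y w) * W"
    by (rule assoc_mult_mat[OF yt yw assms(3), symmetric])
  finally show ?case by (simp add: word_eval_def)
qed

lemma fp_eval_carrier [simp]: "fp_eval n p x \<in> carrier_mat n n"
  by (simp add: fp_eval_def)

lemma fp_eval_intertwine:
  assumes x: "tuple_of d n x" and y: "tuple_of d m y" and W: "W \<in> carrier_mat m n"
    and i: "intertwines d W x y" and p: "free_poly d p"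
  shows "W * fp_eval n p x = fp_eval m p y * W"
proof (rule eq_matI)
  fix i j assume "i < dim_row (fp_eval m p y * W)" "j < dim_col (fp_eval m p y * W)"
  then have ij: "i < m" "j < n" using W by (auto simp: fp_eval_def)
  let ?S = "{w. p w \<noteq> 0}"
  have S: "set w \<subseteq> {..<d}" if "w \<in> ?S" for w using that p by (simp add: free_poly_def)
  have "(W * fp_eval n p x) $$ (i,j) = (\<Sum>l<n. W $$ (i,l) * fp_eval n p x $$ (l,j))"
    by (rule mult_mat_entry[OF W fp_eval_carrier ij])
  also have "\<dots> = (\<Sum>l<n. \<Sum>w\<in>?S. p w * (W $$ (i,l) * word_eval n x w $$ (l,j)))"
    using ij by (intro sum.cong[OF refl]) (simp add: fp_eval_def sum_distrib_left mult.left_commute)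
  also have "\<dots> = (\<Sum>w\<in>?S. p w * (\<Sum>l<n. W $$ (i,l) * word_eval n x w $$ (l,j)))"
    unfolding sum_distrib_left by (rule sum.swap)
  also have "\<dots> = (\<Sum>w\<in>?S. p w * (W * word_eval n x w) $$ (i,j))"
    using ij S by (intro sum.cong refl) (simp add: mult_mat_entry[OF W word_eval_carrier[OF x]])
  also have "\<dots> = (\<Sum>w\<in>?S. p w * (word_eval m y w * W) $$ (i,j))"
    using S by (intro sum.cong refl) (simp add: word_eval_intertwine[OF x y W i])
  also have "\<dots> = (\<Sum>w\<in>?S. p w * (\<Sum>l<m. word_eval m y w $$ (i,l) * W $$ (l,j)))"
    using ij S by (intro sum.cong refl) (simp add: mult_mat_entry[OF word_eval_carrier[OF y] W])
  also have "\<dots> = (\<Sum>l<m. \<Sum>w\<in>?S. p w * (word_eval m y w $$ (i,l) * W $$ (l,j)))"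
    unfolding sum_distrib_left by (rule sum.swap)
  also have "\<dots> = (\<Sum>l<m. fp_eval m p y $$ (i,l) * W $$ (l,j))"
    using ij by (intro sum.cong[OF refl]) (simp add: fp_eval_def sum_distrib_right mult.assoc)
  also have "\<dots> = (fp_eval m p y * W) $$ (i,j)"
    by (rule mult_mat_entry[OF fp_eval_carrier W ij, symmetric])
  finally show "(W * fp_eval n p x) $$ (i,j) = (fp_eval m p y * W) $$ (i,j)" .
qed (use W in \<open>auto simp: fp_eval_def\<close>)

lemma delta_entry_intertwine:
  assumes "tuple_of d n x" "tuple_of d m y" "W \<in> carrier_mat m n" "intertwines d W x y"
    and "fp_matrix d r s \<delta>" "b < r" "a < s" "i < m" "j < n"
  shows "(\<Sum>l<n. W $$ (i,l) * delta_entry \<delta> n x b a l j) = (\<Sum>l<m. delta_entry \<delta> m y b a i l * W $$ (l,j))"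
proof -
  have "free_poly d (\<delta> b a)" using assms by (simp add: fp_matrix_def)
  from fp_eval_intertwine[OF assms(1-4) this]
  have "(W * fp_eval n (\<delta> b a) x) $$ (i,j) = (fp_eval m (\<delta> b a) y * W) $$ (i,j)" by simp
  then show ?thesis using assms(8,9)
    by (simp add: mult_mat_entry[OF assms(3) fp_eval_carrier] mult_mat_entry[OF fp_eval_carrier assms(3)] delta_entry_def)
qed

section \<open>Direct sums expressed by block inclusions\<close>

definition dsum :: "nat \<Rightarrow> nat \<Rightarrow> complex mat list \<Rightarrow> complex mat list \<Rightarrow> complex mat list" where
  "dsum n m x y = map2 (\<lambda>a b. four_block_mat a (0\<^sub>m n m) (0\<^sub>m m n) b) x y"

text \<open>\<open>inl_mat\<close> and \<open>inr_mat\<close> are the two block inclusions of a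
  direct sum; through them direct sums become a special case of intertwining.\<close>

definition inl_mat :: "nat \<Rightarrow> nat \<Rightarrow> complex mat" where
  "inl_mat n m = Matrix.mat (n + m) n (\<lambda>(i,j). if i = j then 1 else 0)"

definition inr_mat :: "nat \<Rightarrow> nat \<Rightarrow> complex mat" where
  "inr_mat n m = Matrix.mat (n + m) m (\<lambda>(i,j). if i = n + j then 1 else 0)"

lemma inl_mat_carrier [simp]: "inl_mat n m \<in> carrier_mat (n + m) n" by (simp add: inl_mat_def)
lemma inr_mat_carrier [simp]: "inr_mat n m \<in> carrier_mat (n + m) m" by (simp add: inr_mat_def)

lemma delta_mult: "(if P then 1 else 0) * z = (if P then z else (0::complex))"
  "z * (if P then 1 else 0) = (if P then z else (0::complex))"
  by auto

lemma inl_mult: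
  assumes "B \<in> carrier_mat n t" "i < n + m" "j < t"
  shows "(inl_mat n m * B) $$ (i,j) = (if i < n then B $$ (i,j) else 0)"
  using assms by (simp add: mult_mat_entry[OF inl_mat_carrier assms(1)])
    (simp add: inl_mat_def delta_mult)

lemma inr_mult:
  assumes "B \<in> carrier_mat m t" "i < n + m" "j < t"
  shows "(inr_mat n m * B) $$ (i,j) = (if i < n then 0 else B $$ (i - n,j))"
proof -
  have "(inr_mat n m * B) $$ (i,j) = (\<Sum>l<m. if i = n + l then B $$ (l,j) else 0)"
    using assms by (simp add: mult_mat_entry[OF inr_mat_carrier assms(1)]) (simp add: inr_mat_def delta_mult)
  also have "\<dots> = (\<Sum>l<m. if l = i - n \<and> n \<le> i then B $$ (l,j) else 0)"
    by (intro sum.cong refl) auto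
  also have "\<dots> = (if i < n then 0 else B $$ (i - n,j))"
    using assms by (cases "i < n") auto
  finally show ?thesis .
qed

lemma mult_inl:
  assumes "B \<in> carrier_mat t (n + m)" "i < t" "j < n"
  shows "(B * inl_mat n m) $$ (i,j) = B $$ (i,j)"
  using assms by (simp add: mult_mat_entry[OF assms(1) inl_mat_carrier])
    (simp add: inl_mat_def delta_mult)

lemma mult_inr:
  assumes "B \<in> carrier_mat t (n + m)" "i < t" "j < m"
  shows "(B * inr_mat n m) $$ (i,j) = B $$ (i,n + j)"
  using assms by (simp add: mult_mat_entry[OF assms(1) inr_mat_carrier])
    (simp add: inr_mat_def delta_mult)

text \<open>A matrix is determined by its products with the two inclusions, which read off its first
  n and its last m columns.\<close>

lemma four_block_diag_iff:
  assumes Z: "Z \<in> carrier_mat (n + m) (n + m)" and X: "X \<in> carrier_mat n n" and Y: "Y \<in> carrier_mat m m"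
  shows "Z = four_block_mat X (0\<^sub>m n m) (0\<^sub>m m n) Y \<longleftrightarrow>
    inl_mat n m * X = Z * inl_mat n m \<and> inr_mat n m * Y = Z * inr_mat n m" (is "_ = ?R")
proof
  assume Zf: "Z = four_block_mat X (0\<^sub>m n m) (0\<^sub>m m n) Y"
  have "inl_mat n m * X = Z * inl_mat n m"
  proof (rule eq_matI)
    fix i j assume "i < dim_row (Z * inl_mat n m)" "j < dim_col (Z * inl_mat n m)"
    then have ij: "i < n + m" "j < n" using Z by (auto simp: inl_mat_def)
    show "(inl_mat n m * X) $$ (i,j) = (Z * inl_mat n m) $$ (i,j)"
      unfolding inl_mult[OF X ij] mult_inl[OF Z ij] using ij X Y by (auto simp: Zf)
  qed (use X Z in \<open>auto simp: inl_mat_def\<close>)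
  moreover have "inr_mat n m * Y = Z * inr_mat n m"
  proof (rule eq_matI)
    fix i j assume "i < dim_row (Z * inr_mat n m)" "j < dim_col (Z * inr_mat n m)"
    then have ij: "i < n + m" "j < m" using Z by (auto simp: inr_mat_def)
    show "(inr_mat n m * Y) $$ (i,j) = (Z * inr_mat n m) $$ (i,j)"
      unfolding inr_mult[OF Y ij] mult_inr[OF Z ij] using ij X Y by (auto simp: Zf)
  qed (use Y Z in \<open>auto simp: inr_mat_def\<close>)
  ultimately show ?R ..
next
  assume R: ?R
  show "Z = four_block_mat X (0\<^sub>m n m) (0\<^sub>m m n) Y"
  proof (rule eq_matI)
    fix i j assume "i < dim_row (four_block_mat X (0\<^sub>m n m) (0\<^sub>m m n) Y)"
      "j < dim_col (four_block_mat X (0\<^sub>m n m) (0\<^sub>m m n) Y)"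
    then have ij: "i < n + m" "j < n + m" using X Y by auto
    show "Z $$ (i,j) = four_block_mat X (0\<^sub>m n m) (0\<^sub>m m n) Y $$ (i,j)"
    proof (cases "j < n")
      case True
      have "Z $$ (i,j) = (inl_mat n m * X) $$ (i,j)"
        using R mult_inl[OF Z ij(1) True] by simp
      then show ?thesis unfolding inl_mult[OF X ij(1) True] using ij X Y True by auto
    next
      case False
      then have j: "j - n < m" "n + (j - n) = j" using ij by auto
      have "Z $$ (i,j) = (inr_mat n m * Y) $$ (i,j - n)"
        using R mult_inr[OF Z ij(1) j(1)] j(2) by simp
      then show ?thesis unfolding inr_mult[OF Y ij(1) j(1)] using ij X Y False by auto
    qed
  qed (use X Y Z in auto)
qed

lemma dsum_nth:
  assumes "tuple_of d n x" "tuple_of d m y" "t < d"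
  shows "dsum n m x y ! t = four_block_mat (x ! t) (0\<^sub>m n m) (0\<^sub>m m n) (y ! t)"
  using assms by (simp add: dsum_def tuple_of_def)

lemma dsum_tuple: "tuple_of d n x \<Longrightarrow> tuple_of d m y \<Longrightarrow> tuple_of d (n + m) (dsum n m x y)"
proof -
  assume x: "tuple_of d n x" and y: "tuple_of d m y"
  have len: "length (dsum n m x y) = d" using x y by (simp add: dsum_def tuple_of_def)
  have "dsum n m x y ! t \<in> carrier_mat (n + m) (n + m)" if "t < d" for t
    unfolding dsum_nth[OF x y that] using tuple_of_nth[OF x that] tuple_of_nth[OF y that] by simp
  then show ?thesis using len by (auto simp: tuple_of_def in_set_conv_nth)
qed

lemma dsum_intertwines:
  assumes x: "tuple_of d n x" and y: "tuple_of d m y"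
  shows "intertwines d (inl_mat n m) x (dsum n m x y)" "intertwines d (inr_mat n m) y (dsum n m x y)"
proof -
  have "inl_mat n m * x ! t = dsum n m x y ! t * inl_mat n m \<and> inr_mat n m * y ! t = dsum n m x y ! t * inr_mat n m"
    if "t < d" for t
    using four_block_diag_iff[OF tuple_of_nth[OF dsum_tuple[OF x y] that] tuple_of_nth[OF x that] tuple_of_nth[OF y that]]
      dsum_nth[OF x y that] by simp
  then show "intertwines d (inl_mat n m) x (dsum n m x y)" "intertwines d (inr_mat n m) y (dsum n m x y)"
    by (auto simp: intertwines_def)
qed

lemma nsq_lessThan_add: "nsq {..<n + m :: nat} f = nsq {..<n} f + nsq {..<m} (\<lambda>i. f (n + i))"
  unfolding nsq_def by (rule sum_lessThan_add)

text \<open>Each entry of \<delta> at a direct sum is block diagonal, by its intertwining with the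
  inclusions. So \<delta> acts on the two summands separately, and the larger of the two bounds
  works.\<close>

lemma dsum_in_G:
  assumes fp: "fp_matrix d r s \<delta>" and n: "n \<ge> 1" "m \<ge> 1"
    and x: "x \<in> G_delta d r s \<delta> n" and y: "y \<in> G_delta d r s \<delta> m"
  shows "dsum n m x y \<in> G_delta d r s \<delta> (n + m)"
proof -
  have tx: "tuple_of d n x" and ty: "tuple_of d m y"
    and sx: "strict_contr r s n (delta_entry \<delta> n x)" and sy: "strict_contr r s m (delta_entry \<delta> m y)"
    using x y n by (auto simp: G_delta_iff)
  define z where "z = dsum n m x y"
  have tz: "tuple_of d (n + m) z" unfolding z_def by (rule dsum_tuple[OF tx ty])
  have e: "fp_eval (n + m) (\<delta> b a) z = four_block_mat (fp_eval n (\<delta> b a) x) (0\<^sub>m n m) (0\<^sub>m m n) (fp_eval m (\<delta> b a) y)"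
    if "b < r" "a < s" for a b
  proof -
    have p: "free_poly d (\<delta> b a)" using that fp by (simp add: fp_matrix_def)
    show ?thesis
      unfolding four_block_diag_iff[OF fp_eval_carrier fp_eval_carrier fp_eval_carrier]
      using fp_eval_intertwine[OF tx tz _ _ p] fp_eval_intertwine[OF ty tz _ _ p] dsum_intertwines[OF tx ty]
      unfolding z_def by auto
  qed
  have dz: "delta_entry \<delta> (n + m) z b a i j = (if i < n then if j < n then delta_entry \<delta> n x b a i j else 0
      else if j < n then 0 else delta_entry \<delta> m y b a (i - n) (j - n))" if "b < r" "a < s" "i < n + m" "j < n + m" for b a i j
    unfolding delta_entry_def e[OF that(1,2)] using that(3,4)
    using carrier_matD[OF fp_eval_carrier[of n "\<delta> b a" x]] carrier_matD[OF fp_eval_carrier[of m "\<delta> b a" y]]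
    by (auto simp: index_mat_four_block)
  have a1: "act (delta_entry \<delta> (n + m) z) s (n + m) g b i = act (delta_entry \<delta> n x) s n g b i" if "b < r" "i < n" for g b i
    unfolding act_def using that by (intro sum.cong[OF refl]) (simp add: sum_lessThan_add dz)
  have a2: "act (delta_entry \<delta> (n + m) z) s (n + m) g b (n + i) = act (delta_entry \<delta> m y) s m (\<lambda>a j. g a (n + j)) b i"
    if "b < r" "i < m" for g b i
    unfolding act_def using that by (intro sum.cong[OF refl]) (simp add: sum_lessThan_add dz)
  obtain \<rho>1 where \<rho>1: "0 \<le> \<rho>1" "\<rho>1 < 1"
    and D1: "\<And>g. (\<Sum>b<r. nsq {..<n} (act (delta_entry \<delta> n x) s n g b)) \<le> \<rho>1 * (\<Sum>a<s. nsq {..<n} (g a))"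
    using sx unfolding strict_contr_def by blast
  obtain \<rho>2 where \<rho>2: "0 \<le> \<rho>2" "\<rho>2 < 1"
    and D2: "\<And>g. (\<Sum>b<r. nsq {..<m} (act (delta_entry \<delta> m y) s m g b)) \<le> \<rho>2 * (\<Sum>a<s. nsq {..<m} (g a))"
    using sy unfolding strict_contr_def by blast
  define \<rho> where "\<rho> = max \<rho>1 \<rho>2"
  have "(\<Sum>b<r. nsq {..<n + m} (act (delta_entry \<delta> (n + m) z) s (n + m) g b)) \<le> \<rho> * (\<Sum>a<s. nsq {..<n + m} (g a))" for g
  proof -
    have "(\<Sum>b<r. nsq {..<n + m} (act (delta_entry \<delta> (n + m) z) s (n + m) g b)) =
      (\<Sum>b<r. nsq {..<n} (act (delta_entry \<delta> n x) s n g b)) + (\<Sum>b<r. nsq {..<m} (act (delta_entry \<delta> m y) s m (\<lambda>a j. g a (n + j)) b))"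
      unfolding nsq_lessThan_add sum.distrib
      by (intro arg_cong2[where f="(+)"] sum.cong[OF refl] nsq_cong) (simp_all add: a1 a2)
    also have "\<dots> \<le> \<rho>1 * (\<Sum>a<s. nsq {..<n} (g a)) + \<rho>2 * (\<Sum>a<s. nsq {..<m} (\<lambda>j. g a (n + j)))"
      by (intro add_mono D1 D2)
    also have "\<dots> \<le> \<rho> * (\<Sum>a<s. nsq {..<n} (g a)) + \<rho> * (\<Sum>a<s. nsq {..<m} (\<lambda>j. g a (n + j)))"
      by (intro add_mono mult_right_mono sum_nonneg) (auto simp: \<rho>_def)
    finally show ?thesis unfolding nsq_lessThan_add sum.distrib by (simp add: distrib_left)
  qed
  then have "strict_contr r s (n + m) (delta_entry \<delta> (n + m) z)"
    unfolding strict_contr_def using \<rho>1 \<rho>2 by (intro exI[of _ \<rho>]) (auto simp: \<rho>_def)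
  then show ?thesis using tz n by (simp add: G_delta_iff z_def)
qed

text \<open>The similarity clause of \<open>H_inf\<close> asks that the conjugated point lie in the
  domain. This is free here: \<open>S\<close> commutes with every coordinate of the direct sum
  \<open>z\<close>, so conjugation returns \<open>z\<close> itself. The lower left blocks of
  \<open>S * \<phi> z\<close> and \<open>\<phi> z * S\<close> give the claim.\<close>

lemma H_inf_intertwine:
  assumes fp: "fp_matrix d r s \<delta>" and \<phi>: "H_inf d r s \<delta> \<phi>" and n: "n \<ge> 1" "m \<ge> 1"
    and x: "x \<in> G_delta d r s \<delta> n" and y: "y \<in> G_delta d r s \<delta> m"
    and W: "W \<in> carrier_mat m n" and i: "intertwines d W x y"
  shows "W * \<phi> x = \<phi> y * W"
proof -
  have tx: "tuple_of d n x" and ty: "tuple_of d m y" using x y n by (auto simp: G_delta_iff)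
  define z where "z = dsum n m x y"
  have z: "z \<in> G_delta d r s \<delta> (n + m)" unfolding z_def by (rule dsum_in_G[OF fp n x y])
  have tz: "tuple_of d (n + m) z" using z n by (simp add: G_delta_iff)
  have fx: "\<phi> x \<in> carrier_mat n n" and fy: "\<phi> y \<in> carrier_mat m m"
    using \<phi> x y n by (auto simp: H_inf_def)
  have fz: "\<phi> z = four_block_mat (\<phi> x) (0\<^sub>m n m) (0\<^sub>m m n) (\<phi> y)"
    using \<phi> x y n z unfolding z_def dsum_def H_inf_def by blast
  define S where "S = four_block_mat (1\<^sub>m n) (0\<^sub>m n m) W (1\<^sub>m m)"
  define S' where "S' = four_block_mat (1\<^sub>m n) (0\<^sub>m n m) (- W) (1\<^sub>m m)"
  have S: "S \<in> carrier_mat (n + m) (n + m)" and S': "S' \<in> carrier_mat (n + m) (n + m)"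
    by (auto simp: S_def S'_def)
  have one: "four_block_mat (1\<^sub>m n) (0\<^sub>m n m) (0\<^sub>m m n) (1\<^sub>m m) = (1\<^sub>m (n + m) :: complex mat)"
    by (rule eq_matI) auto
  have Wm: "W + - W = 0\<^sub>m m n" "- W + W = 0\<^sub>m m n" "1\<^sub>m n + - 0\<^sub>m n n = (1\<^sub>m n :: complex mat)"
    using W by (auto intro!: eq_matI)
  have SS': "S * S' = 1\<^sub>m (n + m)" and S'S: "S' * S = 1\<^sub>m (n + m)"
    unfolding S_def S'_def using W one Wm
    by (simp_all add: mult_four_block_mat[of _ n n _ m _ m _ _ n _ m])
  have comm: "four_block_mat X (0\<^sub>m n m) (0\<^sub>m m n) Y * S = four_block_mat X (0\<^sub>m n m) (Y * W) Y"
    "S * four_block_mat X (0\<^sub>m n m) (0\<^sub>m m n) Y = four_block_mat X (0\<^sub>m n m) (W * X) Y"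
    if X: "X \<in> carrier_mat n n" and Y: "Y \<in> carrier_mat m m" for X Y
    unfolding S_def using W X Y
    by (simp_all add: mult_four_block_mat[of _ n n _ m _ m _ _ n _ m])
  have conj: "S' * a * S = a" if az: "a \<in> set z" for a
  proof -
    obtain t where t: "t < d" "a = z ! t" using az tz unfolding tuple_of_def in_set_conv_nth by metis
    note xt = tuple_of_nth[OF tx t(1)] and yt = tuple_of_nth[OF ty t(1)]
    have ac: "a \<in> carrier_mat (n + m) (n + m)" using tuple_of_nth[OF tz t(1)] t by simp
    have "a = four_block_mat (x ! t) (0\<^sub>m n m) (0\<^sub>m m n) (y ! t)"
      unfolding t(2) z_def by (rule dsum_nth[OF tx ty t(1)])
    then have "a * S = S * a" using comm[OF xt yt] i t(1) by (simp add: intertwines_def)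
    then have "S' * a * S = S' * S * a" using ac S S' by (metis assoc_mult_mat)
    then show ?thesis using ac by (simp add: S'S)
  qed
  have mz: "map (\<lambda>a. S' * a * S) z = z" by (rule map_idI) (rule conj)
  have fzc: "\<phi> z \<in> carrier_mat (n + m) (n + m)" using fx fy by (simp add: fz)
  have "\<phi> (map (\<lambda>a. S' * a * S) z) = S' * \<phi> z * S"
    using \<phi> z S S' SS' S'S n mz unfolding H_inf_def by (metis trans_le_add1)
  then have "\<phi> z = S' * \<phi> z * S" by (simp add: mz)
  then have "S * \<phi> z = S * (S' * \<phi> z * S)" by simp
  also have "\<dots> = S * (S' * \<phi> z) * S"
    by (rule assoc_mult_mat[OF S mult_carrier_mat[OF S' fzc] S, symmetric])
  also have "S * (S' * \<phi> z) = S * S' * \<phi> z" by (rule assoc_mult_mat[OF S S' fzc, symmetric])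
  also have "S * S' * \<phi> z * S = \<phi> z * S" using fzc by (simp add: SS')
  finally have "four_block_mat (\<phi> x) (0\<^sub>m n m) (W * \<phi> x) (\<phi> y) = four_block_mat (\<phi> x) (0\<^sub>m n m) (\<phi> y * W) (\<phi> y)"
    unfolding fz comm[OF fx fy] .
  then have e: "four_block_mat (\<phi> x) (0\<^sub>m n m) (W * \<phi> x) (\<phi> y) $$ (n + i, j)
      = four_block_mat (\<phi> x) (0\<^sub>m n m) (\<phi> y * W) (\<phi> y) $$ (n + i, j)" for i j by simp
  show ?thesis
  proof (rule eq_matI)
    fix i j assume "i < dim_row (\<phi> y * W)" "j < dim_col (\<phi> y * W)"
    then have "i < m" "j < n" using fy W by auto
    then show "(W * \<phi> x) $$ (i,j) = (\<phi> y * W) $$ (i,j)"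
      using e[of i j] fx fy W by (simp add: index_mat_four_block)
  qed (use fx fy W in auto)
qed

text \<open>Intertwining contains both algebraic clauses of \<open>H_inf\<close>: direct sums
  through the two block inclusions, similarity through the intertwiner \<open>S'\<close>.\<close>

lemma H_infI:
  assumes car: "\<And>n x. n \<ge> 1 \<Longrightarrow> x \<in> G_delta d r s \<delta> n \<Longrightarrow> \<phi> x \<in> carrier_mat n n"
    and i: "\<And>n m x y W. n \<ge> 1 \<Longrightarrow> m \<ge> 1 \<Longrightarrow> x \<in> G_delta d r s \<delta> n \<Longrightarrow> y \<in> G_delta d r s \<delta> m \<Longrightarrow>
      W \<in> carrier_mat m n \<Longrightarrow> intertwines d W x y \<Longrightarrow> W * \<phi> x = \<phi> y * W"
    and bd: "\<And>n x. n \<ge> 1 \<Longrightarrow> x \<in> G_delta d r s \<delta> n \<Longrightarrow> opnorm (\<phi> x) \<le> C"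
  shows "H_inf d r s \<delta> \<phi>"
  unfolding H_inf_def
proof (intro conjI allI impI ballI)
  show "\<And>n x. n \<ge> 1 \<Longrightarrow> x \<in> G_delta d r s \<delta> n \<Longrightarrow> \<phi> x \<in> carrier_mat n n" by (rule car)
  show "\<exists>C. \<forall>n\<ge>1. \<forall>x\<in>G_delta d r s \<delta> n. opnorm (\<phi> x) \<le> C" using bd by blast
next
  fix n m x y
  assume n: "n \<ge> (1::nat)" "m \<ge> (1::nat)" and x: "x \<in> G_delta d r s \<delta> n" and y: "y \<in> G_delta d r s \<delta> m"
    and "map2 (\<lambda>a b. four_block_mat a (0\<^sub>m n m) (0\<^sub>m m n) b) x y \<in> G_delta d r s \<delta> (n + m)"
  then have z: "dsum n m x y \<in> G_delta d r s \<delta> (n + m)" by (simp add: dsum_def)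
  have tx: "tuple_of d n x" and ty: "tuple_of d m y" using x y n by (auto simp: G_delta_iff)
  have nm: "n + m \<ge> 1" using n by simp
  have "\<phi> (dsum n m x y) = four_block_mat (\<phi> x) (0\<^sub>m n m) (0\<^sub>m m n) (\<phi> y)"
    unfolding four_block_diag_iff[OF car[OF nm z] car[OF n(1) x] car[OF n(2) y]]
    using i[OF n(1) nm x z _ dsum_intertwines(1)[OF tx ty]] i[OF n(2) nm y z _ dsum_intertwines(2)[OF tx ty]]
    by simp
  then show "\<phi> (map2 (\<lambda>a b. four_block_mat a (0\<^sub>m n m) (0\<^sub>m m n) b) x y)
      = four_block_mat (\<phi> x) (0\<^sub>m n m) (0\<^sub>m m n) (\<phi> y)"
    by (simp add: dsum_def)
next
  fix n x S S'
  assume n: "n \<ge> (1::nat)" and x: "x \<in> G_delta d r s \<delta> n" and S: "S \<in> carrier_mat n n" "S' \<in> carrier_mat n n"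
    and SS': "S * S' = 1\<^sub>m n" and y: "map (\<lambda>a. S' * a * S) x \<in> G_delta d r s \<delta> n"
  have tx: "tuple_of d n x" using x n by (auto simp: G_delta_iff)
  have "intertwines d S' x (map (\<lambda>a. S' * a * S) x)"
    unfolding intertwines_def
  proof (intro allI impI)
    fix t assume t: "t < d"
    note xt = tuple_of_nth[OF tx t]
    have "S' * x ! t = S' * x ! t * (S * S')" using S xt by (simp add: SS')
    also have "\<dots> = S' * x ! t * S * S'" 
      by (rule assoc_mult_mat[OF mult_carrier_mat[OF S(2) xt] S(1) S(2), symmetric])
    finally show "S' * x ! t = map (\<lambda>a. S' * a * S) x ! t * S'" using tx t by (simp add: tuple_of_def)
  qed
  from i[OF n n x y S(2) this] have "S' * \<phi> x = \<phi> (map (\<lambda>a. S' * a * S) x) * S'" .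
  then have "S' * \<phi> x * S = \<phi> (map (\<lambda>a. S' * a * S) x) * S' * S" by simp
  also assume S'S: "S' * S = 1\<^sub>m n"
  have "\<phi> (map (\<lambda>a. S' * a * S) x) * S' * S = \<phi> (map (\<lambda>a. S' * a * S) x)"
    using car[OF n y] S S'S by (metis assoc_mult_mat right_mult_one_mat)
  finally show "\<phi> (map (\<lambda>a. S' * a * S) x) = S' * \<phi> x * S" by simp
qed

section \<open>Interpolation at a single point\<close>

text \<open>Any finite constant would do; it serves to bound a definite form from above by a
  multiple of the identity form.\<close>

lemma finite_matrix_bounded:
  assumes "finite I"
  shows "nsq E (\<lambda>e. \<Sum>q\<in>I. S e q * g q) \<le> (\<Sum>e\<in>E. (\<Sum>q\<in>I. cmod (S e q))\<^sup>2) * nsq I g"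
  unfolding nsq_def[of E] sum_distrib_right
proof (rule sum_mono)
  fix e
  have g: "cmod (g q) \<le> sqrt (nsq I g)" if "q \<in> I" for q
    using assms that unfolding nsq_def by (intro real_le_rsqrt member_le_sum) auto
  have "cmod (\<Sum>q\<in>I. S e q * g q) \<le> (\<Sum>q\<in>I. cmod (S e q) * cmod (g q))"
    using norm_sum[of "\<lambda>q. S e q * g q" I] by (simp add: norm_mult)
  also have "\<dots> \<le> (\<Sum>q\<in>I. cmod (S e q) * sqrt (nsq I g))"
    by (intro sum_mono mult_left_mono g) auto
  also have "\<dots> = (\<Sum>q\<in>I. cmod (S e q)) * sqrt (nsq I g)" by (simp add: sum_distrib_right)
  finally have "(cmod (\<Sum>q\<in>I. S e q * g q))\<^sup>2 \<le> ((\<Sum>q\<in>I. cmod (S e q)) * sqrt (nsq I g))\<^sup>2"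
    by (intro power_mono) auto
  then show "(cmod (\<Sum>q\<in>I. S e q * g q))\<^sup>2 \<le> (\<Sum>q\<in>I. cmod (S e q))\<^sup>2 * nsq I g"
    by (simp add: power_mult_distrib)
qed

lemma pair_sum: "(\<Sum>p\<in>{..<n} \<times> {..<n}. F p) = (\<Sum>j<n. \<Sum>i<n. F (i,j))"
  for F :: "nat \<times> nat \<Rightarrow> 'a::comm_monoid_add"
  unfolding sum.cartesian_product' by (rule sum.swap)

text \<open>Conjugating \<open>n\<close> copies of \<open>x\<close> by a factor \<open>S\<close> of the form \<open>H = S* S\<close> gives a point of
  the domain; the corona hypothesis there, tested on \<open>S\<close> applied to the vectorised identity,
  is the positivity of the pairing with \<open>H\<close>.\<close>

lemma pairing_nonneg:
  fixes n :: nat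
  defines "I \<equiv> {..<n} \<times> {..<n}"
  assumes fp: "fp_matrix d r s \<delta>" and \<psi>: "\<And>l. l < k \<Longrightarrow> H_inf d r s \<delta> (\<psi> l)"
    and hyp: "\<And>m z v. m \<ge> 1 \<Longrightarrow> z \<in> G_delta d r s \<delta> m \<Longrightarrow>
      \<epsilon>\<^sup>2 * nsq {..<m} v \<le> (\<Sum>l<k. nsq {..<m} (\<lambda>i. \<Sum>j<m. \<psi> l z $$ (i,j) * v j))"
    and n: "n \<ge> 1" and x: "x \<in> G_delta d r s \<delta> n"
    and \<kappa>: "0 < \<kappa>" and H: "herm_on I H" and lower: "\<And>g. \<kappa> * nsq I g \<le> Re (qform I H g)"
    and contr: "\<And>f. (\<Sum>b<r. Re (qform I H (lift (delta_entry \<delta> n x) s n f b))) + \<kappa> * (\<Sum>a<s. nsq I (f a))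
          \<le> (\<Sum>a<s. Re (qform I H (f a)))"
  shows "\<epsilon>\<^sup>2 * Re (qform I H (\<lambda>(i,j). if i = j then 1 else 0)) \<le> (\<Sum>l<k. Re (qform I H (\<lambda>p. \<psi> l x $$ p)))"
proof -
  have finI: "finite I" by (simp add: I_def)
  have tx: "tuple_of d n x" using x n by (simp add: G_delta_iff)
  have "psd_on I H" unfolding psd_on_def
  proof (intro conjI allI)
    fix g
    have "0 \<le> \<kappa> * nsq I g" using \<kappa> by simp
    then show "0 \<le> Re (qform I H g)" using lower[of g] by linarith
  qed (rule H)
  then obtain S where S: "\<forall>p\<in>I. \<forall>q\<in>I. H (p,q) = (\<Sum>e\<in>I. cnj (S e p) * S e q)"
    using psd_on_factor[OF finI] by blast
  have qS: "Re (qform I H g) = nsq I (\<lambda>e. \<Sum>q\<in>I. S e q * g q)" for g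
    using qform_factor[OF finI, where A=H and E=I and S=S and c=g] S by (simp add: nsq_def)
  \<comment> \<open>The lower bound by \<kappa> makes \<open>S\<close> injective, hence invertible;
    semidefiniteness of \<open>H\<close> alone would not give this.\<close>
  have "\<exists>R. (\<forall>i\<in>I. \<forall>j\<in>I. (\<Sum>e\<in>I. S i e * R e j) = (if i = j then 1 else 0)) \<and>
     (\<forall>i\<in>I. \<forall>j\<in>I. (\<Sum>e\<in>I. R i e * S e j) = (if i = j then 1 else 0))"
  proof (rule finite_injective_inverse[OF finI, of S])
    fix c p assume c: "\<And>i. i \<in> I \<Longrightarrow> (\<Sum>j\<in>I. S i j * c j) = 0" and p: "p \<in> I"
    have "Re (qform I H c) = 0" unfolding qS using c by (simp add: nsq_def)
    then have "\<kappa> * nsq I c \<le> 0" using lower[of c] by simp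
    then have "nsq I c \<le> 0" using \<kappa> by (simp add: mult_le_0_iff)
    then have "nsq I c = 0" using nsq_nonneg[of I c] by linarith
    then show "c p = 0" using p by (simp add: nsq_eq_0[OF finI])
  next
    fix R assume "\<And>i j. i \<in> I \<Longrightarrow> j \<in> I \<Longrightarrow> (\<Sum>e\<in>I. S i e * R e j) = (if i = j then 1 else 0)"
      "\<And>i j. i \<in> I \<Longrightarrow> j \<in> I \<Longrightarrow> (\<Sum>e\<in>I. R i e * S e j) = (if i = j then 1 else 0)"
    then show ?thesis by blast
  qed
  then obtain R where SR: "\<And>i j. i \<in> I \<Longrightarrow> j \<in> I \<Longrightarrow> (\<Sum>e\<in>I. S i e * R e j) = (if i = j then 1 else 0)"
    and RS: "\<And>i j. i \<in> I \<Longrightarrow> j \<in> I \<Longrightarrow> (\<Sum>e\<in>I. R i e * S e j) = (if i = j then 1 else 0)"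
    by blast
  \<comment> \<open>Matrices are indexed by natural numbers, so \<open>I\<close> is enumerated; the
    new point has size \<open>N\<close>, the number of pairs.\<close>
  define N where "N = card I"
  obtain h where h: "bij_betw h {..<N} I"
    using ex_bij_betw_nat_finite[OF finI] by (auto simp: N_def lessThan_atLeast0)
  have hI: "h \<alpha> \<in> I" if "\<alpha> < N" for \<alpha> using that bij_betwE[OF h] by auto
  have hinj: "h \<alpha> = h \<beta> \<longleftrightarrow> \<alpha> = \<beta>" if "\<alpha> < N" "\<beta> < N" for \<alpha> \<beta>
    using that bij_betw_imp_inj_on[OF h] by (auto simp: inj_on_def)
  have re: "(\<Sum>\<alpha><N. F (h \<alpha>)) = (\<Sum>p\<in>I. F p)" for F :: "nat \<times> nat \<Rightarrow> complex"
    by (rule sum.reindex_bij_betw[OF h])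
  have ren: "nsq {..<N} (\<lambda>\<alpha>. F (h \<alpha>)) = nsq I F" for F
    unfolding nsq_def by (rule sum.reindex_bij_betw[OF h])
  have N1: "N \<ge> 1" using n by (simp add: N_def I_def)
  define W where "W j = Matrix.mat N n (\<lambda>(\<alpha>,i). S (h \<alpha>) (i,j))" for j
  have W: "W j \<in> carrier_mat N n" for j by (simp add: W_def)
  have We: "W j $$ (\<alpha>,i) = S (h \<alpha>) (i,j)" if "\<alpha> < N" "i < n" for j \<alpha> i using that by (simp add: W_def)
  define X where "X t = Matrix.mat N N (\<lambda>(\<alpha>,\<beta>). \<Sum>p\<in>I. (\<Sum>i<n. S (h \<alpha>) (i,snd p) * x ! t $$ (i,fst p)) * R p (h \<beta>))" for t
  define z where "z = map X [0..<d]"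
  have tz: "tuple_of d N z" by (auto simp: tuple_of_def z_def X_def)
  have int: "intertwines d (W j) x z" if j: "j < n" for j
    unfolding intertwines_def
  proof (intro allI impI)
    fix t assume t: "t < d"
    note xt = tuple_of_nth[OF tx t]
    have zt: "z ! t = X t" using t by (simp add: z_def)
    have Xc: "X t \<in> carrier_mat N N" by (simp add: X_def)
    show "W j * x ! t = z ! t * W j"
      unfolding zt
    proof (rule eq_matI)
      fix \<alpha> i assume "\<alpha> < dim_row (X t * W j)" "i < dim_col (X t * W j)"
      then have \<alpha>: "\<alpha> < N" and i: "i < n" by (auto simp: X_def W_def)
      define y where "y p = (\<Sum>i<n. S (h \<alpha>) (i,snd p) * x ! t $$ (i,fst p))" for p
      have ijI: "(i,j) \<in> I" using i j by (simp add: I_def)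
      have "(X t * W j) $$ (\<alpha>,i) = (\<Sum>\<beta><N. \<Sum>p\<in>I. y p * (R p (h \<beta>) * S (h \<beta>) (i,j)))"
        unfolding mult_mat_entry[OF Xc W \<alpha> i]
        using \<alpha> i by (intro sum.cong[OF refl]) (simp add: X_def We y_def sum_distrib_right mult.assoc)
      also have "\<dots> = (\<Sum>p\<in>I. y p * (\<Sum>\<beta><N. R p (h \<beta>) * S (h \<beta>) (i,j)))"
        unfolding sum_distrib_left by (rule sum.swap)
      also have "\<dots> = (\<Sum>p\<in>I. if p = (i,j) then y p else 0)"
        using re[of "\<lambda>e. R p e * S e (i,j)" for p] by (intro sum.cong[OF refl]) (simp add: RS[OF _ ijI])
      also have "\<dots> = y (i,j)" using ijI finI by simp
      also have "\<dots> = (W j * x ! t) $$ (\<alpha>,i)"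
        unfolding mult_mat_entry[OF W xt \<alpha> i] y_def using \<alpha> by (simp add: We)
      finally show "(W j * x ! t) $$ (\<alpha>,i) = (X t * W j) $$ (\<alpha>,i)" ..
    qed (use xt in \<open>auto simp: W_def X_def\<close>)
  qed
  \<comment> \<open>Evaluated at the new point, \<delta> composed with \<open>S\<close> equals
    \<open>S\<close> composed with the lifted \<delta>(x); the relations for the individual
    \<open>W j\<close> are added up.\<close>
  have actz: "act (delta_entry \<delta> N z) s N (\<lambda>a \<alpha>. \<Sum>p\<in>I. S (h \<alpha>) p * f a p) b \<alpha>
      = (\<Sum>p\<in>I. S (h \<alpha>) p * lift (delta_entry \<delta> n x) s n f b p)" if b: "b < r" and \<alpha>: "\<alpha> < N" for f b \<alpha>
  proof -
    have "act (delta_entry \<delta> N z) s N (\<lambda>a \<alpha>. \<Sum>p\<in>I. S (h \<alpha>) p * f a p) b \<alpha> =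
      (\<Sum>a<s. \<Sum>\<beta><N. \<Sum>j<n. \<Sum>i<n. delta_entry \<delta> N z b a \<alpha> \<beta> * W j $$ (\<beta>,i) * f a (i,j))"
      unfolding act_def I_def pair_sum sum_distrib_left
      by (intro sum.cong[OF refl]) (simp add: We mult.assoc)
    also have "\<dots> = (\<Sum>a<s. \<Sum>j<n. \<Sum>i<n. \<Sum>\<beta><N. delta_entry \<delta> N z b a \<alpha> \<beta> * W j $$ (\<beta>,i) * f a (i,j))"
    proof (rule sum.cong[OF refl])
      fix a
      show "(\<Sum>\<beta><N. \<Sum>j<n. \<Sum>i<n. delta_entry \<delta> N z b a \<alpha> \<beta> * W j $$ (\<beta>,i) * f a (i,j)) =
        (\<Sum>j<n. \<Sum>i<n. \<Sum>\<beta><N. delta_entry \<delta> N z b a \<alpha> \<beta> * W j $$ (\<beta>,i) * f a (i,j))"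
        by (subst sum.swap, intro sum.cong[OF refl] sum.swap)
    qed
    also have "\<dots> = (\<Sum>a<s. \<Sum>j<n. \<Sum>i<n. (\<Sum>i'<n. W j $$ (\<alpha>,i') * delta_entry \<delta> n x b a i' i) * f a (i,j))"
      unfolding sum_distrib_right[symmetric]
      using delta_entry_intertwine[OF tx tz W int fp b _ \<alpha>] by (intro sum.cong[OF refl]) simp
    also have "\<dots> = (\<Sum>a<s. \<Sum>j<n. \<Sum>i<n. \<Sum>i'<n. S (h \<alpha>) (i',j) * (delta_entry \<delta> n x b a i' i * f a (i,j)))"
      using \<alpha> by (intro sum.cong[OF refl]) (simp add: We sum_distrib_right mult.assoc)
    also have "\<dots> = (\<Sum>a<s. \<Sum>j<n. \<Sum>i'<n. \<Sum>i<n. S (h \<alpha>) (i',j) * (delta_entry \<delta> n x b a i' i * f a (i,j)))"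
      by (intro sum.cong[OF refl] sum.swap)
    also have "\<dots> = (\<Sum>j<n. \<Sum>a<s. \<Sum>i'<n. \<Sum>i<n. S (h \<alpha>) (i',j) * (delta_entry \<delta> n x b a i' i * f a (i,j)))"
      by (rule sum.swap)
    also have "\<dots> = (\<Sum>j<n. \<Sum>i'<n. \<Sum>a<s. \<Sum>i<n. S (h \<alpha>) (i',j) * (delta_entry \<delta> n x b a i' i * f a (i,j)))"
      by (intro sum.cong[OF refl] sum.swap)
    also have "\<dots> = (\<Sum>p\<in>I. S (h \<alpha>) p * lift (delta_entry \<delta> n x) s n f b p)"
      unfolding I_def pair_sum by (simp add: lift_def act_def sum_distrib_left)
    finally show ?thesis .
  qed
  have "strict_contr r s N (delta_entry \<delta> N z)"
  proof -
    \<comment> \<open>An upper bound for \<open>H\<close>; the summand \<kappa> guarantees that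
      \<open>M\<close> is at least \<kappa>. The absolute gap in \<open>contr\<close> is then at
      least \<kappa>/M of the form itself, which gives the contraction constant 1 -
      \<kappa>/M.\<close>
    define M where "M = (\<Sum>e\<in>I. (\<Sum>q\<in>I. cmod (S e q))\<^sup>2) + \<kappa>"
    have M0: "\<kappa> \<le> M" unfolding M_def by (simp add: sum_nonneg)
    have M: "Re (qform I H g) \<le> M * nsq I g" for g
    proof -
      have "Re (qform I H g) \<le> (\<Sum>e\<in>I. (\<Sum>q\<in>I. cmod (S e q))\<^sup>2) * nsq I g"
        unfolding qS by (rule finite_matrix_bounded[OF finI])
      moreover have "0 \<le> \<kappa> * nsq I g" using \<kappa> by simp
      ultimately show ?thesis unfolding M_def distrib_right by linarith
    qed
    have "(\<Sum>b<r. nsq {..<N} (act (delta_entry \<delta> N z) s N g b)) \<le> (1 - \<kappa> / M) * (\<Sum>a<s. nsq {..<N} (g a))" for g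
    proof -
      \<comment> \<open>Every \<open>g\<close> is \<open>S\<close> applied to this \<open>f\<close>,
        so that squared norms of \<open>g\<close> become values of \<open>H\<close> at
        \<open>f\<close>.\<close>
      define f where "f a p = (\<Sum>\<beta><N. R p (h \<beta>) * g a \<beta>)" for a p
      have gf: "g a \<alpha> = (\<Sum>p\<in>I. S (h \<alpha>) p * f a p)" if "\<alpha> < N" for a \<alpha>
      proof -
        have "(\<Sum>p\<in>I. S (h \<alpha>) p * f a p) = (\<Sum>\<beta><N. (\<Sum>p\<in>I. S (h \<alpha>) p * R p (h \<beta>)) * g a \<beta>)"
          unfolding f_def sum_distrib_left sum_distrib_right by (subst sum.swap) (simp add: mult.assoc)
        also have "\<dots> = (\<Sum>\<beta><N. if \<alpha> = \<beta> then g a \<beta> else 0)"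
          using that by (intro sum.cong[OF refl]) (simp add: SR hI hinj)
        finally show ?thesis using that by simp
      qed
      have "act (delta_entry \<delta> N z) s N g b \<alpha> = (\<Sum>p\<in>I. S (h \<alpha>) p * lift (delta_entry \<delta> n x) s n f b p)"
        if "b < r" "\<alpha> < N" for b \<alpha>
      proof -
        have "act (delta_entry \<delta> N z) s N g b \<alpha> = act (delta_entry \<delta> N z) s N (\<lambda>a \<alpha>. \<Sum>p\<in>I. S (h \<alpha>) p * f a p) b \<alpha>"
          unfolding act_def by (intro sum.cong[OF refl]) (simp add: gf[symmetric])
        then show ?thesis by (simp only: actz[OF that])
      qed
      then have "(\<Sum>b<r. nsq {..<N} (act (delta_entry \<delta> N z) s N g b)) =
          (\<Sum>b<r. nsq {..<N} (\<lambda>\<alpha>. \<Sum>p\<in>I. S (h \<alpha>) p * lift (delta_entry \<delta> n x) s n f b p))"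
        by (intro sum.cong[OF refl] nsq_cong) simp
      also have "\<dots> = (\<Sum>b<r. Re (qform I H (lift (delta_entry \<delta> n x) s n f b)))"
        unfolding qS by (intro sum.cong[OF refl] ren)
      finally have 1: "(\<Sum>b<r. nsq {..<N} (act (delta_entry \<delta> N z) s N g b)) = (\<Sum>b<r. Re (qform I H (lift (delta_entry \<delta> n x) s n f b)))" .
      have "nsq {..<N} (g a) = Re (qform I H (f a))" for a
      proof -
        have "nsq {..<N} (g a) = nsq {..<N} (\<lambda>\<alpha>. \<Sum>p\<in>I. S (h \<alpha>) p * f a p)"
          by (intro nsq_cong) (simp add: gf[symmetric])
        then show ?thesis unfolding qS by (simp only: ren[of "\<lambda>e. \<Sum>p\<in>I. S e p * f a p"])
      qed
      then have 2: "(\<Sum>a<s. nsq {..<N} (g a)) = (\<Sum>a<s. Re (qform I H (f a)))" by simp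
      have "(\<Sum>a<s. Re (qform I H (f a))) \<le> M * (\<Sum>a<s. nsq I (f a))"
        unfolding sum_distrib_left by (intro sum_mono M)
      then have "\<kappa> / M * (\<Sum>a<s. Re (qform I H (f a))) \<le> \<kappa> / M * (M * (\<Sum>a<s. nsq I (f a)))"
        using \<kappa> M0 by (intro mult_left_mono) auto
      also have "\<dots> = \<kappa> * (\<Sum>a<s. nsq I (f a))" using \<kappa> M0 by simp
      finally show ?thesis using contr[of f] unfolding 1 2 by (simp add: left_diff_distrib)
    qed
    then show ?thesis unfolding strict_contr_def using \<kappa> M0
      by (intro exI[of _ "1 - \<kappa> / M"]) (auto simp: field_simps)
  qed
  then have z: "z \<in> G_delta d r s \<delta> N" using tz N1 by (simp add: G_delta_iff)
  define v where "v \<alpha> = (\<Sum>p\<in>I. S (h \<alpha>) p * (case p of (i,j) \<Rightarrow> if i = j then 1 else 0))" for \<alpha>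
  have vW: "v \<alpha> = (\<Sum>j<n. W j $$ (\<alpha>,j))" if "\<alpha> < N" for \<alpha>
    unfolding v_def I_def pair_sum using that
    by (intro sum.cong[OF refl]) (simp add: We if_distrib cong: if_cong)
  \<comment> \<open>By intertwining, \<psi> at the new point composed with \<open>S\<close> is
    \<open>S\<close> composed with n copies of \<psi>(x), and these copies send the vectorised
    identity to the vectorised \<psi>(x).\<close>
  have \<psi>v: "(\<Sum>\<beta><N. \<psi> l z $$ (\<alpha>,\<beta>) * v \<beta>) = (\<Sum>p\<in>I. S (h \<alpha>) p * \<psi> l x $$ p)" if l: "l < k" and \<alpha>: "\<alpha> < N" for l \<alpha>
  proof -
    have zc: "\<psi> l z \<in> carrier_mat N N" and xc: "\<psi> l x \<in> carrier_mat n n"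
      using \<psi>[OF l] z x n N1 unfolding H_inf_def by blast+
    have "(\<Sum>\<beta><N. \<psi> l z $$ (\<alpha>,\<beta>) * v \<beta>) = (\<Sum>\<beta><N. \<Sum>j<n. \<psi> l z $$ (\<alpha>,\<beta>) * W j $$ (\<beta>,j))"
      by (intro sum.cong[OF refl]) (simp add: vW sum_distrib_left)
    also have "\<dots> = (\<Sum>j<n. \<Sum>\<beta><N. \<psi> l z $$ (\<alpha>,\<beta>) * W j $$ (\<beta>,j))" by (rule sum.swap)
    also have "\<dots> = (\<Sum>j<n. (\<psi> l z * W j) $$ (\<alpha>,j))"
      using \<alpha> by (intro sum.cong[OF refl]) (simp only: mult_mat_entry[OF zc W] lessThan_iff)
    also have "\<dots> = (\<Sum>j<n. (W j * \<psi> l x) $$ (\<alpha>,j))"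
      using H_inf_intertwine[OF fp \<psi>[OF l] n N1 x z W int] by (intro sum.cong[OF refl]) simp
    also have "\<dots> = (\<Sum>j<n. \<Sum>i<n. S (h \<alpha>) (i,j) * \<psi> l x $$ (i,j))"
      using \<alpha> by (intro sum.cong[OF refl]) (simp only: mult_mat_entry[OF W xc] lessThan_iff, simp add: We)
    finally show ?thesis unfolding I_def pair_sum .
  qed
  have "nsq {..<N} (\<lambda>i. \<Sum>j<N. \<psi> l z $$ (i,j) * v j) = Re (qform I H (\<lambda>p. \<psi> l x $$ p))" if "l < k" for l
  proof -
    have "nsq {..<N} (\<lambda>i. \<Sum>j<N. \<psi> l z $$ (i,j) * v j) = nsq {..<N} (\<lambda>\<alpha>. \<Sum>p\<in>I. S (h \<alpha>) p * \<psi> l x $$ p)"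
      using that by (intro nsq_cong) (simp add: \<psi>v)
    then show ?thesis unfolding qS by (simp only: ren[of "\<lambda>e. \<Sum>p\<in>I. S e p * \<psi> l x $$ p"])
  qed
  moreover have "nsq {..<N} v = Re (qform I H (\<lambda>(i,j). if i = j then 1 else 0))"
    unfolding qS v_def[abs_def] by (rule ren)
  ultimately show ?thesis using hyp[OF N1 z, of v] by simp
qed

lemma qform_scale: "qform I H (\<lambda>p. of_real c * g p) = of_real (c\<^sup>2) * qform I H g"
  unfolding qform_def sum_distrib_left by (intro sum.cong refl) (simp add: power2_eq_square)

text \<open>The colligation and its state space vary with the point for which they are built. Only
  contractivity as a row and the intertwining property are kept, so that later statements can
  quantify over the function alone.\<close>

definition nc_transfer :: "nat \<Rightarrow> nat \<Rightarrow> nat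
    \<Rightarrow> ((nat \<Rightarrow> nat \<Rightarrow> nat \<Rightarrow> nat \<Rightarrow> complex) \<Rightarrow> nat \<Rightarrow> nat \<Rightarrow> nat \<Rightarrow> nat \<Rightarrow> complex) \<Rightarrow> bool" where
  "nc_transfer r s k T \<longleftrightarrow>
     (\<forall>D m u. strict_contr r s m D \<longrightarrow>
       nsq {..<m} (\<lambda>i. \<Sum>l<k. \<Sum>j<m. T D m l i j * u l j) \<le> (\<Sum>l<k. nsq {..<m} (u l))) \<and>
     (\<forall>D D' m m' W l i j. strict_contr r s m D \<longrightarrow> strict_contr r s m' D' \<longrightarrow>
       (\<forall>b<r. \<forall>a<s. \<forall>i<m'. \<forall>j<m.
         (\<Sum>i'<m. W i i' * D b a i' j) = (\<Sum>i'<m'. D' b a i i' * W i' j)) \<longrightarrow>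
       l < k \<longrightarrow> i < m' \<longrightarrow> j < m \<longrightarrow>
       (\<Sum>i'<m. W i i' * T D m l i' j) = (\<Sum>i'<m'. T D' m' l i i' * W i' j))"

text \<open>The positivity premise of \<open>model_exists\<close> is supplied by
  \<open>pairing_nonneg\<close>. The resulting inequality compares two families of vectors indexed
  by matrix entries, so \<open>contraction_extension\<close> provides \<open>U\<close>, and its
  transfer function sends the column \<psi>(x) to \<epsilon> I.\<close>

theorem single_point_solution:
  fixes n :: nat
  assumes fp: "fp_matrix d r s \<delta>" and \<psi>: "\<And>l. l < k \<Longrightarrow> H_inf d r s \<delta> (\<psi> l)"
    and hyp: "\<And>m z v. m \<ge> 1 \<Longrightarrow> z \<in> G_delta d r s \<delta> m \<Longrightarrow>
      \<epsilon>\<^sup>2 * nsq {..<m} v \<le> (\<Sum>l<k. nsq {..<m} (\<lambda>i. \<Sum>j<m. \<psi> l z $$ (i,j) * v j))"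
    and n: "n \<ge> 1" and x: "x \<in> G_delta d r s \<delta> n"
  shows "\<exists>T. nc_transfer r s k T \<and> (\<forall>i<n. \<forall>j<n.
      (\<Sum>l<k. \<Sum>i'<n. T (delta_entry \<delta> n x) n l i i' * \<psi> l x $$ (i',j)) = (if i = j then of_real \<epsilon> else 0))"
proof -
  define I where "I = {..<n} \<times> {..<n}"
  have finI: "finite I" by (simp add: I_def)
  define D where "D = delta_entry \<delta> n x"
  define h where "h p = complex_of_real \<epsilon> * (\<lambda>(i,j). if i = j then 1 else 0) p" for p :: "nat \<times> nat"
  have D: "strict_contr r s n D" using x n by (simp add: G_delta_iff D_def)
  have pos: "Re (qform I H h) \<le> (\<Sum>l<k. Re (qform I H (\<lambda>p. \<psi> l x $$ p)))"
    if "0 < \<kappa>" "herm_on I H" "\<And>g. \<kappa> * nsq I g \<le> Re (qform I H g)"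
      "\<And>f. (\<Sum>b<r. Re (qform I H (lift D s n f b))) + \<kappa> * (\<Sum>a<s. nsq I (f a))
          \<le> (\<Sum>a<s. Re (qform I H (f a)))" for H \<kappa>
    using pairing_nonneg[OF fp \<psi> hyp n x that(1), folded I_def D_def, OF _ _ _ that(2-4)]
    unfolding h_def[abs_def] qform_scale by simp
  have "\<exists>(E :: (nat \<times> nat \<times> nat) set) f. finite E \<and> (\<forall>c. (cmod (\<Sum>p\<in>I. h p * c p))\<^sup>2 + (\<Sum>e\<in>E. \<Sum>a<s. (cmod (\<Sum>p\<in>I. f e a p * c p))\<^sup>2)
      \<le> (\<Sum>l<k. (cmod (\<Sum>p\<in>I. \<psi> l x $$ p * c p))\<^sup>2)
        + (\<Sum>e\<in>E. \<Sum>b<r. (cmod (\<Sum>p\<in>I. lift D s n (f e) b p * c p))\<^sup>2))"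
  proof (rule model_exists[OF D, where h=h and k=k and \<psi>="\<lambda>l p. \<psi> l x $$ p", folded I_def])
    fix H \<kappa> assume "0 < \<kappa>" "herm_on I H" "\<And>g. \<kappa> * nsq I g \<le> Re (qform I H g)"
      "\<And>f. (\<Sum>b<r. Re (qform I H (lift D s n f b))) + \<kappa> * (\<Sum>a<s. nsq I (f a))
          \<le> (\<Sum>a<s. Re (qform I H (f a)))"
    then show "Re (qform I H h) \<le> (\<Sum>l<k. Re (qform I H (\<lambda>p. \<psi> l x $$ p)))" by (rule pos)
  next
    fix E :: "(nat \<times> nat \<times> nat) set" and f
    assume "finite E" "\<And>c. (cmod (\<Sum>p\<in>I. h p * c p))\<^sup>2 + (\<Sum>e\<in>E. \<Sum>a<s. (cmod (\<Sum>p\<in>I. f e a p * c p))\<^sup>2)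
      \<le> (\<Sum>l<k. (cmod (\<Sum>p\<in>I. \<psi> l x $$ p * c p))\<^sup>2)
        + (\<Sum>e\<in>E. \<Sum>b<r. (cmod (\<Sum>p\<in>I. lift D s n (f e) b p * c p))\<^sup>2)"
    then show ?thesis by blast
  qed
  then obtain E :: "(nat \<times> nat \<times> nat) set" and f where E: "finite E" and
    le: "\<And>c. (cmod (\<Sum>p\<in>I. h p * c p))\<^sup>2 + (\<Sum>e\<in>E. \<Sum>a<s. (cmod (\<Sum>p\<in>I. f e a p * c p))\<^sup>2)
      \<le> (\<Sum>l<k. (cmod (\<Sum>p\<in>I. \<psi> l x $$ p * c p))\<^sup>2)
        + (\<Sum>e\<in>E. \<Sum>b<r. (cmod (\<Sum>p\<in>I. lift D s n (f e) b p * c p))\<^sup>2)"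
    by blast
  define A where "A = {..<k} <+> E \<times> {..<r}"
  define B where "B = {()} <+> E \<times> {..<s}"
  define g where "g p = case_sum (\<lambda>l. \<psi> l x $$ p) (\<lambda>(e,b). lift D s n (f e) b p)" for p
  define hh where "hh p = case_sum (\<lambda>_::unit. h p) (\<lambda>(e,a). f e a p)" for p
  have fin: "finite A" "finite B" by (auto simp: A_def B_def E)
  have le': "nsq B (\<lambda>\<beta>. \<Sum>p\<in>I. hh p \<beta> * c p) \<le> nsq A (\<lambda>\<alpha>. \<Sum>p\<in>I. g p \<alpha> * c p)" for c
    using le[of c] by (simp add: A_def B_def nsq_Plus E nsq_Times hh_def g_def) (simp add: nsq_def)
  obtain U where U: "\<And>p \<beta>. p \<in> I \<Longrightarrow> \<beta> \<in> B \<Longrightarrow> (\<Sum>\<alpha>\<in>A. U \<beta> \<alpha> * g p \<alpha>) = hh p \<beta>"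
    and Uc: "\<And>y. nsq B (\<lambda>\<beta>. \<Sum>\<alpha>\<in>A. U \<beta> \<alpha> * y \<alpha>) \<le> nsq A y"
    by (rule contraction_extension[OF finI fin le']) (rule that; assumption)
  interpret T: transfer_function k r s E U A
    by unfold_locales (use E Uc in \<open>simp_all add: A_def B_def\<close>)
  have interp: "(\<Sum>l<k. \<Sum>i'<n. T.tf D n l i i' * \<psi> l x $$ (i',j)) = (if i = j then of_real \<epsilon> else 0)"
    if i: "i < n" and j: "j < n" for i j
  proof -
    define F where "F \<gamma> i = f (fst \<gamma>) (snd \<gamma>) (i,j)" for \<gamma> i
    have inp: "T.inp D n (\<lambda>l i. \<psi> l x $$ (i,j)) F i = g (i,j)" for i
      by (auto simp: T.inp_def g_def lift_def F_def[abs_def] fun_eq_iff split: sum.split)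
    have "T.sol D n (\<lambda>l i. \<psi> l x $$ (i,j)) (\<lambda>i. h (i,j)) F"
      unfolding T.sol_def T.out_def inp
    proof (intro conjI allI impI ballI)
      fix i assume "i < n"
      then have p: "(i,j) \<in> I" using j by (simp add: I_def)
      have B: "Inl () \<in> B" "\<gamma> \<in> E \<times> {..<s} \<Longrightarrow> Inr \<gamma> \<in> B" for \<gamma> by (auto simp: B_def)
      show "h (i,j) = (\<Sum>\<alpha>\<in>A. U (Inl ()) \<alpha> * g (i,j) \<alpha>)"
        using U[OF p B(1)] by (simp add: hh_def)
      fix \<gamma> assume "\<gamma> \<in> E \<times> {..<s}"
      then show "F \<gamma> i = (\<Sum>\<alpha>\<in>A. U (Inr \<gamma>) \<alpha> * g (i,j) \<alpha>)"
        using U[OF p B(2)] by (simp add: hh_def F_def split_def)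
    qed
    from T.tf_apply[OF D this i] show ?thesis by (simp add: h_def)
  qed
  have "nc_transfer r s k T.tf"
    unfolding nc_transfer_def
  proof (intro conjI allI impI)
    fix D D' m m' W l i j
    assume "strict_contr r s m D" "strict_contr r s m' D'" "\<forall>b<r. \<forall>a<s. \<forall>i<m'. \<forall>j<m.
         (\<Sum>i'<m. W i i' * D b a i' j) = (\<Sum>i'<m'. D' b a i i' * W i' j)" "l < k" "i < m'" "j < m"
    then show "(\<Sum>i'<m. W i i' * T.tf D m l i' j) = (\<Sum>i'<m'. T.tf D' m' l i i' * W i' j)"
      by (intro T.tf_intertwine) auto
  qed (rule T.tf_contr)
  then show ?thesis using interp unfolding D_def by blast
qed

section \<open>Compactness and the corona theorem\<close>

lemma nsq_scale: "nsq A (\<lambda>i. of_real c * f i) = c\<^sup>2 * nsq A f"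
  by (simp add: nsq_def norm_mult power_mult_distrib sum_distrib_left)

lemma mat_adjoint_entry:
  assumes "A \<in> carrier_mat p q" "i < q" "j < p"
  shows "mat_adjoint A $$ (i,j) = cnj (A $$ (j,i))"
  using assms by (simp add: mat_adjoint_def mat_of_rows_def)

text \<open>The form of A* A at \<open>v\<close> is the squared norm of A v, so the Loewner
  inequality at \<open>v\<close> is a statement about the column of all \<open>A l\<close>.\<close>

lemma loewner_le_column:
  assumes le: "loewner_le n ((complex_of_real \<epsilon>)\<^sup>2 \<cdot>\<^sub>m 1\<^sub>m n) (msum n (\<lambda>l. mat_adjoint (A l) * A l) {..<k})"
    and A: "\<And>l. l < k \<Longrightarrow> A l \<in> carrier_mat n n"
  shows "\<epsilon>\<^sup>2 * nsq {..<n} v \<le> (\<Sum>l<k. nsq {..<n} (\<lambda>i. \<Sum>j<n. A l $$ (i,j) * v j))"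
proof -
  define B where "B = msum n (\<lambda>l. mat_adjoint (A l) * A l) {..<k}"
  define C where "C = (complex_of_real \<epsilon>)\<^sup>2 \<cdot>\<^sub>m (1\<^sub>m n :: complex mat)"
  define w where "w = Matrix.vec n v"
  have B: "B \<in> carrier_mat n n" by (simp add: B_def msum_def)
  have C: "C \<in> carrier_mat n n" by (simp add: C_def)
  have w: "w \<in> carrier_vec n" by (simp add: w_def)
  have wi: "vec_index w i = v i" if "i < n" for i using that by (simp add: w_def)
  have "0 \<le> Re (conjugate w \<bullet> ((B - C) *\<^sub>v w))"
    using le w unfolding loewner_le_def B_def C_def by blast
  also have "conjugate w \<bullet> ((B - C) *\<^sub>v w) = (\<Sum>i<n. cnj (v i) * (\<Sum>j<n. (B - C) $$ (i,j) * v j))"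
  proof -
    have BC: "B - C \<in> carrier_mat n n" using B C by auto
    have "conjugate w \<bullet> ((B - C) *\<^sub>v w) = (\<Sum>i<n. vec_index (conjugate w) i * vec_index ((B - C) *\<^sub>v w) i)"
      by (subst scalar_prod_def) (use B C in \<open>simp add: lessThan_atLeast0 del: index_mult_mat_vec\<close>)
    also have "\<dots> = (\<Sum>i<n. cnj (v i) * (\<Sum>j<n. (B - C) $$ (i,j) * vec_index w j))"
    proof (rule sum.cong[OF refl])
      fix i assume "i \<in> {..<n}"
      then have i: "i < n" by simp
      have "vec_index (conjugate w) i = cnj (v i)" using i w by (simp add: w_def)
      then show "vec_index (conjugate w) i * vec_index ((B - C) *\<^sub>v w) i
          = cnj (v i) * (\<Sum>j<n. (B - C) $$ (i,j) * vec_index w j)"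
        using mult_mat_vec_entry[OF BC w i] by simp
    qed
    finally show ?thesis by (simp add: wi)
  qed
  also have "\<dots> = qform {..<n} (\<lambda>p. (\<Sum>l<k. \<Sum>e<n. cnj (A l $$ (e,fst p)) * A l $$ (e,snd p))
      - of_real (\<epsilon>\<^sup>2) * (case p of (i,j) \<Rightarrow> if i = j then 1 else 0)) v"
    unfolding qform_def sum_distrib_left
  proof (intro sum.cong[OF refl])
    fix i j assume "i \<in> {..<n}" "j \<in> {..<n}"
    then have ij: "i < n" "j < n" by auto
    have "B $$ (i,j) = (\<Sum>l<k. \<Sum>e<n. cnj (A l $$ (e,i)) * A l $$ (e,j))"
    proof -
      have "B $$ (i,j) = (\<Sum>l<k. (mat_adjoint (A l) * A l) $$ (i,j))" using ij by (simp add: B_def msum_def)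
      also have "\<dots> = (\<Sum>l<k. \<Sum>e<n. cnj (A l $$ (e,i)) * A l $$ (e,j))"
      proof (rule sum.cong[OF refl])
        fix l assume "l \<in> {..<k}"
        then have Al: "A l \<in> carrier_mat n n" using A by simp
        have ad: "mat_adjoint (A l) \<in> carrier_mat n n" using Al by (simp add: mat_adjoint_def mat_of_rows_def)
        show "(mat_adjoint (A l) * A l) $$ (i,j) = (\<Sum>e<n. cnj (A l $$ (e,i)) * A l $$ (e,j))"
          unfolding mult_mat_entry[OF ad Al ij] using ij by (intro sum.cong[OF refl]) (simp add: mat_adjoint_entry[OF Al])
      qed
      finally show ?thesis .
    qed
    moreover have "C $$ (i,j) = of_real (\<epsilon>\<^sup>2) * (if i = j then 1 else 0)" using ij by (simp add: C_def)
    moreover have "(B - C) $$ (i,j) = B $$ (i,j) - C $$ (i,j)" using ij B C by simp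
    ultimately show "cnj (v i) * ((B - C) $$ (i,j) * v j) = cnj (v i) *
        ((\<Sum>l<k. \<Sum>e<n. cnj (A l $$ (e,fst (i,j))) * A l $$ (e,snd (i,j)))
          - of_real (\<epsilon>\<^sup>2) * (case (i,j) of (i,j) \<Rightarrow> if i = j then 1 else 0)) * v j"
      by simp
  qed
  also have "\<dots> = (\<Sum>l<k. of_real (nsq {..<n} (\<lambda>i. \<Sum>j<n. A l $$ (i,j) * v j))) - of_real (\<epsilon>\<^sup>2) * of_real (nsq {..<n} v)"
  proof -
    have 1: "qform {..<n} (\<lambda>p. \<Sum>e<n. cnj (A l $$ (e,fst p)) * A l $$ (e,snd p)) v
        = of_real (nsq {..<n} (\<lambda>i. \<Sum>j<n. A l $$ (i,j) * v j))" for l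
      unfolding nsq_def by (rule qform_factor[where S="\<lambda>e j. A l $$ (e,j)"]) auto
    have 2: "qform {..<n} (\<lambda>p. of_real (\<epsilon>\<^sup>2) * (case p of (i,j) \<Rightarrow> if i = j then 1 else 0)) v
        = of_real (\<epsilon>\<^sup>2) * of_real (nsq {..<n} v)"
      using qform_lin[of "{..<n}" "\<lambda>_. 0" "of_real (\<epsilon>\<^sup>2)" "\<lambda>(i,j). if i = j then 1 else 0" v]
        qform_unit[of "{..<n}" v] by (simp add: qform_def)
    show ?thesis unfolding qform_diff qform_sum[where E="{..<k}"] 1 2 ..
  qed
  finally show ?thesis by simp
qed

text \<open>A candidate solution is a single function of (l,x,i,j), which puts all candidates into
  one product space. Each instance of a condition mentions finitely many coordinates and is an
  equation or a weak inequality, hence closed.\<close>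

definition nc_contractive :: "nat \<Rightarrow> nat \<Rightarrow> nat \<Rightarrow> (nat \<Rightarrow> nat \<Rightarrow> nat list \<Rightarrow> complex) \<Rightarrow> nat \<Rightarrow> real
    \<Rightarrow> (nat \<times> complex mat list \<times> nat \<times> nat \<Rightarrow> complex) set" where
  "nc_contractive d r s \<delta> k c = {\<Phi>.
     (\<forall>n\<ge>1. \<forall>x\<in>G_delta d r s \<delta> n. \<forall>u.
        nsq {..<n} (\<lambda>i. \<Sum>l<k. \<Sum>j<n. \<Phi> (l,x,i,j) * u l j) \<le> c\<^sup>2 * (\<Sum>l<k. nsq {..<n} (u l))) \<and>
     (\<forall>n\<ge>1. \<forall>m\<ge>1. \<forall>x\<in>G_delta d r s \<delta> n. \<forall>y\<in>G_delta d r s \<delta> m. \<forall>W\<in>carrier_mat m n.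
        intertwines d W x y \<longrightarrow> (\<forall>l<k. \<forall>i<m. \<forall>j<n.
        (\<Sum>i'<n. W $$ (i,i') * \<Phi> (l,x,i',j)) = (\<Sum>i'<m. \<Phi> (l,y,i,i') * W $$ (i',j))))}"

lemma closed_nc_contractive: "closed (nc_contractive d r s \<delta> k c)"
  unfolding nc_contractive_def nsq_def Ball_def
  by (intro closed_Collect_conj closed_Collect_all closed_Collect_imp open_Collect_const
      closed_Collect_le closed_Collect_eq continuous_intros continuous_on_product_coordinates)

definition left_inverse_at :: "nat \<Rightarrow> (nat \<Rightarrow> complex mat list \<Rightarrow> complex mat) \<Rightarrow> nat \<Rightarrow> complex mat list
    \<Rightarrow> (nat \<times> complex mat list \<times> nat \<times> nat \<Rightarrow> complex) set" where
  "left_inverse_at k \<psi> n x = {\<Phi>. \<forall>i<n. \<forall>j<n.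
     (\<Sum>l<k. \<Sum>i'<n. \<Phi> (l,x,i,i') * \<psi> l x $$ (i',j)) = (if i = j then 1 else 0)}"

lemma closed_left_inverse_at: "closed (left_inverse_at k \<psi> n x)"
  unfolding left_inverse_at_def
  by (intro closed_Collect_all closed_Collect_imp open_Collect_const
      closed_Collect_eq continuous_intros continuous_on_product_coordinates)

text \<open>Intertwining with the block inclusions identifies the values at \<open>x\<close> and
  \<open>y\<close> with the diagonal blocks of the value at the direct sum. As \<psi> is block
  diagonal there, the left inverse identity restricts to both blocks. This makes the one-point
  constraints directed.\<close>

lemma left_inverse_at_dsum:
  assumes fp: "fp_matrix d r s \<delta>" and \<psi>: "\<And>l. l < k \<Longrightarrow> H_inf d r s \<delta> (\<psi> l)"
    and n: "n \<ge> 1" "m \<ge> 1" and x: "x \<in> G_delta d r s \<delta> n" and y: "y \<in> G_delta d r s \<delta> m"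
    and \<Phi>: "\<Phi> \<in> nc_contractive d r s \<delta> k c" "\<Phi> \<in> left_inverse_at k \<psi> (n + m) (dsum n m x y)"
  shows "\<Phi> \<in> left_inverse_at k \<psi> n x" "\<Phi> \<in> left_inverse_at k \<psi> m y"
proof -
  define z where "z = dsum n m x y"
  have z: "z \<in> G_delta d r s \<delta> (n + m)" unfolding z_def by (rule dsum_in_G[OF fp n x y])
  have tx: "tuple_of d n x" and ty: "tuple_of d m y" using x y n by (auto simp: G_delta_iff)
  have nm: "n + m \<ge> 1" using n by simp
  have int: "(\<Sum>i'<p. W $$ (i,i') * \<Phi> (l,w,i',j)) = (\<Sum>i'<n + m. \<Phi> (l,z,i,i') * W $$ (i',j))"
    if "p \<ge> 1" "w \<in> G_delta d r s \<delta> p" "W \<in> carrier_mat (n + m) p" "intertwines d W w z" "l < k" "i < n + m" "j < p"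
    for p w W l i j
    using \<Phi>(1) that nm z unfolding nc_contractive_def by blast
  have \<psi>z: "\<psi> l z = four_block_mat (\<psi> l x) (0\<^sub>m n m) (0\<^sub>m m n) (\<psi> l y)"
    and \<psi>x: "\<psi> l x \<in> carrier_mat n n" and \<psi>y: "\<psi> l y \<in> carrier_mat m m" if "l < k" for l
    using \<psi>[OF that] x y n z unfolding z_def dsum_def H_inf_def by blast+
  have Z: "(\<Sum>l<k. \<Sum>i'<n + m. \<Phi> (l,z,i,i') * \<psi> l z $$ (i',j)) = (if i = j then 1 else 0)"
    if "i < n + m" "j < n + m" for i j
    using \<Phi>(2) that unfolding left_inverse_at_def z_def by blast
  have \<Phi>x: "\<Phi> (l,x,i,j) = \<Phi> (l,z,i,j)" if "l < k" "i < n" "j < n" for l i j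
    using int[OF n(1) x inl_mat_carrier dsum_intertwines(1)[OF tx ty, folded z_def] that(1) _ that(3), of i] that
    by (simp add: inl_mat_def delta_mult)
  have \<Phi>y: "\<Phi> (l,y,i,j) = \<Phi> (l,z,n + i,n + j)" if "l < k" "i < m" "j < m" for l i j
    using int[OF n(2) y inr_mat_carrier dsum_intertwines(2)[OF tx ty, folded z_def] that(1) _ that(3), of "n + i"] that
    by (simp add: inr_mat_def delta_mult)
  show "\<Phi> \<in> left_inverse_at k \<psi> n x"
    unfolding left_inverse_at_def
  proof (intro CollectI allI impI)
    fix i j assume ij: "i < n" "j < n"
    have "(\<Sum>l<k. \<Sum>i'<n. \<Phi> (l,x,i,i') * \<psi> l x $$ (i',j)) = (\<Sum>l<k. \<Sum>i'<n + m. \<Phi> (l,z,i,i') * \<psi> l z $$ (i',j))"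
    proof (rule sum.cong[OF refl])
      fix l assume "l \<in> {..<k}"
      then have l: "l < k" by simp
      have e: "\<psi> l z $$ (i',j) = (if i' < n then \<psi> l x $$ (i',j) else 0)" if "i' < n + m" for i'
        using that ij \<psi>x[OF l] \<psi>y[OF l] by (auto simp: \<psi>z[OF l])
      show "(\<Sum>i'<n. \<Phi> (l,x,i,i') * \<psi> l x $$ (i',j)) = (\<Sum>i'<n + m. \<Phi> (l,z,i,i') * \<psi> l z $$ (i',j))"
        unfolding sum_lessThan_add using ij l by (simp add: e \<Phi>x)
    qed
    then show "(\<Sum>l<k. \<Sum>i'<n. \<Phi> (l,x,i,i') * \<psi> l x $$ (i',j)) = (if i = j then 1 else 0)"
      using Z[of i j] ij by simp
  qed
  show "\<Phi> \<in> left_inverse_at k \<psi> m y"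
    unfolding left_inverse_at_def
  proof (intro CollectI allI impI)
    fix i j assume ij: "i < m" "j < m"
    have "(\<Sum>l<k. \<Sum>i'<m. \<Phi> (l,y,i,i') * \<psi> l y $$ (i',j)) = (\<Sum>l<k. \<Sum>i'<n + m. \<Phi> (l,z,n + i,i') * \<psi> l z $$ (i',n + j))"
    proof (rule sum.cong[OF refl])
      fix l assume "l \<in> {..<k}"
      then have l: "l < k" by simp
      have e: "\<psi> l z $$ (i',n + j) = (if i' < n then 0 else \<psi> l y $$ (i' - n,j))" if "i' < n + m" for i'
        using that ij \<psi>x[OF l] \<psi>y[OF l] by (auto simp: \<psi>z[OF l])
      show "(\<Sum>i'<m. \<Phi> (l,y,i,i') * \<psi> l y $$ (i',j)) = (\<Sum>i'<n + m. \<Phi> (l,z,n + i,i') * \<psi> l z $$ (i',n + j))"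
        unfolding sum_lessThan_add using ij l by (simp add: e \<Phi>y)
    qed
    then show "(\<Sum>l<k. \<Sum>i'<m. \<Phi> (l,y,i,i') * \<psi> l y $$ (i',j)) = (if i = j then 1 else 0)"
      using Z[of "n + i" "n + j"] ij by simp
  qed
qed

text \<open>Recovers the size from the point alone. It is meaningful for nonempty tuples only, which
  is why d = 0 is treated apart.\<close>

definition tuple_size :: "complex mat list \<Rightarrow> nat" where
  "tuple_size x = dim_row (hd x)"

lemma tuple_size_eq: "d \<ge> 1 \<Longrightarrow> n \<ge> 1 \<Longrightarrow> x \<in> G_delta d r s \<delta> n \<Longrightarrow> tuple_size x = n"
  by (cases x) (auto simp: G_delta_iff tuple_of_def tuple_size_def)

text \<open>The one-point transfer function is contractive and sends \<psi>(x) to \<epsilon> I;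
  scaling it by 1/\<epsilon> gives the left inverse together with the norm bound.\<close>

lemma nc_contractive_left_inverse:
  assumes d: "d \<ge> 1" and fp: "fp_matrix d r s \<delta>" and \<psi>: "\<And>l. l < k \<Longrightarrow> H_inf d r s \<delta> (\<psi> l)"
    and \<epsilon>: "\<epsilon> > 0"
    and hyp: "\<And>m z v. m \<ge> 1 \<Longrightarrow> z \<in> G_delta d r s \<delta> m \<Longrightarrow>
      \<epsilon>\<^sup>2 * nsq {..<m} v \<le> (\<Sum>l<k. nsq {..<m} (\<lambda>i. \<Sum>j<m. \<psi> l z $$ (i,j) * v j))"
    and n: "n \<ge> 1" and x: "x \<in> G_delta d r s \<delta> n"
  shows "{\<Phi>. \<forall>w. \<Phi> w \<in> cball 0 (1 / \<epsilon>)} \<inter> nc_contractive d r s \<delta> k (1 / \<epsilon>) \<inter> left_inverse_at k \<psi> n x \<noteq> {}"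
proof -
  obtain T where T: "nc_transfer r s k T"
    and Tx: "\<And>i j. i < n \<Longrightarrow> j < n \<Longrightarrow>
      (\<Sum>l<k. \<Sum>i'<n. T (delta_entry \<delta> n x) n l i i' * \<psi> l x $$ (i',j)) = (if i = j then of_real \<epsilon> else 0)"
    using single_point_solution[OF fp \<psi> hyp n x] by blast
  have Tc: "nsq {..<m} (\<lambda>i. \<Sum>l<k. \<Sum>j<m. T D m l i j * u l j) \<le> (\<Sum>l<k. nsq {..<m} (u l))"
    if "strict_contr r s m D" for D m u
    using T that unfolding nc_transfer_def by blast
  \<comment> \<open>An index that names no entry at a point of the domain gets the value 0, so that
    every coordinate lies in the disc needed for compactness.\<close>
  define valid where "valid = (\<lambda>(l,y,i,j). l < k \<and> tuple_size y \<ge> 1 \<and> y \<in> G_delta d r s \<delta> (tuple_size y)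
      \<and> i < tuple_size y \<and> j < tuple_size y)"
  define \<Phi> where "\<Phi> w = (if valid w then (case w of (l,y,i,j) \<Rightarrow>
      of_real (1 / \<epsilon>) * T (delta_entry \<delta> (tuple_size y) y) (tuple_size y) l i j) else 0)" for w
  have \<Phi>e: "\<Phi> (l,y,i,j) = of_real (1 / \<epsilon>) * T (delta_entry \<delta> m y) m l i j"
    if "m \<ge> 1" "y \<in> G_delta d r s \<delta> m" "l < k" "i < m" "j < m" for l y i j m
    using that tuple_size_eq[OF d that(1,2)] by (simp add: \<Phi>_def valid_def)
  have sc: "strict_contr r s m (delta_entry \<delta> m y)" if "m \<ge> 1" "y \<in> G_delta d r s \<delta> m" for m y
    using that by (simp add: G_delta_iff)
  have row: "nsq {..<m} (\<lambda>i. \<Sum>l<k. \<Sum>j<m. \<Phi> (l,y,i,j) * u l j) \<le> (1 / \<epsilon>)\<^sup>2 * (\<Sum>l<k. nsq {..<m} (u l))"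
    if my: "m \<ge> 1" "y \<in> G_delta d r s \<delta> m" for m y u
  proof -
    have "nsq {..<m} (\<lambda>i. \<Sum>l<k. \<Sum>j<m. \<Phi> (l,y,i,j) * u l j) =
      nsq {..<m} (\<lambda>i. of_real (1 / \<epsilon>) * (\<Sum>l<k. \<Sum>j<m. T (delta_entry \<delta> m y) m l i j * u l j))"
      unfolding sum_distrib_left using my
      by (intro nsq_cong sum.cong[OF refl]) (simp add: \<Phi>e[OF my])
    also have "\<dots> = (1 / \<epsilon>)\<^sup>2 * nsq {..<m} (\<lambda>i. \<Sum>l<k. \<Sum>j<m. T (delta_entry \<delta> m y) m l i j * u l j)"
      by (rule nsq_scale)
    also have "\<dots> \<le> (1 / \<epsilon>)\<^sup>2 * (\<Sum>l<k. nsq {..<m} (u l))"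
      by (intro mult_left_mono Tc sc my) simp
    finally show ?thesis .
  qed
  have "\<Phi> \<in> nc_contractive d r s \<delta> k (1 / \<epsilon>)"
    unfolding nc_contractive_def
  proof (intro CollectI conjI allI impI ballI)
    fix n' m x y W l i j
    assume nm: "n' \<ge> 1" "m \<ge> 1" and x: "x \<in> G_delta d r s \<delta> n'" and y: "y \<in> G_delta d r s \<delta> m"
      and W: "W \<in> carrier_mat m n'" and i: "intertwines d W x y" and l: "l < k" and ij: "i < m" "j < n'"
    have tx: "tuple_of d n' x" and ty: "tuple_of d m y" using x y nm by (auto simp: G_delta_iff)
    have "(\<Sum>i'<n'. W $$ (i,i') * \<Phi> (l,x,i',j)) = of_real (1 / \<epsilon>) * (\<Sum>i'<n'. W $$ (i,i') * T (delta_entry \<delta> n' x) n' l i' j)"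
      unfolding sum_distrib_left using l ij by (intro sum.cong[OF refl]) (simp add: \<Phi>e[OF nm(1) x])
    also have "(\<Sum>i'<n'. W $$ (i,i') * T (delta_entry \<delta> n' x) n' l i' j) = (\<Sum>i'<m. T (delta_entry \<delta> m y) m l i i' * W $$ (i',j))"
    proof -
      have "\<forall>b<r. \<forall>a<s. \<forall>i<m. \<forall>j<n'. (\<Sum>i'<n'. W $$ (i,i') * delta_entry \<delta> n' x b a i' j)
          = (\<Sum>i'<m. delta_entry \<delta> m y b a i i' * W $$ (i',j))"
        using delta_entry_intertwine[OF tx ty W i fp] by blast
      then show ?thesis
        using T[unfolded nc_transfer_def, THEN conjunct2, rule_format, where W="\<lambda>i j. W $$ (i,j)",
            OF sc[OF nm(1) x] sc[OF nm(2) y] _ l ij] by blast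
    qed
    also have "of_real (1 / \<epsilon>) * \<dots> = (\<Sum>i'<m. \<Phi> (l,y,i,i') * W $$ (i',j))"
      unfolding sum_distrib_left using l ij by (intro sum.cong[OF refl]) (simp add: \<Phi>e[OF nm(2) y])
    finally show "(\<Sum>i'<n'. W $$ (i,i') * \<Phi> (l,x,i',j)) = (\<Sum>i'<m. \<Phi> (l,y,i,i') * W $$ (i',j))" .
  qed (rule row)
  moreover have "\<Phi> \<in> left_inverse_at k \<psi> n x"
    unfolding left_inverse_at_def
  proof (intro CollectI allI impI)
    fix i j assume ij: "i < n" "j < n"
    have "(\<Sum>l<k. \<Sum>i'<n. \<Phi> (l,x,i,i') * \<psi> l x $$ (i',j)) =
      of_real (1 / \<epsilon>) * (\<Sum>l<k. \<Sum>i'<n. T (delta_entry \<delta> n x) n l i i' * \<psi> l x $$ (i',j))"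
      unfolding sum_distrib_left using ij by (intro sum.cong[OF refl]) (simp add: \<Phi>e[OF n x])
    then show "(\<Sum>l<k. \<Sum>i'<n. \<Phi> (l,x,i,i') * \<psi> l x $$ (i',j)) = (if i = j then 1 else 0)"
      using \<epsilon> ij by (simp add: Tx)
  qed
  moreover have "\<Phi> w \<in> cball 0 (1 / \<epsilon>)" for w
  proof (cases "valid w")
    case True
    then obtain l y i j where w: "w = (l,y,i,j)" by (cases w) auto
    define m where "m = tuple_size y"
    have l: "l < k" and my: "m \<ge> 1" "y \<in> G_delta d r s \<delta> m" and ij: "i < m" "j < m"
      using True by (auto simp: w valid_def m_def)
    define u where "u l' j' = (if l' = l then if j' = j then 1 else 0 else 0 :: complex)" for l' j'
    have "(\<Sum>l'<k. \<Sum>j'<m. \<Phi> (l',y,i,j') * u l' j') = \<Phi> (l,y,i,j)"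
    proof -
      have "(\<Sum>l'<k. \<Sum>j'<m. \<Phi> (l',y,i,j') * u l' j') =
        (\<Sum>l'<k. if l' = l then (\<Sum>j'<m. if j' = j then \<Phi> (l',y,i,j') else 0) else 0)"
        by (intro sum.cong[OF refl]) (simp add: u_def delta_mult)
      then show ?thesis using l ij by simp
    qed
    then have "(cmod (\<Phi> (l,y,i,j)))\<^sup>2 \<le> nsq {..<m} (\<lambda>i. \<Sum>l<k. \<Sum>j<m. \<Phi> (l,y,i,j) * u l j)"
      unfolding nsq_def using ij
        member_le_sum[of i "{..<m}" "\<lambda>i. (cmod (\<Sum>l<k. \<Sum>j<m. \<Phi> (l,y,i,j) * u l j))\<^sup>2"] by simp
    also have "\<dots> \<le> (1 / \<epsilon>)\<^sup>2 * (\<Sum>l<k. nsq {..<m} (u l))" by (rule row[OF my])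
    also have "(\<Sum>l<k. nsq {..<m} (u l)) = 1"
    proof -
      have "nsq {..<m} (u l') = (\<Sum>j'<m. if j' = j then if l' = l then 1 else 0 else 0)" for l'
        unfolding nsq_def by (intro sum.cong[OF refl]) (simp add: u_def)
      then have "nsq {..<m} (u l') = (if l' = l then 1 else 0)" for l' using ij by simp
      then show ?thesis using l by simp
    qed
    finally have "(cmod (\<Phi> w))\<^sup>2 \<le> (1 / \<epsilon>)\<^sup>2" by (simp only: w mult_1_right)
    then have "cmod (\<Phi> w) \<le> 1 / \<epsilon>" by (rule power2_le_imp_le) (use \<epsilon> in simp)
    then show ?thesis by simp
  next
    case False
    then show ?thesis using \<epsilon> by (simp add: \<Phi>_def)
  qed
  ultimately show ?thesis by blast
qed

text \<open>The finite intersection property in the compact set \<open>K\<close>: finitely many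
  one-point constraints all follow from the constraint at one direct sum, and that one can be met
  within \<open>K\<close>.\<close>

theorem corona_solution_entries:
  assumes d: "d \<ge> 1" and fp: "fp_matrix d r s \<delta>" and \<psi>: "\<And>l. l < k \<Longrightarrow> H_inf d r s \<delta> (\<psi> l)"
    and \<epsilon>: "\<epsilon> > 0"
    and hyp: "\<And>m z v. m \<ge> 1 \<Longrightarrow> z \<in> G_delta d r s \<delta> m \<Longrightarrow>
      \<epsilon>\<^sup>2 * nsq {..<m} v \<le> (\<Sum>l<k. nsq {..<m} (\<lambda>i. \<Sum>j<m. \<psi> l z $$ (i,j) * v j))"
  shows "\<exists>\<Phi>\<in>nc_contractive d r s \<delta> k (1 / \<epsilon>).
    \<forall>n\<ge>1. \<forall>x\<in>G_delta d r s \<delta> n. \<Phi> \<in> left_inverse_at k \<psi> n x"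
proof -
  define K where "K = {\<Phi>. \<forall>w. \<Phi> w \<in> cball 0 (1 / \<epsilon>)} \<inter> nc_contractive d r s \<delta> k (1 / \<epsilon>)"
  define X where "X = {p. fst p \<ge> 1 \<and> snd p \<in> G_delta d r s \<delta> (fst p)}"
  define L where "L p = left_inverse_at k \<psi> (fst p) (snd p)" for p
  have K: "compact K"
    unfolding K_def by (intro compact_Int_closed compact_function_box closed_nc_contractive) simp
  have K0: "(\<lambda>_. 0) \<in> K"
    using \<epsilon> by (auto simp: K_def nc_contractive_def nsq_def intro!: mult_nonneg_nonneg sum_nonneg)
  have ne: "K \<inter> L p \<noteq> {}" if "p \<in> X" for p
    using nc_contractive_left_inverse[OF d fp \<psi> \<epsilon> hyp] that unfolding K_def L_def X_def by blast
  \<comment> \<open>The empty family is set apart because \<open>X\<close> may be empty; the zero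
    function serves it.\<close>
  have dir: "Y = {} \<or> (\<exists>p\<in>X. K \<inter> L p \<subseteq> (\<Inter>q\<in>Y. L q))" if "finite Y" "Y \<subseteq> X" for Y
    using that
  proof (induction Y rule: finite_induct)
    case (insert q Y)
    show ?case
    proof (cases "Y = {}")
      case True
      then show ?thesis using insert.prems by auto
    next
      case False
      then obtain p where p: "p \<in> X" "K \<inter> L p \<subseteq> (\<Inter>q\<in>Y. L q)" using insert by auto
      have q: "q \<in> X" using insert.prems by simp
      define n where "n = fst q"
      define m where "m = fst p"
      have nm: "n \<ge> 1" "m \<ge> 1" "snd q \<in> G_delta d r s \<delta> n" "snd p \<in> G_delta d r s \<delta> m"
        using p(1) q by (auto simp: X_def n_def m_def)
      define z where "z = (n + m, dsum n m (snd q) (snd p))"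
      have "z \<in> X" using dsum_in_G[OF fp nm] nm by (simp add: X_def z_def)
      moreover have "\<Phi> \<in> L q \<and> \<Phi> \<in> L p" if "\<Phi> \<in> K \<inter> L z" for \<Phi>
        using left_inverse_at_dsum[OF fp \<psi> nm, where \<Phi>=\<Phi> and c="1 / \<epsilon>"] that
        by (simp add: K_def L_def z_def n_def m_def)
      ultimately show ?thesis using p(2) by blast
    qed
  qed simp
  have "K \<inter> (\<Inter>p\<in>X. L p) \<noteq> {}"
  proof (rule compact_imp_fip_image[OF K])
    show "closed (L p)" for p unfolding L_def by (rule closed_left_inverse_at)
    fix Y assume Y: "finite Y" "Y \<subseteq> X"
    from dir[OF Y] show "K \<inter> (\<Inter>q\<in>Y. L q) \<noteq> {}"
    proof
      assume "Y = {}"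
      then show ?thesis using K0 by auto
    next
      assume "\<exists>p\<in>X. K \<inter> L p \<subseteq> (\<Inter>q\<in>Y. L q)"
      then obtain p where p: "p \<in> X" "K \<inter> L p \<subseteq> (\<Inter>q\<in>Y. L q)" by blast
      obtain \<Phi> where "\<Phi> \<in> K \<inter> L p" using ne[OF p(1)] by blast
      then have "\<Phi> \<in> K \<inter> (\<Inter>q\<in>Y. L q)" using p(2) by (meson IntD1 IntI subsetD)
      then show ?thesis by (metis empty_iff)
    qed
  qed
  then obtain \<Phi> where "\<Phi> \<in> K" "\<And>p. p \<in> X \<Longrightarrow> \<Phi> \<in> L p" by blast
  then show ?thesis by (intro bexI[of _ \<Phi>]) (auto simp: K_def X_def L_def)
qed

theorem theorem8p16:
  fixes d r s k :: nat
    and \<delta> :: "nat \<Rightarrow> nat \<Rightarrow> nat list \<Rightarrow> complex"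
    and \<psi> :: "nat \<Rightarrow> complex mat list \<Rightarrow> complex mat"
    and \<epsilon> :: real
  assumes "fp_matrix d r s \<delta>"
    and "\<forall>j<k. H_inf d r s \<delta> (\<psi> j)"
    and "\<epsilon> > 0"
    and "\<forall>n\<ge>1. \<forall>x\<in>G_delta d r s \<delta> n.
           loewner_le n ((\<epsilon>\<^sup>2 :: complex) \<cdot>\<^sub>m 1\<^sub>m n)
             (msum n (\<lambda>j. mat_adjoint (\<psi> j x) * \<psi> j x) {..<k})"
  shows "\<exists>\<omega> :: nat \<Rightarrow> complex mat list \<Rightarrow> complex mat.
           (\<forall>j<k. H_inf d r s \<delta> (\<omega> j)) \<and>
           (\<forall>n\<ge>1. \<forall>x\<in>G_delta d r s \<delta> n. opnorm (row_op n k (\<lambda>j. \<omega> j x)) \<le> 1 / \<epsilon>) \<and>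
           (\<forall>n\<ge>1. \<forall>x\<in>G_delta d r s \<delta> n.
              msum n (\<lambda>j. \<omega> j x * \<psi> j x) {..<k} = 1\<^sub>m n)"
proof -
  note fp = assms(1) and \<epsilon> = assms(3)
  have \<psi>: "H_inf d r s \<delta> (\<psi> l)" if "l < k" for l using assms(2) that by simp
  have \<psi>c: "\<psi> l x \<in> carrier_mat n n" if "l < k" "n \<ge> 1" "x \<in> G_delta d r s \<delta> n" for l n x
    using \<psi>[OF that(1)] that unfolding H_inf_def by blast
  have hyp: "\<epsilon>\<^sup>2 * nsq {..<m} v \<le> (\<Sum>l<k. nsq {..<m} (\<lambda>i. \<Sum>j<m. \<psi> l z $$ (i,j) * v j))"
    if "m \<ge> 1" "z \<in> G_delta d r s \<delta> m" for m z v
    by (rule loewner_le_column) (use assms(4) \<psi>c that in auto)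
  show ?thesis
  proof (cases "d = 0")
    case True
    \<comment> \<open>For d = 0 the only point is the empty list, which would belong to the domain
      at size n and, as its own direct sum, at size 2n. The matrix \<open>\<psi> 0 []\<close> cannot
      have both sizes, and k = 0 is excluded by the lower bound. So the domain is empty at positive
      sizes, and \<psi> itself can serve as \<omega>.\<close>
    have "x \<notin> G_delta d r s \<delta> n" if n: "n \<ge> 1" for n x
    proof
      assume x: "x \<in> G_delta d r s \<delta> n"
      have "k \<noteq> 0"
      proof
        assume "k = 0"
        then have "\<epsilon>\<^sup>2 * real n \<le> 0" using hyp[OF n x, of "\<lambda>_. 1"] by (simp add: nsq_def)
        moreover have "0 < \<epsilon>\<^sup>2 * real n" using \<epsilon> n by simp
        ultimately show False by linarith
      qed
      then have k: "0 < k" by simp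
      have "x = []" using x n True by (simp add: G_delta_iff tuple_of_def)
      moreover from this have "dsum n n x x = []" by (simp add: dsum_def)
      ultimately have "\<psi> 0 [] \<in> carrier_mat n n" "\<psi> 0 [] \<in> carrier_mat (n + n) (n + n)"
        using \<psi>c[OF k n x] \<psi>c[OF k _ dsum_in_G[OF fp n n x x]] n by auto
      then have "n = n + n" using carrier_matD(1)[of "\<psi> 0 []"] by metis
      then show False using n by simp
    qed
    then show ?thesis by (intro exI[of _ \<psi>]) (use \<psi> in blast)
  next
    case False
    then have d: "d \<ge> 1" by simp
    obtain \<Phi> where \<Phi>: "\<Phi> \<in> nc_contractive d r s \<delta> k (1 / \<epsilon>)"
      and li: "\<And>n x. n \<ge> 1 \<Longrightarrow> x \<in> G_delta d r s \<delta> n \<Longrightarrow> \<Phi> \<in> left_inverse_at k \<psi> n x"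
      using corona_solution_entries[OF d fp \<psi> \<epsilon> hyp] by blast
    define \<omega> where "\<omega> l x = Matrix.mat (tuple_size x) (tuple_size x) (\<lambda>(i,j). \<Phi> (l,x,i,j))" for l x
    have \<omega>c: "\<omega> l x \<in> carrier_mat n n" if "n \<ge> 1" "x \<in> G_delta d r s \<delta> n" for l n x
      using tuple_size_eq[OF d that] by (simp add: \<omega>_def)
    have \<omega>e: "\<omega> l x $$ (i,j) = \<Phi> (l,x,i,j)" if "n \<ge> 1" "x \<in> G_delta d r s \<delta> n" "i < n" "j < n" for l n x i j
      using tuple_size_eq[OF d that(1,2)] that by (simp add: \<omega>_def)
    have row: "nsq {..<n} (\<lambda>i. \<Sum>l<k. \<Sum>j<n. \<omega> l x $$ (i,j) * u l j) \<le> (1 / \<epsilon>)\<^sup>2 * (\<Sum>l<k. nsq {..<n} (u l))"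
      if nx: "n \<ge> 1" "x \<in> G_delta d r s \<delta> n" for n x u
    proof -
      have "nsq {..<n} (\<lambda>i. \<Sum>l<k. \<Sum>j<n. \<omega> l x $$ (i,j) * u l j) = nsq {..<n} (\<lambda>i. \<Sum>l<k. \<Sum>j<n. \<Phi> (l,x,i,j) * u l j)"
        by (intro nsq_cong sum.cong[OF refl]) (simp add: \<omega>e[OF nx])
      then show ?thesis using \<Phi> nx unfolding nc_contractive_def by simp
    qed
    have e0: "0 \<le> 1 / \<epsilon>" using \<epsilon> by simp
    have Hinf: "H_inf d r s \<delta> (\<omega> l)" if l: "l < k" for l
    proof (rule H_infI[where C="1 / \<epsilon>"])
      fix n m x y W
      assume nm: "n \<ge> (1::nat)" "m \<ge> (1::nat)" and x: "x \<in> G_delta d r s \<delta> n" and y: "y \<in> G_delta d r s \<delta> m"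
        and W: "W \<in> carrier_mat m n" and i: "intertwines d W x y"
      show "W * \<omega> l x = \<omega> l y * W"
      proof (rule eq_matI)
        fix i j assume "i < dim_row (\<omega> l y * W)" "j < dim_col (\<omega> l y * W)"
        then have ij: "i < m" "j < n" using W \<omega>c[OF nm(2) y, of l] by auto
        have "(\<Sum>i'<n. W $$ (i,i') * \<Phi> (l,x,i',j)) = (\<Sum>i'<m. \<Phi> (l,y,i,i') * W $$ (i',j))"
          using \<Phi> nm x y W i l ij unfolding nc_contractive_def by blast
        then show "(W * \<omega> l x) $$ (i,j) = (\<omega> l y * W) $$ (i,j)"
          unfolding mult_mat_entry[OF W \<omega>c[OF nm(1) x] ij] mult_mat_entry[OF \<omega>c[OF nm(2) y] W ij]
          using ij by (simp add: \<omega>e[OF nm(1) x] \<omega>e[OF nm(2) y])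
      qed (use W \<omega>c[OF nm(1) x, of l] \<omega>c[OF nm(2) y, of l] in auto)
    next
      fix n x assume nx: "n \<ge> (1::nat)" "x \<in> G_delta d r s \<delta> n"
      show "opnorm (\<omega> l x) \<le> 1 / \<epsilon>"
      proof (rule opnorm_le[OF \<omega>c[OF nx] e0])
        fix g :: "nat \<Rightarrow> complex"
        define u where "u l' = (if l' = l then g else (\<lambda>_. 0))" for l'
        have 1: "(\<Sum>l'<k. \<Sum>j<n. \<omega> l' x $$ (i,j) * u l' j) = (\<Sum>j<n. \<omega> l x $$ (i,j) * g j)" for i
        proof -
          have "(\<Sum>l'<k. \<Sum>j<n. \<omega> l' x $$ (i,j) * u l' j) = (\<Sum>l'<k. if l' = l then \<Sum>j<n. \<omega> l' x $$ (i,j) * g j else 0)"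
            by (intro sum.cong[OF refl]) (simp add: u_def)
          then show ?thesis using l by simp
        qed
        have 2: "(\<Sum>l'<k. nsq {..<n} (u l')) = nsq {..<n} g"
        proof -
          have "nsq {..<n} (u l') = (if l' = l then nsq {..<n} g else 0)" for l'
            by (simp add: u_def nsq_def)
          then show ?thesis using l by simp
        qed
        show "nsq {..<n} (\<lambda>i. \<Sum>j<n. \<omega> l x $$ (i,j) * g j) \<le> (1 / \<epsilon>)\<^sup>2 * nsq {..<n} g"
          using row[OF nx, of u] unfolding 1 2 .
      qed
    qed (rule \<omega>c)
    moreover have "opnorm (row_op n k (\<lambda>j. \<omega> j x)) \<le> 1 / \<epsilon>" if nx: "n \<ge> 1" "x \<in> G_delta d r s \<delta> n" for n x
    proof (rule opnorm_le[of _ n "k * n"])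
      show "row_op n k (\<lambda>j. \<omega> j x) \<in> carrier_mat n (k * n)" by (simp add: row_op_def mult.commute)
      fix g
      have e: "row_op n k (\<lambda>j. \<omega> j x) $$ (i, l * n + j) = \<omega> l x $$ (i,j)" if "i < n" "l < k" "j < n" for i l j
        using that block_less[of l k j n] by (simp add: row_op_def mult.commute)
      have "nsq {..<n} (\<lambda>i. \<Sum>j<k * n. row_op n k (\<lambda>j. \<omega> j x) $$ (i,j) * g j) =
        nsq {..<n} (\<lambda>i. \<Sum>l<k. \<Sum>j<n. \<omega> l x $$ (i,j) * g (l * n + j))"
        unfolding sum_blocks by (intro nsq_cong sum.cong[OF refl]) (simp add: e)
      also have "\<dots> \<le> (1 / \<epsilon>)\<^sup>2 * (\<Sum>l<k. nsq {..<n} (\<lambda>j. g (l * n + j)))" by (rule row[OF nx])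
      also have "(\<Sum>l<k. nsq {..<n} (\<lambda>j. g (l * n + j))) = nsq {..<k * n} g"
        unfolding nsq_def sum_blocks ..
      finally show "nsq {..<n} (\<lambda>i. \<Sum>j<k * n. row_op n k (\<lambda>j. \<omega> j x) $$ (i,j) * g j)
          \<le> (1 / \<epsilon>)\<^sup>2 * nsq {..<k * n} g" .
    qed (rule e0)
    moreover have "msum n (\<lambda>j. \<omega> j x * \<psi> j x) {..<k} = 1\<^sub>m n" if nx: "n \<ge> 1" "x \<in> G_delta d r s \<delta> n" for n x
    proof (rule eq_matI)
      fix i j assume "i < dim_row (1\<^sub>m n :: complex mat)" "j < dim_col (1\<^sub>m n :: complex mat)"
      then have ij: "i < n" "j < n" by auto
      have "msum n (\<lambda>j. \<omega> j x * \<psi> j x) {..<k} $$ (i,j) = (\<Sum>l<k. (\<omega> l x * \<psi> l x) $$ (i,j))"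
        using ij by (simp add: msum_def)
      also have "\<dots> = (\<Sum>l<k. \<Sum>i'<n. \<Phi> (l,x,i,i') * \<psi> l x $$ (i',j))"
      proof (rule sum.cong[OF refl])
        fix l assume "l \<in> {..<k}"
        then have l: "l < k" by simp
        show "(\<omega> l x * \<psi> l x) $$ (i,j) = (\<Sum>i'<n. \<Phi> (l,x,i,i') * \<psi> l x $$ (i',j))"
          unfolding mult_mat_entry[OF \<omega>c[OF nx] \<psi>c[OF l nx] ij] using ij by (simp add: \<omega>e[OF nx])
      qed
      also have "\<dots> = (if i = j then 1 else 0)"
        using li[OF nx] ij unfolding left_inverse_at_def by blast
      finally show "msum n (\<lambda>j. \<omega> j x * \<psi> j x) {..<k} $$ (i,j) = 1\<^sub>m n $$ (i,j)" using ij by simp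
    qed (auto simp: msum_def)
    ultimately show ?thesis by blast
  qed
qed

end
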